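(* A non-empty subset $\Gamma$ of $\mathbb{C}$ is a somewhere hypercyclic scalar set if and only if $\overline{\Gamma\mathbb{T}}\setminus\{0\}$ is non-empty, bounded and bounded away from $0$ and has an empty interior.
   Context: $\mathbb{T}=\{z\in\mathbb{C}:|z|=1\}$, $\Gamma\mathbb{T}=\{\gamma z:\ \gamma\in\Gamma,\ |z|=1\}$, and $\overline{\Gamma\mathbb{T}}$ is its closure in $\mathbb{C}$; interiors of subsets of $\mathbb{C}$ are taken in $\mathbb{C}$. A set $A\subset\mathbb{C}$ is bounded away from $0$ if there is $\delta>0$ such that $|z|\ge\delta$ for all $z\in A$. For a complex Banach space $X$, $L(X)$ denotes the space of bounded linear operators on $X$. For $T\in L(X)$, $x\in X$ and a non-empty set $\Gamma\subset\mathbb{C}$, put $\mathrm{Orb}(\Gamma x,T)=\{\gamma T^n x:\ \gamma\in\Gamma,\ n\ge 0\}$. A vector $x\in X$ is hypercyclic for $T$ if $\{T^n x: n\ge 0\}$ is dense in $X$. A subset of $X$ is somewhere dense in $X$ if its closure has non-empty interior. A set $\Gamma\subset\mathbb{C}$ is called a somewhere hypercyclic scalar set if the following holds: for every infinite-dimensional complex Banach space $X$, every $T\in L(X)$ and every $x\in X$, the set $\mathrm{Orb}(\Gamma x,T)$ is somewhere dense in $X$ if and only if $x$ is hypercyclic for $T$. *)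

theory Defs
  imports "HOL-Analysis.Analysis" "HOL-Algebra.Module"
begin

text \<open>
  The notion of a somewhere hypercyclic scalar set quantifies over all infinite-dimensional complex
  Banach spaces, so a Banach space has to be a term rather than a type of some class. It is
  rendered as a module over the ring of complex numbers in the sense of HOL-Algebra, together with
  a norm. The ring-multiplication and unit fields inherited from the record \<^type>\<open>module\<close> are not
  used: the locale \<open>Module.module\<close> puts no condition on them.
\<close>

definition complex_ring :: "complex ring" where
  "complex_ring = \<lparr>carrier = UNIV, monoid.mult = (*), one = 1, ring.zero = 0, add = (+)\<rparr>"

record 'a normed_module = "(complex, 'a) module" +
  nrm :: "'a \<Rightarrow> real"

locale complex_normed_space = Module.module complex_ring X for X :: "'a normed_module" (structure) +
  assumes nrm_nonneg: "x \<in> carrier X \<Longrightarrow> 0 \<le> nrm X x"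
    and nrm_eq_0: "x \<in> carrier X \<Longrightarrow> nrm X x = 0 \<Longrightarrow> x = \<zero>\<^bsub>X\<^esub>"
    and nrm_smult: "x \<in> carrier X \<Longrightarrow> nrm X (c \<odot>\<^bsub>X\<^esub> x) = cmod c * nrm X x"
    and nrm_triangle:
      "x \<in> carrier X \<Longrightarrow> y \<in> carrier X \<Longrightarrow> nrm X (x \<oplus>\<^bsub>X\<^esub> y) \<le> nrm X x + nrm X y"

text \<open>
  The locale \<^locale>\<open>Metric_space\<close> asks for nonnegativity and symmetry also outside the carrier,
  hence the case distinction.
\<close>

definition nrm_dist :: "'a normed_module \<Rightarrow> 'a \<Rightarrow> 'a \<Rightarrow> real" where
  "nrm_dist X x y = (if x \<in> carrier X \<and> y \<in> carrier X then nrm X (x \<ominus>\<^bsub>X\<^esub> y) else 0)"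

abbreviation nrm_topology :: "'a normed_module \<Rightarrow> 'a topology" where
  "nrm_topology X \<equiv> Metric_space.mtopology (carrier X) (nrm_dist X)"

lemma carrier_complex_ring [simp]: "carrier complex_ring = UNIV"
  by (simp add: complex_ring_def)

lemma (in complex_normed_space) nrm_zero: "nrm X \<zero>\<^bsub>X\<^esub> = 0"
  using nrm_smult[of "\<zero>\<^bsub>X\<^esub>" 0] by simp

lemma (in complex_normed_space) nrm_minus:
  assumes "x \<in> carrier X" shows "nrm X (\<ominus>\<^bsub>X\<^esub> x) = nrm X x"
proof -
  have "\<ominus>\<^bsub>complex_ring\<^esub> \<one>\<^bsub>complex_ring\<^esub> = -1"
    by (rule R.minus_equality) (simp_all add: complex_ring_def)
  then have "\<ominus>\<^bsub>X\<^esub> x = (-1) \<odot>\<^bsub>X\<^esub> x"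
    using smult_l_minus[of "\<one>\<^bsub>complex_ring\<^esub>" x] assms by simp
  then show ?thesis using nrm_smult[OF assms, of "-1"] by simp
qed

lemma (in complex_normed_space) Metric_space_nrm_dist: "Metric_space (carrier X) (nrm_dist X)"
proof
  fix x y
  show "0 \<le> nrm_dist X x y" by (simp add: nrm_dist_def nrm_nonneg)
  show "nrm_dist X x y = nrm_dist X y x"
  proof (cases "x \<in> carrier X \<and> y \<in> carrier X")
    case True
    then have "y \<ominus>\<^bsub>X\<^esub> x = \<ominus>\<^bsub>X\<^esub> (x \<ominus>\<^bsub>X\<^esub> y)"
      by (simp add: M.minus_eq M.minus_add M.a_comm)
    then show ?thesis using True by (simp add: nrm_dist_def nrm_minus)
  qed (auto simp: nrm_dist_def)
next
  fix x y assume xy: "x \<in> carrier X" "y \<in> carrier X"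
  have "x \<ominus>\<^bsub>X\<^esub> y = \<zero>\<^bsub>X\<^esub> \<longleftrightarrow> x = y"
    using xy by (metis M.minus_eq M.minus_equality M.minus_minus M.r_neg M.a_inv_closed)
  then show "nrm_dist X x y = 0 \<longleftrightarrow> x = y"
    using xy nrm_eq_0[of "x \<ominus>\<^bsub>X\<^esub> y"] by (auto simp: nrm_dist_def nrm_zero)
next
  fix x y z assume xyz: "x \<in> carrier X" "y \<in> carrier X" "z \<in> carrier X"
  then have "x \<ominus>\<^bsub>X\<^esub> z = (x \<ominus>\<^bsub>X\<^esub> y) \<oplus>\<^bsub>X\<^esub> (y \<ominus>\<^bsub>X\<^esub> z)"
    by (simp add: M.minus_eq M.a_assoc M.r_neg1)
  then show "nrm_dist X x z \<le> nrm_dist X x y + nrm_dist X y z"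
    using xyz nrm_triangle[of "x \<ominus>\<^bsub>X\<^esub> y" "y \<ominus>\<^bsub>X\<^esub> z"] by (simp add: nrm_dist_def)
qed

definition complex_banach_space :: "'a normed_module \<Rightarrow> bool" where
  "complex_banach_space X \<longleftrightarrow>
     complex_normed_space X \<and> Metric_space.mcomplete (carrier X) (nrm_dist X)"

definition infinite_dimensional :: "'a normed_module \<Rightarrow> bool" where
  "infinite_dimensional X \<longleftrightarrow>
     \<not> (\<exists>B. finite B \<and> B \<subseteq> carrier X \<and>
           (\<forall>x\<in>carrier X. \<exists>c. x = (\<Oplus>\<^bsub>X\<^esub>b\<in>B. c b \<odot>\<^bsub>X\<^esub> b)))"

text \<open>The values of an operator outside the carrier are irrelevant.\<close>

definition bounded_operators :: "'a normed_module \<Rightarrow> ('a \<Rightarrow> 'a) set" where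
  "bounded_operators X = {T. T \<in> carrier X \<rightarrow> carrier X
     \<and> (\<forall>x\<in>carrier X. \<forall>y\<in>carrier X. T (x \<oplus>\<^bsub>X\<^esub> y) = T x \<oplus>\<^bsub>X\<^esub> T y)
     \<and> (\<forall>c. \<forall>x\<in>carrier X. T (c \<odot>\<^bsub>X\<^esub> x) = c \<odot>\<^bsub>X\<^esub> T x)
     \<and> (\<exists>K. \<forall>x\<in>carrier X. nrm X (T x) \<le> K * nrm X x)}"

definition scalar_orbit ::
    "'a normed_module \<Rightarrow> complex set \<Rightarrow> 'a \<Rightarrow> ('a \<Rightarrow> 'a) \<Rightarrow> 'a set" where
  "scalar_orbit X \<Gamma> x T = {\<gamma> \<odot>\<^bsub>X\<^esub> (T ^^ n) x |\<gamma> n. \<gamma> \<in> \<Gamma>}"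

definition hypercyclic_vector :: "'a normed_module \<Rightarrow> ('a \<Rightarrow> 'a) \<Rightarrow> 'a \<Rightarrow> bool" where
  "hypercyclic_vector X T x \<longleftrightarrow>
     x \<in> carrier X \<and> nrm_topology X closure_of (range (\<lambda>n. (T ^^ n) x)) = carrier X"

definition somewhere_dense :: "'a normed_module \<Rightarrow> 'a set \<Rightarrow> bool" where
  "somewhere_dense X S \<longleftrightarrow> nrm_topology X interior_of (nrm_topology X closure_of S) \<noteq> {}"

text \<open>
  A formula cannot quantify over types, so the notion is relative to a type \<open>'a\<close> and ranges over
  all infinite-dimensional complex Banach spaces whose carrier is a subset of \<open>'a\<close>. If \<open>'a\<close> has
  cardinality less than the continuum there is no such space; otherwise every separable one
  has an isometric copy in \<open>'a\<close>. In a nonseparable space both sides of the equivalence below are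
  false, so the notion does not depend on the choice of a type of cardinality at least that of
  the continuum.
\<close>

definition somewhere_hypercyclic_scalar_set :: "'a itself \<Rightarrow> complex set \<Rightarrow> bool" where
  "somewhere_hypercyclic_scalar_set _ \<Gamma> \<longleftrightarrow>
     (\<forall>X :: 'a normed_module. complex_banach_space X \<longrightarrow> infinite_dimensional X \<longrightarrow>
        (\<forall>T\<in>bounded_operators X. \<forall>x\<in>carrier X.
           somewhere_dense X (scalar_orbit X \<Gamma> x T) \<longleftrightarrow> hypercyclic_vector X T x))"

definition circle_saturation :: "complex set \<Rightarrow> complex set" where
  "circle_saturation \<Gamma> = {\<gamma> * z |\<gamma> z. \<gamma> \<in> \<Gamma> \<and> cmod z = 1}"

definition bounded_away_from_0 :: "complex set \<Rightarrow> bool" where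
  "bounded_away_from_0 A \<longleftrightarrow> (\<exists>\<delta>>0. \<forall>z\<in>A. \<delta> \<le> cmod z)"

end

theory Submission
  imports Defs "HOL-Computational_Algebra.Fundamental_Theorem_Algebra"
begin

text \<open>
  If \<open>closure (\<Gamma>\<T>) - {0}\<close> is bounded, bounded away from 0 and nowhere dense, everything happens in the
  span of the orbit, that is, for the seminorm \<open>N p = \<parallel>p(T) x\<parallel>\<close> on complex polynomials, on which \<open>T\<close>
  acts as multiplication by the variable \<open>z\<close>. Let \<open>R\<close> be the compact nowhere dense set of moduli and \<open>\<omega>\<close>
  the set of limits of \<open>c z^m\<close> with \<open>|c| = 1\<close>, \<open>m \<rightarrow> \<infinity>\<close>. Evaluation at a point is unbounded, since otherwise
  it would map the open set in the closure of the orbit into a locally finite union of sets with moduli in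
  \<open>R |\<lambda>|^n\<close>; hence every nonzero polynomial has dense range. Every \<open>p\<close> in that open set lies in \<open>r\<omega>\<close> for some
  \<open>r\<close> in \<open>R\<close>. The scalings \<open>s > 0\<close> with \<open>s\<omega> \<subseteq> \<omega>\<close> form a closed semigroup, and nowhere density of \<open>R\<close> forces it to
  contain all \<open>s < 1\<close> or all \<open>s > 1\<close>; so \<open>\<omega>\<close> itself has interior. A connectedness argument in the style of
  Bourdon and Feldman shows that \<open>\<omega>\<close> is everything, and an argument in the style of Leon-Saavedra and
  Mueller removes the rotations.

  Conversely, the counterexamples live on \<open>c\<^sub>0\<close>. For unbounded \<open>\<Gamma>\<close> take the backward shift \<open>B\<close>, a contraction.
  For \<open>\<Gamma>\<close> accumulating at 0 take \<open>2B\<close> and a vector whose iterates have first coordinate of modulus at least 1.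
  If the closure has interior take the sum of an irrational rotation of the complex plane and \<open>2B\<close>.
\<close>

text \<open>Working with polynomials gives the limits a multiplication: products of limits of
  monomials are again limits of monomials. Neither \<open>\<Gamma>\<close> nor the set of its moduli
  is closed under multiplication, only the circle is. This is why the moduli are traded for the
  semigroup of scalings that preserve the rotation limits, and why rotations are removed only at the
  end, when the moduli are gone.

  Multiplication by the variable need not be invertible, so a power of it cannot simply be
  cancelled. It can be absorbed into another approximating monomial of larger degree, and for this
  the exponents have to be unbounded in the definition of a limit. The orbit closure itself offers
  no lower bound on exponents; monomials of low degree have to be excluded by perturbation, which in
  turn needs the seminorm to be definite.

  Boundedness of the moduli from above and from below has a second use besides compactness: one
  single factor moves all of them to the same prescribed side of 1, whichever half of the scalings
  is available.\<close>

hide_const (open) Module.smult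

section \<open>Closed subsemigroups of the real line\<close>

lemma interior_finite_Union_closed_empty:
  fixes A :: "'i \<Rightarrow> 'a::topological_space set"
  assumes "finite I" "\<And>i. i \<in> I \<Longrightarrow> closed (A i)" "\<And>i. i \<in> I \<Longrightarrow> interior (A i) = {}"
  shows "interior (\<Union>i\<in>I. A i) = {}"
  using assms by (induction I) (simp_all add: interior_closed_Un_empty_interior)

text \<open>The positive multiples of a small \<open>s\<close> form a net of mesh \<open>s\<close>,
  and a closed set containing arbitrarily fine nets contains everything.\<close>

lemma closed_add_semigroup_half_line:
  fixes \<Phi> :: "real set"
  assumes cl: "closed \<Phi>" and add: "\<And>s t. s \<in> \<Phi> \<Longrightarrow> t \<in> \<Phi> \<Longrightarrow> s + t \<in> \<Phi>"
    and small: "\<And>\<delta>. \<delta> > 0 \<Longrightarrow> \<exists>s\<in>\<Phi>. 0 < s \<and> s < \<delta>"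
  shows "{0<..} \<subseteq> \<Phi>"
proof
  fix x :: real assume "x \<in> {0<..}"
  then have x: "x > 0" by simp
  have "\<exists>y\<in>\<Phi>. dist y x < e" if "e > 0" for e
  proof -
    obtain s where s: "s \<in> \<Phi>" "0 < s" "s < min e x" using small[of "min e x"] x \<open>e > 0\<close> by auto
    have mult: "real (Suc n) * s \<in> \<Phi>" for n
    proof (induction n)
      case (Suc n)
      from add[OF this s(1)] show ?case by (simp add: algebra_simps)
    qed (use s in simp)
    define n where "n = nat \<lfloor>x / s\<rfloor>"
    \<comment> \<open>The choice \<open>s < x\<close> makes the multiple at least 1; 0 is not known
      to lie in \<open>\<Phi>\<close>.\<close>
    have "x / s \<ge> 1" using s by simp
    then have n: "n \<ge> 1" "real n = of_int \<lfloor>x / s\<rfloor>" by (auto simp: n_def le_nat_iff)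
    then obtain m where m: "n = Suc m" by (cases n) auto
    have "real n \<le> x / s" "x / s < real n + 1" using n(2) by linarith+
    then have "real n * s \<le> x" "x < real n * s + s" using s by (simp_all add: field_simps)
    then have "dist (real n * s) x < e" using s by (simp add: dist_real_def)
    then show ?thesis using mult[of m] m by blast
  qed
  then have "x \<in> closure \<Phi>" unfolding closure_approachable by blast
  then show "x \<in> \<Phi>" using cl by simp
qed

lemma closed_add_semigroup_half_line_neg:
  fixes \<Phi> :: "real set"
  assumes cl: "closed \<Phi>" and add: "\<And>s t. s \<in> \<Phi> \<Longrightarrow> t \<in> \<Phi> \<Longrightarrow> s + t \<in> \<Phi>"
    and small: "\<And>\<delta>. \<delta> > 0 \<Longrightarrow> \<exists>s\<in>\<Phi>. -\<delta> < s \<and> s < 0"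
  shows "{..<0} \<subseteq> \<Phi>"
proof -
  have "{0<..} \<subseteq> uminus ` \<Phi>"
  proof (rule closed_add_semigroup_half_line)
    show "closed (uminus ` \<Phi>)" using cl by (rule closed_negations)
    show "s + t \<in> uminus ` \<Phi>" if "s \<in> uminus ` \<Phi>" "t \<in> uminus ` \<Phi>" for s t
      using that add by (metis (no_types, lifting) imageE image_eqI minus_add_distrib)
    show "\<exists>s\<in>uminus ` \<Phi>. 0 < s \<and> s < \<delta>" if "\<delta> > 0" for \<delta>
      using small[OF that] by force
  qed
  then show ?thesis
  proof (intro subsetI)
    fix x :: real assume "x \<in> {..<0}"
    then have "- x \<in> uminus ` \<Phi>" using \<open>{0<..} \<subseteq> uminus ` \<Phi>\<close> by auto
    then show "x \<in> \<Phi>" by auto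
  qed
qed

text \<open>Arbitrarily small elements of one sign fill a half-line, which multiples of an element
  of the other sign spread over the whole line. Otherwise the least positive element generates
  everything by division with remainder.\<close>

lemma closed_add_semigroup_cases:
  fixes \<Phi> :: "real set"
  assumes cl: "closed \<Phi>" and add: "\<And>s t. s \<in> \<Phi> \<Longrightarrow> t \<in> \<Phi> \<Longrightarrow> s + t \<in> \<Phi>"
    and pos: "a \<in> \<Phi>" "a > 0" and neg: "b \<in> \<Phi>" "b < 0"
  shows "\<Phi> = UNIV \<or> (\<exists>\<alpha>>0. \<Phi> = range (\<lambda>k::int. of_int k * \<alpha>))"
proof -
  have mult: "real (Suc n) * s \<in> \<Phi>" if s: "s \<in> \<Phi>" for n s
  proof (induction n)
    case (Suc n)
    from add[OF this s] show ?case by (simp add: algebra_simps)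
  qed (use s in simp)
  show ?thesis
  proof (cases "(\<forall>\<delta>>0. \<exists>s\<in>\<Phi>. 0 < s \<and> s < \<delta>) \<or> (\<forall>\<delta>>0. \<exists>s\<in>\<Phi>. -\<delta> < s \<and> s < 0)")
    case True
    have "x \<in> \<Phi>" for x
      using True
    proof
      assume "\<forall>\<delta>>0. \<exists>s\<in>\<Phi>. 0 < s \<and> s < \<delta>"
      then have half: "{0<..} \<subseteq> \<Phi>"
        using closed_add_semigroup_half_line[of \<Phi>, OF cl add] by blast
      obtain n where "real n * (-b) > \<bar>x\<bar>" using reals_Archimedean3[of "-b"] neg by auto
      then have "x - real (Suc n) * b > 0" using neg by (auto simp: algebra_simps)
      then have "x - real (Suc n) * b \<in> \<Phi>" using half by auto
      from add[OF this mult[OF neg(1), of n]] show ?thesis by simp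
    next
      assume "\<forall>\<delta>>0. \<exists>s\<in>\<Phi>. -\<delta> < s \<and> s < 0"
      then have half: "{..<0} \<subseteq> \<Phi>"
        using closed_add_semigroup_half_line_neg[of \<Phi>, OF cl add] by blast
      obtain n where "real n * a > \<bar>x\<bar>" using reals_Archimedean3[of a] pos by auto
      then have "x - real (Suc n) * a < 0" using pos by (auto simp: algebra_simps)
      then have "x - real (Suc n) * a \<in> \<Phi>" using half by auto
      from add[OF this mult[OF pos(1), of n]] show ?thesis by simp
    qed
    then show ?thesis by blast
  next
    case False
    then obtain d1 d2 where d: "d1 > 0" "d2 > 0" "\<And>s. s \<in> \<Phi> \<Longrightarrow> s > 0 \<Longrightarrow> s \<ge> d1"
      "\<And>s. s \<in> \<Phi> \<Longrightarrow> s < 0 \<Longrightarrow> s \<le> -d2" by (meson not_less)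
    \<comment> \<open>Cutting at \<open>d1\<close> and \<open>-d2\<close> instead of 0 keeps both
      sets closed, so that their extrema are attained.\<close>
    define P where "P = {s \<in> \<Phi>. s \<ge> d1}"
    define M where "M = {s \<in> \<Phi>. s \<le> -d2}"
    have P: "closed P" "P \<noteq> {}" "bdd_below P" using cl pos d
      by (auto simp: P_def bdd_below_def intro!: closed_Collect_conj closed_Collect_le)
    have M: "closed M" "M \<noteq> {}" "bdd_above M" using cl neg d
      by (auto simp: M_def bdd_above_def intro!: closed_Collect_conj closed_Collect_le)
    define \<alpha> where "\<alpha> = Inf P"
    define \<beta> where "\<beta> = Sup M"
    have \<alpha>: "\<alpha> \<in> \<Phi>" "\<alpha> > 0" using closed_contains_Inf[OF P(2,3,1)] d(1) by (auto simp: \<alpha>_def P_def)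
    have \<beta>: "\<beta> \<in> \<Phi>" "\<beta> < 0" using closed_contains_Sup[OF M(2,3,1)] d(2) by (auto simp: \<beta>_def M_def)
    have min: "s \<ge> \<alpha>" if "s \<in> \<Phi>" "s > 0" for s
      unfolding \<alpha>_def using that d(3)[OF that] P(3) by (intro cInf_lower) (auto simp: P_def)
    have max: "s \<le> \<beta>" if "s \<in> \<Phi>" "s < 0" for s
      unfolding \<beta>_def using that d(4)[OF that] M(3) by (intro cSup_upper) (auto simp: M_def)
    \<comment> \<open>The sum \<open>\<alpha> + \<beta>\<close> lies strictly between
      \<open>\<beta>\<close> and \<open>\<alpha>\<close>; the extremality of both leaves only the
      value 0.\<close>
    have \<alpha>\<beta>: "\<beta> = - \<alpha>"
      using min[OF add[OF \<alpha>(1) \<beta>(1)]] max[OF add[OF \<alpha>(1) \<beta>(1)]] \<alpha>(2) \<beta>(2) by linarith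
    have zero: "0 \<in> \<Phi>" using add[OF \<alpha>(1) \<beta>(1)] \<alpha>\<beta> by simp
    have int: "of_int k * \<alpha> \<in> \<Phi>" for k
    proof (cases k rule: int_cases3)
      case (pos n)
      then show ?thesis using mult[OF \<alpha>(1), of "n - 1"] by simp
    next
      case (neg n)
      then show ?thesis using mult[OF \<beta>(1), of "n - 1"] \<alpha>\<beta> by simp
    qed (use zero in simp)
    have "s \<in> range (\<lambda>k::int. of_int k * \<alpha>)" if s: "s \<in> \<Phi>" for s
    proof -
      define k where "k = \<lfloor>s / \<alpha>\<rfloor>"
      have "of_int k \<le> s / \<alpha>" "s / \<alpha> < of_int k + 1" unfolding k_def by linarith+
      then have k: "of_int k * \<alpha> \<le> s" "s < of_int k * \<alpha> + \<alpha>" using \<alpha>(2) by (simp_all add: field_simps)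
      have "s - of_int k * \<alpha> \<in> \<Phi>" using add[OF s int[of "-k"]] by simp
      with min[of "s - of_int k * \<alpha>"] k have "s = of_int k * \<alpha>" by force
      then show ?thesis by blast
    qed
    with int \<alpha>(2) show ?thesis by blast
  qed
qed

lemma closed_add_semigroup_translates_nowhere_dense:
  fixes \<Phi> R Q :: "real set"
  assumes cl: "closed \<Phi>" and add: "\<And>s t. s \<in> \<Phi> \<Longrightarrow> t \<in> \<Phi> \<Longrightarrow> s + t \<in> \<Phi>"
    and R: "compact R" "interior R = {}" and Q: "open Q" "Q \<inter> R \<noteq> {}"
    and cover: "\<And>t. t \<in> Q \<Longrightarrow> \<exists>r\<in>R \<inter> Q. t - r \<in> \<Phi>"
  shows "{0<..} \<subseteq> \<Phi> \<or> {..<0} \<subseteq> \<Phi>"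
  \<comment> \<open>If 0 is isolated in \<open>\<Phi>\<close>, points of \<open>Q - R\<close> near the supremum and the infimum of \<open>R \<inter> Q\<close> yield elements
    of \<open>\<Phi>\<close> of both signs. So \<open>\<Phi>\<close> is discrete and finitely many translates of \<open>R\<close> cover a ball in \<open>Q\<close>.\<close>
proof (rule ccontr)
  assume "\<not> ?thesis"
  then obtain d1 d2 where d12: "d1 > 0" "d2 > 0" "\<And>s. s \<in> \<Phi> \<Longrightarrow> s > 0 \<Longrightarrow> s \<ge> d1"
    "\<And>s. s \<in> \<Phi> \<Longrightarrow> s < 0 \<Longrightarrow> s \<le> -d2"
    using closed_add_semigroup_half_line[of \<Phi>, OF cl add]
      closed_add_semigroup_half_line_neg[of \<Phi>, OF cl add] by (metis not_less)
  define d where "d = min d1 d2"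
  have d: "d > 0" "\<And>s. s \<in> \<Phi> \<Longrightarrow> s \<noteq> 0 \<Longrightarrow> \<bar>s\<bar> \<ge> d"
    using d12 unfolding d_def by (force, smt (verit))
  have "bounded (R \<inter> Q)" using R(1) compact_imp_bounded bounded_subset inf_le1 by metis
  then have bdd: "bdd_above (R \<inter> Q)" "bdd_below (R \<inter> Q)"
    by (simp_all add: bounded_imp_bdd_above bounded_imp_bdd_below)
  have near: "\<exists>t\<in>Q - R. \<bar>t - r\<bar> < d / 2" if r: "r \<in> Q" for r
  proof -
    obtain e where e: "e > 0" "ball r e \<subseteq> Q" using Q(1) r open_contains_ball by blast
    have "\<not> ball r (min e (d/2)) \<subseteq> R"
      using R(2) interior_maximal[of "ball r (min e (d/2))" R] e d by fastforce
    then obtain t where "t \<in> ball r (min e (d/2))" and tR: "t \<notin> R" by blast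
    then have t: "dist r t < e" "dist r t < d / 2" by auto
    then have "t \<in> Q - R" "\<bar>t - r\<bar> < d / 2" using e(2) tR by (auto simp: dist_real_def abs_minus_commute)
    then show ?thesis by blast
  qed
  have ne: "R \<inter> Q \<noteq> {}" using Q(2) by blast
  obtain r1 where r1: "r1 \<in> R \<inter> Q" "r1 > Sup (R \<inter> Q) - d / 2"
    using less_cSupD[OF ne, of "Sup (R \<inter> Q) - d/2"] d(1) by auto
  obtain t1 where t1: "t1 \<in> Q - R" "\<bar>t1 - r1\<bar> < d / 2" using near r1 by blast
  obtain s1 where s1: "s1 \<in> R \<inter> Q" "t1 - s1 \<in> \<Phi>" using cover t1 by blast
  \<comment> \<open>Since \<open>t1 > Sup (R \<inter> Q) - d\<close>, the difference
    \<open>t1 - s1\<close> exceeds \<open>-d\<close>, and a non-zero element of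
    \<open>\<Phi>\<close> above \<open>-d\<close> is positive. The infimum gives the negative
    element in the same way.\<close>
  have "s1 \<le> Sup (R \<inter> Q)" using s1 bdd by (intro cSup_upper) auto
  moreover have "t1 \<noteq> s1" using s1 t1 by blast
  ultimately have pos: "t1 - s1 > 0" using d(2)[OF s1(2)] r1(2) t1(2) by linarith
  obtain r2 where r2: "r2 \<in> R \<inter> Q" "r2 < Inf (R \<inter> Q) + d / 2"
    using cInf_lessD[OF ne, of "Inf (R \<inter> Q) + d/2"] d(1) by auto
  obtain t2 where t2: "t2 \<in> Q - R" "\<bar>t2 - r2\<bar> < d / 2" using near r2 by blast
  obtain s2 where s2: "s2 \<in> R \<inter> Q" "t2 - s2 \<in> \<Phi>" using cover t2 by blast
  have "s2 \<ge> Inf (R \<inter> Q)" using s2 bdd by (intro cInf_lower) auto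
  moreover have "t2 \<noteq> s2" using s2 t2 by blast
  ultimately have neg: "t2 - s2 < 0" using d(2)[OF s2(2)] r2(2) t2(2) by linarith
  consider "\<Phi> = UNIV" | \<alpha> where "\<alpha> > 0" "\<Phi> = range (\<lambda>k::int. of_int k * \<alpha>)"
    using closed_add_semigroup_cases[of \<Phi>, OF cl add s1(2) pos s2(2) neg] by blast
  then show False
  proof cases
    case 1
    then show False using d(2)[of "d/2"] d(1) by simp
  next
    case (2 \<alpha>)
    obtain B where B: "\<And>r. r \<in> R \<Longrightarrow> \<bar>r\<bar> \<le> B"
      using compact_imp_bounded[OF R(1)] by (auto simp: bounded_iff)
    obtain e where e: "e > 0" "ball r1 e \<subseteq> Q" using Q(1) r1 open_contains_ball by blast
    \<comment> \<open>As \<open>R\<close> is bounded by \<open>B\<close>, translates by larger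
      multiples of \<open>\<alpha>\<close> miss the ball, so finitely many suffice.\<close>
    define K where "K = \<lceil>(\<bar>r1\<bar> + e + B) / \<alpha>\<rceil>"
    define A where "A k = (+) (of_int k * \<alpha>) ` R" for k :: int
    have "ball r1 e \<subseteq> (\<Union>k\<in>{-K..K}. A k)"
    proof
      fix t assume t: "t \<in> ball r1 e"
      then obtain r where r: "r \<in> R" "t - r \<in> \<Phi>" using cover e(2) by blast
      then obtain k where k: "t - r = of_int k * \<alpha>" using 2 by blast
      have "\<bar>t\<bar> \<le> \<bar>r1\<bar> + e" using t by (auto simp: dist_real_def)
      then have "\<bar>of_int k * \<alpha>\<bar> \<le> \<bar>r1\<bar> + e + B" using B[OF r(1)] k by linarith
      then have "\<bar>of_int k\<bar> \<le> (\<bar>r1\<bar> + e + B) / \<alpha>" using 2(1) by (simp add: abs_mult field_simps)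
      then have "\<bar>k\<bar> \<le> K" unfolding K_def by linarith
      moreover have "t \<in> A k" unfolding A_def using r(1) k by (intro image_eqI[of _ _ r]) auto
      ultimately show "t \<in> (\<Union>k\<in>{-K..K}. A k)" by (intro UN_I[of k]) auto
    qed
    moreover have "interior (\<Union>k\<in>{-K..K}. A k) = {}"
      unfolding A_def using R
      by (intro interior_finite_Union_closed_empty)
         (auto intro: compact_imp_closed compact_translation simp: interior_translation)
    ultimately have "ball r1 e = {}" using interior_maximal open_ball by blast
    then show False using e(1) by simp
  qed
qed

section \<open>Seminorms on polynomials\<close>

locale poly_seminorm =
  fixes N :: "complex poly \<Rightarrow> real" and K :: real
  assumes triangle: "N (p + q) \<le> N p + N q"
    and smult: "N (smult c p) = cmod c * N p"
    and shift: "N (pCons 0 p) \<le> K * N p"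
    and K_nonneg: "0 \<le> K"
begin

lemma N_0 [simp]: "N 0 = 0"
  using smult[of 0 0] by simp

lemma N_minus: "N (- p) = N p"
  using smult[of "-1" p] by simp

lemma N_nonneg: "0 \<le> N p"
  using triangle[of p "-p"] by (simp add: N_minus)

lemma N_commute: "N (p - q) = N (q - p)"
  using N_minus[of "p - q"] by simp

lemma N_diff_triangle: "N (p - r) \<le> N (p - q) + N (q - r)"
  using triangle[of "p - q" "q - r"] by simp

lemma N_diff: "N (p - q) \<le> N p + N q"
  using triangle[of p "-q"] by (simp add: N_minus)

lemma N_smult_diff: "N (smult a p - smult b p) = cmod (a - b) * N p"
  using smult[of "a - b" p] by (simp add: smult_diff_left)

lemma N_monom_diff: "N (monom a n - monom b n) = cmod (a - b) * N (monom 1 n)"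
  using N_smult_diff[of a "monom 1 n" b] by (simp add: smult_monom)

text \<open>A polynomial in a bounded operator is bounded, by Horner's scheme. Strict positivity of
  \<open>C\<close> allows tolerances to be divided by it.\<close>

lemma mult_bound: "\<exists>C>0. \<forall>q. N (p * q) \<le> C * N q"
proof (induction p)
  case 0
  show ?case by (rule exI[of _ 1]) (simp add: N_nonneg)
next
  case (pCons a p)
  obtain C where C: "C > 0" "\<And>q. N (p * q) \<le> C * N q" using pCons.IH by blast
  have "N (pCons a p * q) \<le> (cmod a + K * C + 1) * N q" for q
  proof -
    have "N (pCons a p * q) \<le> cmod a * N q + K * N (p * q)"
      using triangle[of "smult a q" "pCons 0 (p * q)"] shift[of "p * q"] by (simp add: smult)
    also have "\<dots> \<le> cmod a * N q + K * (C * N q)"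
      using C(2)[of q] K_nonneg by (simp add: mult_left_mono)
    also have "\<dots> \<le> (cmod a + K * C + 1) * N q" using N_nonneg[of q] by (simp add: algebra_simps)
    finally show ?thesis .
  qed
  moreover have "cmod a + K * C + 1 > 0" using C(1) K_nonneg by (simp add: add_nonneg_pos)
  ultimately show ?case by blast
qed

lemma continuous_on_N_monom: "continuous_on A (\<lambda>c. N (p - monom c m))"
proof (rule continuous_onI)
  fix c e :: real and x assume e: "(e::real) > 0" and "x \<in> A"
  define d where "d = e / (N (monom 1 m) + 1)"
  have d: "d > 0" using e N_nonneg[of "monom 1 m"] by (simp add: d_def add_nonneg_pos)
  have "dist (N (p - monom y m)) (N (p - monom x m)) \<le> e" if "dist y x < d" for y
  proof -
    have "\<bar>N (p - monom y m) - N (p - monom x m)\<bar> \<le> N (monom y m - monom x m)"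
      using N_diff_triangle[of p "monom y m" "monom x m"]
        N_diff_triangle[of p "monom x m" "monom y m"] N_commute[of "monom x m" "monom y m"] by linarith
    also have "\<dots> \<le> d * (N (monom 1 m) + 1)"
      using that d N_nonneg[of "monom 1 m"] by (auto simp: N_monom_diff dist_norm intro!: mult_mono)
    also have "\<dots> = e" using N_nonneg[of "monom 1 m"] by (simp add: d_def add_nonneg_eq_0_iff)
    finally show ?thesis by (simp add: dist_real_def)
  qed
  then show "\<exists>d>0. \<forall>x'\<in>A. dist x' x < d \<longrightarrow> dist (N (p - monom x' m)) (N (p - monom x m)) \<le> e"
    using d by blast
qed

text \<open>An omega-limit set: unbounded exponents allow any fixed power of the variable to be
  split off the approximating monomials. The coefficient set is a parameter because the proof passes
  from prescribed moduli to the unit circle and finally to \<open>{1}\<close>.\<close>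

definition monom_limits :: "complex set \<Rightarrow> complex poly set" where
  "monom_limits A = {p. \<forall>e>0. \<forall>n. \<exists>m\<ge>n. \<exists>c\<in>A. N (p - monom c m) < e}"

lemma monom_limitsD:
  "p \<in> monom_limits A \<Longrightarrow> e > 0 \<Longrightarrow> \<exists>m\<ge>n. \<exists>c\<in>A. N (p - monom c m) < e"
  by (simp add: monom_limits_def)

lemma monom_limits_closed:
  assumes "\<And>e. e > 0 \<Longrightarrow> \<exists>q\<in>monom_limits A. N (p - q) < e"
  shows "p \<in> monom_limits A"
  unfolding monom_limits_def
proof (intro CollectI allI impI)
  fix e :: real and n assume "e > 0"
  then obtain q where q: "q \<in> monom_limits A" "N (p - q) < e / 2" using assms[of "e/2"] by auto
  obtain m c where "m \<ge> n" "c \<in> A" "N (q - monom c m) < e / 2"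
    using monom_limitsD[OF q(1), of "e/2" n] \<open>e > 0\<close> by auto
  then show "\<exists>m\<ge>n. \<exists>c\<in>A. N (p - monom c m) < e"
    using N_diff_triangle[of p "monom c m" q] q(2) by (intro exI[of _ m]) force
qed

text \<open>If b z^m is close to Q and m is at least n, then P Q is close to b z^(m-n) (P z^n),
  hence to a monomial. Only P z^n, not P, has to be a limit; for Q = 1 this cancels a power of the
  variable.\<close>

lemma monom_limits_mult_tail:
  assumes P: "P * monom 1 n \<in> monom_limits A" and Q: "Q \<in> monom_limits B"
  shows "P * Q \<in> monom_limits {a * b |a b. a \<in> A \<and> b \<in> B}"
  unfolding monom_limits_def
proof (intro CollectI allI impI)
  fix e :: real and n0 assume "e > 0"
  obtain C where C: "C > 0" "\<And>q. N (P * q) \<le> C * N q" using mult_bound[of "P"] by blast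
  obtain m b where m: "m \<ge> n" "b \<in> B" "N (Q - monom b m) < e / (2 * C)"
    using monom_limitsD[OF Q, of "e / (2*C)" n] \<open>e > 0\<close> C(1) by auto
  \<comment> \<open>\<open>D\<close> depends on \<open>m\<close> and \<open>b\<close>, so the
    approximation of \<open>Q\<close> has to be fixed before that of
    \<open>P * monom 1 n\<close>.\<close>
  obtain D where D: "D > 0" "\<And>q. N (monom b (m - n) * q) \<le> D * N q" using mult_bound[of "monom b (m - n)"] by blast
  obtain k a where k: "k \<ge> n0" "a \<in> A" "N (P * monom 1 n - monom a k) < e / (2 * D)"
    using monom_limitsD[OF P, of "e / (2*D)" n0] \<open>e > 0\<close> D(1) by auto
  have "N (P * Q - P * monom b m) \<le> C * N (Q - monom b m)"
    using C(2)[of "Q - monom b m"] by (simp add: algebra_simps)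
  also have "\<dots> < e / 2" using m(3) C(1) by (simp add: field_simps)
  finally have 1: "N (P * Q - P * monom b m) < e / 2" .
  have eq: "monom b (m - n) * (P * monom 1 n - monom a k) = P * monom b m - monom (a * b) (k + (m - n))"
  proof -
    have "monom b (m - n) * monom 1 n = monom b m" using m(1) by (simp add: mult_monom)
    then have "monom b (m - n) * (P * monom 1 n) = P * monom b m" by (metis mult.left_commute)
    then show ?thesis by (simp add: right_diff_distrib mult_monom algebra_simps)
  qed
  have "N (P * monom b m - monom (a * b) (k + (m - n))) \<le> D * N (P * monom 1 n - monom a k)"
    using D(2)[of "P * monom 1 n - monom a k"] unfolding eq .
  also have "\<dots> < e / 2" using k(3) D(1) by (simp add: field_simps)
  finally have 2: "N (P * monom b m - monom (a * b) (k + (m - n))) < e / 2" .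
  have "N (P * Q - monom (a * b) (k + (m - n))) < e"
    using N_diff_triangle[of "P * Q" "monom (a * b) (k + (m - n))" "P * monom b m"] 1 2 by linarith
  then show "\<exists>m\<ge>n0. \<exists>c\<in>{a * b |a b. a \<in> A \<and> b \<in> B}. N (P * Q - monom c m) < e"
    using k(1,2) m(2) by (intro exI[of _ "k + (m - n)"]) auto
qed

lemma monom_limits_smult:
  assumes P: "P \<in> monom_limits A" and c: "\<And>a. a \<in> A \<Longrightarrow> c * a \<in> B"
  shows "smult c P \<in> monom_limits B"
  unfolding monom_limits_def
proof (intro CollectI allI impI)
  fix e :: real and n assume "e > 0"
  then obtain m a where m: "m \<ge> n" "a \<in> A" "N (P - monom a m) < e / (cmod c + 1)"
    using monom_limitsD[OF P, of "e / (cmod c + 1)" n] by (auto simp: add_nonneg_pos)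
  have "N (smult c P - monom (c * a) m) = cmod c * N (P - monom a m)"
    using smult[of c "P - monom a m"] by (simp add: smult_diff_right smult_monom)
  also have "\<dots> \<le> (cmod c + 1) * N (P - monom a m)"
    using N_nonneg[of "P - monom a m"] by (simp add: algebra_simps)
  also have "\<dots> < (cmod c + 1) * (e / (cmod c + 1))"
    using m(3) by (intro mult_strict_left_mono) (auto simp: add_nonneg_pos)
  also have "\<dots> = e" by (simp add: add_nonneg_eq_0_iff)
  finally show "\<exists>m\<ge>n. \<exists>b\<in>B. N (smult c P - monom b m) < e"
    using m(1) c[OF m(2)] by blast
qed

lemma monom_limits_mult:
  "P \<in> monom_limits A \<Longrightarrow> Q \<in> monom_limits B \<Longrightarrow>
     P * Q \<in> monom_limits {a * b |a b. a \<in> A \<and> b \<in> B}"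
  using monom_limits_mult_tail[of P 0] by (simp add: monom_0)

lemma monom_limits_mult_tail':
  assumes "P * monom 1 n \<in> monom_limits A" "Q \<in> monom_limits A"
    and "\<And>a b. a \<in> A \<Longrightarrow> b \<in> A \<Longrightarrow> a * b \<in> A"
  shows "P * Q \<in> monom_limits A"
proof -
  have "monom_limits {a * b |a b. a \<in> A \<and> b \<in> A} \<subseteq> monom_limits A"
    using assms(3) unfolding monom_limits_def by blast
  then show ?thesis using monom_limits_mult_tail[OF assms(1,2)] by blast
qed

text \<open>Along a subsequence the coefficients from \<open>A\<close> converge to some non-zero
  \<open>a\<close>. Dividing the approximating monomials by these coefficients is then
  asymptotically the same as dividing by \<open>a\<close>, and coefficients from \<open>B\<close>
  remain.\<close>

lemma monom_limits_compact_factor: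
  assumes A: "compact A" "0 \<notin> A" and P: "P \<in> monom_limits {a * b |a b. a \<in> A \<and> b \<in> B}"
  obtains a where "a \<in> A" "smult (inverse a) P \<in> monom_limits B"
proof -
  have "\<exists>m\<ge>k. \<exists>a\<in>A. \<exists>b\<in>B. N (P - monom (a * b) m) < inverse (real (Suc k))" for k
    using monom_limitsD[OF P, of "inverse (real (Suc k))" k] by auto
  then obtain m a b where mab: "\<And>k. m k \<ge> k" "\<And>k. a k \<in> A" "\<And>k. b k \<in> B"
    "\<And>k. N (P - monom (a k * b k) (m k)) < inverse (real (Suc k))"
    by metis
  obtain l r where l: "l \<in> A" and r: "strict_mono r" "(a \<circ> r) \<longlonglongrightarrow> l"
    using A(1) mab(2) unfolding compact_def by metis
  have l0: "l \<noteq> 0" using l A(2) by auto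
  have inv: "(\<lambda>k. inverse (a (r k))) \<longlonglongrightarrow> inverse l"
    using r(2) l0 by (auto intro: tendsto_inverse simp: o_def)
  have "smult (inverse l) P \<in> monom_limits B"
    unfolding monom_limits_def
  proof (intro CollectI allI impI)
    fix e :: real and n assume "e > 0"
    \<comment> \<open>The first summand is the cost of exchanging the limit \<open>l\<close> for the
      actual coefficient, the second the original error after division by that coefficient.\<close>
    define g where "g k = cmod (inverse l - inverse (a (r k))) * N P
      + cmod (inverse (a (r k))) * inverse (real (Suc (r k)))" for k
    have "(\<lambda>k. inverse (real (Suc k))) \<longlonglongrightarrow> 0" by (rule LIMSEQ_inverse_real_of_nat)
    then have "(\<lambda>k. inverse (real (Suc (r k)))) \<longlonglongrightarrow> 0"
      using LIMSEQ_subseq_LIMSEQ[OF _ r(1)] by (fastforce simp: o_def)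
    then have "g \<longlonglongrightarrow> cmod (inverse l - inverse l) * N P + cmod (inverse l) * 0"
      unfolding g_def by (intro tendsto_intros inv)
    then have "eventually (\<lambda>k. g k < e) sequentially"
      using \<open>e > 0\<close> by (intro order_tendstoD) auto
    then obtain k where k: "k \<ge> n" "g k < e"
      unfolding eventually_sequentially by (metis max.cobounded1 max.cobounded2)
    have ak: "a (r k) \<noteq> 0" using mab(2) A(2) by metis
    have "m (r k) \<ge> n" using mab(1)[of "r k"] seq_suble[OF r(1), of k] k(1) by linarith
    moreover have "N (smult (inverse l) P - monom (b (r k)) (m (r k))) \<le> g k"
    proof -
      have "smult (inverse (a (r k))) (P - monom (a (r k) * b (r k)) (m (r k)))
          = smult (inverse (a (r k))) P - monom (b (r k)) (m (r k))"
        using ak by (simp add: smult_diff_right smult_monom field_simps)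
      then have "N (smult (inverse (a (r k))) P - monom (b (r k)) (m (r k)))
          = cmod (inverse (a (r k))) * N (P - monom (a (r k) * b (r k)) (m (r k)))"
        by (metis smult)
      also have "\<dots> \<le> cmod (inverse (a (r k))) * inverse (real (Suc (r k)))"
        using mab(4)[of "r k"] by (intro mult_left_mono) auto
      finally show ?thesis
        using N_diff_triangle[of "smult (inverse l) P" "monom (b (r k)) (m (r k))" "smult (inverse (a (r k))) P"]
        by (simp add: N_smult_diff g_def)
    qed
    ultimately show "\<exists>m\<ge>n. \<exists>c\<in>B. N (smult (inverse l) P - monom c m) < e"
      using k(2) mab(3) by (meson order.strict_trans1)
  qed
  then show thesis using that l by blast
qed


section \<open>Multiplication operators with dense range\<close>

definition dense_range :: "complex poly \<Rightarrow> bool" where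
  "dense_range p \<longleftrightarrow> (\<forall>q. \<forall>e>0. \<exists>s. N (q - p * s) < e)"

lemma N_tendsto_0:
  assumes "\<And>k. N (X k) \<le> g k" "g \<longlonglongrightarrow> 0" shows "(\<lambda>k. N (X k)) \<longlonglongrightarrow> 0"
  by (rule Lim_null_comparison[OF _ assms(2)]) (simp add: assms(1) N_nonneg)

lemma dense_range_mult:
  assumes "dense_range p" "dense_range q" shows "dense_range (p * q)"
  unfolding dense_range_def
proof (intro allI impI)
  fix r and e :: real assume e: "e > 0"
  obtain C where C: "C > 0" "\<And>q. N (p * q) \<le> C * N q" using mult_bound[of p] by blast
  obtain s where s: "N (r - p * s) < e / 2" using assms(1) e unfolding dense_range_def by (meson half_gt_zero)
  obtain t where t: "N (s - q * t) < e / (2 * C)"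
    using assms(2) e C(1) unfolding dense_range_def by (meson divide_pos_pos mult_pos_pos zero_less_numeral)
  have "N (p * s - p * q * t) \<le> C * N (s - q * t)" using C(2)[of "s - q * t"] by (simp add: algebra_simps)
  also have "\<dots> < e / 2" using t C(1) by (simp add: field_simps)
  finally show "\<exists>s. N (r - p * q * s) < e"
    using s N_diff_triangle[of r "p * q * t" "p * s"] by (intro exI[of _ t]) linarith
qed

lemma dense_range_const: "c \<noteq> 0 \<Longrightarrow> dense_range [:c:]"
  unfolding dense_range_def
proof (intro allI impI)
  fix q and e :: real assume "c \<noteq> 0" "e > 0"
  then show "\<exists>s. N (q - [:c:] * s) < e" by (intro exI[of _ "smult (inverse c) q"]) simp
qed

text \<open>If N p is small compared with p(z), then p / p(z) is small and differs from 1 by a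
  multiple of X - z. So 1 is in the closure of these multiples, and multiplication by
  \<open>q\<close> carries this over to \<open>q\<close>.\<close>

lemma dense_range_linear:
  assumes unbounded: "\<And>M. \<exists>p. cmod (poly p z) > M * N p"
  shows "dense_range [:-z, 1:]"
  unfolding dense_range_def
proof (intro allI impI)
  fix q and e :: real assume e: "e > 0"
  obtain C where C: "C > 0" "\<And>p. N (q * p) \<le> C * N p" using mult_bound[of q] by blast
  obtain p where p: "cmod (poly p z) > (C / e) * N p" using unbounded by blast
  define w where "w = poly p z"
  \<comment> \<open>Up to sign the quotient of p / p(z) on division by X - z; the remainder is
    1.\<close>
  define s where "s = smult (- inverse w) (synthetic_div p z)"
  have w: "cmod w > (C / e) * N p" using p by (simp add: w_def)
  moreover have "(C / e) * N p \<ge> 0" using C(1) e N_nonneg by simp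
  ultimately have w0: "w \<noteq> 0" by auto
  have "1 - [:-z, 1:] * s = smult (inverse w) p"
  proof -
    have "smult (inverse w) p = smult (inverse w) ([:-z, 1:] * synthetic_div p z + [:w:])"
      unfolding w_def by (simp only: synthetic_div_correct')
    also have "\<dots> = [:-z, 1:] * smult (inverse w) (synthetic_div p z) + 1"
      using w0 by (simp only: smult_add_right mult_smult_right) (simp add: one_pCons)
    also have "\<dots> = 1 - [:-z, 1:] * s"
      unfolding s_def by (simp only: smult_minus_left mult_minus_right) simp
    finally show ?thesis by simp
  qed
  then have "q - [:-z, 1:] * (s * q) = q * smult (inverse w) p"
    by (metis (no_types, opaque_lifting) mult.assoc mult.commute mult.right_neutral right_diff_distrib)
  then have "N (q - [:-z, 1:] * (s * q)) \<le> C * (inverse (cmod w) * N p)"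
    using C(2)[of "smult (inverse w) p"] by (simp add: smult norm_inverse)
  also have "\<dots> < e" using w e C(1) w0 by (simp add: field_simps)
  finally show "\<exists>s. N (q - [:-z, 1:] * s) < e" by blast
qed

text \<open>Over the complex numbers \<open>p\<close> splits into linear factors, and dense ranges
  are preserved under composition.\<close>

lemma dense_range_nonzero:
  assumes lin: "\<And>z. dense_range [:-z, 1:]" and "p \<noteq> 0"
  shows "dense_range p"
  using \<open>p \<noteq> 0\<close>
proof (induction "degree p" arbitrary: p)
  case 0
  then obtain c where "p = [:c:]" by (metis degree_eq_zeroE)
  then show ?case using 0 by (simp add: dense_range_const)
next
  case (Suc n)
  then have "\<not> constant (poly p)" by (simp add: constant_degree)
  then obtain z where "poly p z = 0" using fundamental_theorem_of_algebra by blast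
  then obtain q where q: "p = [:-z, 1:] * q" by (auto simp: poly_eq_0_iff_dvd dvd_def)
  with Suc.prems have "q \<noteq> 0" by auto
  then have "degree p = Suc (degree q)" unfolding q by (subst degree_mult_eq) auto
  then have "dense_range q" using Suc.hyps \<open>q \<noteq> 0\<close> by simp
  then show ?case unfolding q using lin by (intro dense_range_mult)
qed

end

section \<open>Limits of rotated orbits\<close>

locale dense_range_seminorm = poly_seminorm +
  assumes dense: "p \<noteq> 0 \<Longrightarrow> dense_range p"
begin

abbreviation rotation_limits :: "complex poly set" where
  "rotation_limits \<equiv> monom_limits (sphere 0 1)"

lemma rotation_limits_smult:
  "P \<in> rotation_limits \<Longrightarrow> cmod c = 1 \<Longrightarrow> smult c P \<in> rotation_limits"
  by (rule monom_limits_smult) (auto simp: norm_mult)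

lemma rotation_limits_mult_tail:
  assumes "P * monom c n \<in> rotation_limits" "cmod c = 1" "Q \<in> rotation_limits"
  shows "P * Q \<in> rotation_limits"
proof (rule monom_limits_mult_tail')
  have "c \<noteq> 0" using assms(2) by auto
  then have "P * monom 1 n = smult (inverse c) (P * monom c n)"
    by (simp add: smult_monom flip: mult_smult_right)
  then show "P * monom 1 n \<in> rotation_limits"
    using rotation_limits_smult[OF assms(1), of "inverse c"] assms(2) by (simp add: norm_inverse)
qed (use assms in \<open>auto simp: norm_mult\<close>)

section \<open>Interior points of the limit set and cancellation\<close>

definition limits_interior :: "complex poly set" where
  "limits_interior = {p. \<exists>e>0. \<forall>q. N (q - p) < e \<longrightarrow> q \<in> rotation_limits}"

lemma limits_interior_subset: "p \<in> limits_interior \<Longrightarrow> p \<in> rotation_limits"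
  unfolding limits_interior_def by fastforce

lemma limits_interior_open:
  assumes "p \<in> limits_interior"
  obtains e where "e > 0" "\<And>q. N (q - p) < e \<Longrightarrow> q \<in> limits_interior"
proof -
  obtain e where e: "e > 0" "\<And>q. N (q - p) < e \<Longrightarrow> q \<in> rotation_limits"
    using assms unfolding limits_interior_def by blast
  have "q \<in> limits_interior" if "N (q - p) < e" for q
    unfolding limits_interior_def
  proof (intro CollectI exI[of _ "e - N (q - p)"] conjI allI impI)
    fix r assume "N (r - q) < e - N (q - p)"
    then show "r \<in> rotation_limits" using N_diff_triangle[of r p q] by (intro e(2)) linarith
  qed (use that in simp)
  with e(1) that show thesis by blast
qed

text \<open>Polynomials near \<open>P\<close> become limits after multiplication by the monomial.
  Since 1 is a limit too, its approximating monomials of large degree absorb that factor.\<close>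

lemma limits_interior_cancel_monom:
  assumes one: "1 \<in> limits_interior" and c: "cmod c = 1"
    and P: "P * monom c m \<in> limits_interior"
  shows "P \<in> limits_interior"
proof -
  obtain e where e: "e > 0" "\<And>q. N (q - P * monom c m) < e \<Longrightarrow> q \<in> limits_interior"
    using limits_interior_open[OF P] by blast
  obtain C where C: "C > 0" "\<And>q. N (monom c m * q) \<le> C * N q"
    using mult_bound[of "monom c m"] by blast
  have "q \<in> rotation_limits" if q: "N (q - P) < e / C" for q
  proof -
    have "N (q * monom c m - P * monom c m) \<le> C * N (q - P)"
      using C(2)[of "q - P"] by (simp add: algebra_simps)
    also have "\<dots> < e" using q C(1) by (simp add: field_simps)
    finally have "q * monom c m \<in> rotation_limits" using e(2) limits_interior_subset by blast
    then have "q * 1 \<in> rotation_limits"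
      using rotation_limits_mult_tail c limits_interior_subset[OF one] by blast
    then show ?thesis by simp
  qed
  then show ?thesis using e(1) C(1) unfolding limits_interior_def by (intro CollectI exI[of _ "e / C"]) auto
qed

text \<open>Replacing \<open>Q\<close> by a nearby rotated monomial keeps the product in the
  interior, because the interior is open; so only a monomial has to be cancelled.\<close>

lemma limits_interior_cancel:
  assumes one: "1 \<in> limits_interior" and Q: "Q \<in> rotation_limits"
    and PQ: "P * Q \<in> limits_interior"
  shows "P \<in> limits_interior"
proof -
  obtain e where e: "e > 0" "\<And>q. N (q - P * Q) < e \<Longrightarrow> q \<in> limits_interior"
    using limits_interior_open[OF PQ] by blast
  obtain C where C: "C > 0" "\<And>q. N (P * q) \<le> C * N q" using mult_bound[of P] by blast
  obtain m c where m: "c \<in> sphere 0 1" "N (Q - monom c m) < e / C"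
    using monom_limitsD[OF Q, of "e / C" 0] e C by auto
  have "N (P * monom c m - P * Q) \<le> C * N (monom c m - Q)"
    using C(2)[of "monom c m - Q"] by (simp add: algebra_simps)
  also have "\<dots> < e" using m(2) C(1) by (simp add: field_simps N_commute)
  finally have "P * monom c m \<in> limits_interior" by (rule e(2))
  then show ?thesis using limits_interior_cancel_monom[OF one] m(1) by simp
qed

text \<open>For some \<open>s\<close> the product \<open>P * s\<close> is close to 1 and hence
  interior. Cancelling the limit \<open>P\<close> makes \<open>s\<close> interior, in particular a
  limit, and cancelling \<open>s\<close> leaves \<open>P\<close>.\<close>

lemma rotation_limits_nonzero_interior:
  assumes one: "1 \<in> limits_interior" and P: "P \<in> rotation_limits" "P \<noteq> 0"
  shows "P \<in> limits_interior"
proof -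
  obtain e where e: "e > 0" "\<And>q. N (q - 1) < e \<Longrightarrow> q \<in> limits_interior"
    using limits_interior_open[OF one] by blast
  obtain s where "N (1 - P * s) < e" using dense[OF P(2)] e(1) unfolding dense_range_def by blast
  then have Ps: "P * s \<in> limits_interior" by (intro e(2)) (simp add: N_commute)
  then have "s \<in> limits_interior"
    using limits_interior_cancel[OF one P(1), of s] by (simp add: mult.commute)
  then show ?thesis using limits_interior_cancel[OF one _ Ps] limits_interior_subset by blast
qed

text \<open>The parameters at which the segment meets the limits form a closed set, and an open one
  because non-zero limits are interior points. The unit interval is connected.\<close>

lemma rotation_limits_segment:
  assumes one: "1 \<in> limits_interior" and p: "p \<in> rotation_limits"
    and nz: "\<And>t. 0 \<le> t \<Longrightarrow> t \<le> 1 \<Longrightarrow> p + smult (complex_of_real t) (q - p) \<noteq> 0"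
  shows "q \<in> rotation_limits"
proof -
  define g where "g t = p + smult (complex_of_real t) (q - p)" for t :: real
  define S where "S = {t \<in> {0..1}. g t \<in> rotation_limits}"
  have lip: "N (g s - g t) = dist s t * N (q - p)" for s t
  proof -
    have "g s - g t = smult (complex_of_real (s - t)) (q - p)"
      by (simp add: g_def smult_diff_left)
    then show ?thesis by (simp only: smult norm_of_real dist_real_def)
  qed
  have near: "\<exists>d>0. \<forall>s. dist s t < d \<longrightarrow> N (g s - g t) < e" if "e > 0" for e :: real and t
  proof (intro exI[of _ "e / (N (q - p) + 1)"] conjI allI impI)
    show "e / (N (q - p) + 1) > 0" using that N_nonneg[of "q - p"] by (simp add: add_nonneg_pos)
    fix s assume s: "dist s t < e / (N (q - p) + 1)"
    have "N (g s - g t) \<le> dist s t * (N (q - p) + 1)" by (simp add: lip algebra_simps)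
    also have "\<dots> < e" using s N_nonneg[of "q - p"] by (simp add: field_simps add_nonneg_pos)
    finally show "N (g s - g t) < e" .
  qed
  have "openin (top_of_set {0..1}) S"
    unfolding openin_euclidean_subtopology_iff
  proof (intro conjI ballI)
    fix t assume t: "t \<in> S"
    then have "g t \<in> limits_interior"
      using rotation_limits_nonzero_interior[OF one] nz[of t] by (auto simp: S_def g_def)
    then obtain e where e: "e > 0" "\<And>r. N (r - g t) < e \<Longrightarrow> r \<in> limits_interior"
      using limits_interior_open by blast
    obtain d where "d > 0" "\<And>s. dist s t < d \<Longrightarrow> N (g s - g t) < e" using near[OF e(1)] by blast
    then show "\<exists>d>0. \<forall>s\<in>{0..1}. dist s t < d \<longrightarrow> s \<in> S"
      using e(2) limits_interior_subset by (intro exI[of _ d]) (auto simp: S_def)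
  qed (auto simp: S_def)
  moreover have "closedin (top_of_set {0..1}) S"
    unfolding closedin_limpt
  proof (intro conjI allI impI)
    fix t assume t: "t islimpt S \<and> t \<in> {0..1}"
    have "g t \<in> rotation_limits"
    proof (rule monom_limits_closed)
      fix e :: real assume "e > 0"
      then obtain d where d: "d > 0" "\<And>s. dist s t < d \<Longrightarrow> N (g s - g t) < e" using near by blast
      then obtain s where "s \<in> S" "dist s t < d" using t unfolding islimpt_approachable by blast
      then show "\<exists>q\<in>rotation_limits. N (g t - q) < e" using d(2) by (auto simp: S_def N_commute)
    qed
    then show "t \<in> S" using t by (simp add: S_def)
  qed (auto simp: S_def)
  moreover have "0 \<in> S" using p by (simp add: S_def g_def)
  ultimately have "S = {0..1}" using connected_Icc[of 0 "1::real"] unfolding connected_clopen by blast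
  then have "1 \<in> S" by simp
  then show ?thesis by (simp add: S_def g_def)
qed

lemma rotation_limits_UNIV:
  assumes one: "1 \<in> limits_interior"
  shows "p \<in> rotation_limits"
proof -
  have nonzero: "q \<in> rotation_limits" if "q \<noteq> 0" for q
  proof -
    \<comment> \<open>The straight segment from 1 to \<open>q\<close> meets 0 if \<open>q\<close> is
      a negative constant. The detour through a monomial of degree above \<open>degree q\<close>
      avoids 0 by linear independence.\<close>
    define L where "L = Suc (degree q)"
    have cq: "coeff q L = 0" by (simp add: L_def coeff_eq_0)
    have "monom 1 L \<in> rotation_limits"
    proof (rule rotation_limits_segment[OF one limits_interior_subset[OF one]])
      fix t :: real
      show "1 + smult (complex_of_real t) (monom 1 L - 1) \<noteq> 0"
      proof
        assume *: "1 + smult (complex_of_real t) (monom 1 L - 1) = 0"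
        have "coeff (1 + smult (complex_of_real t) (monom 1 L - 1)) L = t" by (simp add: L_def)
        moreover have "coeff (1 + smult (complex_of_real t) (monom 1 L - 1)) 0 = 1 - t"
          by (simp add: L_def)
        ultimately show False unfolding * by simp
      qed
    qed
    then show ?thesis
    proof (rule rotation_limits_segment[OF one])
      fix t :: real
      show "monom 1 L + smult (complex_of_real t) (q - monom 1 L) \<noteq> 0"
      proof
        assume *: "monom 1 L + smult (complex_of_real t) (q - monom 1 L) = 0"
        have "coeff (monom 1 L + smult (complex_of_real t) (q - monom 1 L)) L = 1 - t"
          using cq by simp
        then have "t = 1" unfolding * by simp
        then show False using * that by simp
      qed
    qed
  qed
  show ?thesis
  proof (cases "p = 0")
    case True
    \<comment> \<open>Small non-zero constants are limits already, so 0 follows by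
      closedness.\<close>
    have "\<exists>q\<in>rotation_limits. N (0 - q) < e" if "e > 0" for e :: real
    proof -
      define d where "d = e / (N 1 + 1)"
      have d: "d > 0" using that N_nonneg[of 1] by (simp add: d_def add_nonneg_pos)
      have "N (0 - [:complex_of_real d:]) = d * N 1"
        using smult[of "complex_of_real d" 1] N_minus[of "[:complex_of_real d:]"] d by simp
      also have "\<dots> < e" using that N_nonneg[of 1] by (simp add: d_def field_simps add_nonneg_pos)
      finally show ?thesis
        using nonzero[of "[:complex_of_real d:]"] d by (intro bexI[of _ "[:complex_of_real d:]"]) auto
    qed
    then show ?thesis unfolding True by (rule monom_limits_closed)
  qed (rule nonzero)
qed

section \<open>Removing the rotations\<close>

lemma orbit_dense_of_rotation_limits_UNIV:
  assumes full: "\<And>p. p \<in> rotation_limits"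
  shows "P \<in> monom_limits {1}"
  \<comment> \<open>The sets \<open>E P\<close> are cosets of the closed subgroup \<open>E 1\<close> of the circle. If the latter consists of
    \<open>M\<close>-th roots of unity, then \<open>c ^ M\<close> for \<open>c \<in> E (w + (1 - |w|) z)\<close> depends continuously on \<open>w\<close> in the
    unit disc and equals \<open>w ^ (- M)\<close> on its boundary, so it has no continuous logarithm.\<close>
proof -
  have cis_Arg_unit: "cis (Arg c) = c" if "cmod c = 1" for c
  proof -
    have "c \<noteq> 0" using that by auto
    then show ?thesis using that by (simp add: cis_Arg sgn_div_norm)
  qed
  \<comment> \<open>The rotations that carry \<open>P\<close> to a limit of unrotated monomials.
    Compactness of the circle provides at least one.\<close>
  define E where "E P = {c. cmod c = 1 \<and> smult c P \<in> monom_limits {1}}" for P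
  have E_nonempty: "\<exists>c. c \<in> E P" for P
  proof -
    have "sphere (0::complex) 1 = {a * b |a b. a \<in> sphere 0 1 \<and> b \<in> {1}}" by auto
    then have "P \<in> monom_limits {a * b |a b. a \<in> sphere (0::complex) 1 \<and> b \<in> {1}}"
      using full[of P] by simp
    then obtain a where "a \<in> sphere (0::complex) 1" "smult (inverse a) P \<in> monom_limits {1}"
      by (rule monom_limits_compact_factor[rotated 2]) auto
    then have "inverse a \<in> E P" by (simp add: E_def norm_inverse)
    then show ?thesis by blast
  qed
  have pick: "(SOME c. c \<in> E P) \<in> E P" for P by (rule someI_ex[OF E_nonempty])
  have E_mult: "c * d \<in> E (P * Q)" if "c \<in> E P" "d \<in> E Q" for c d P Q
    using that monom_limits_mult[of "smult c P" "{1}" "smult d Q" "{1}"]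
    by (auto simp: E_def norm_mult mult_ac)
  have E_closed: "c \<in> E P" if c: "cl \<longlonglongrightarrow> c" and d: "\<And>k. cl k \<in> E (Q k)"
    and lim: "(\<lambda>k. N (smult c P - smult (cl k) (Q k))) \<longlonglongrightarrow> 0" for c cl P Q
  proof -
    have "(\<lambda>k. cmod (cl k)) \<longlonglongrightarrow> cmod c" using c by (rule tendsto_norm)
    moreover have "(\<lambda>k. cmod (cl k)) = (\<lambda>k. 1)" using d by (auto simp: E_def)
    ultimately have "cmod c = 1" by (simp add: LIMSEQ_const_iff)
    moreover have "smult c P \<in> monom_limits {1}"
    proof (rule monom_limits_closed)
      fix e :: real assume "e > 0"
      then have "eventually (\<lambda>k. N (smult c P - smult (cl k) (Q k)) < e) sequentially"
        using lim by (rule order_tendstoD(2)[rotated])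
      then obtain k where "N (smult c P - smult (cl k) (Q k)) < e"
        using eventually_happens by fastforce
      then show "\<exists>q\<in>monom_limits {1}. N (smult c P - q) < e" using d[of k] by (auto simp: E_def)
    qed
    ultimately show ?thesis by (simp add: E_def)
  qed
  have compact_E: "\<exists>c r. strict_mono r \<and> (cl \<circ> r) \<longlonglongrightarrow> c" if "\<And>k. cl k \<in> E (Q k)" for cl :: "nat \<Rightarrow> complex" and Q
  proof -
    have "\<forall>k. cl k \<in> sphere 0 1" using that by (auto simp: E_def)
    then show ?thesis using compact_sphere[of "0::complex" 1] unfolding compact_def by blast
  qed
  \<comment> \<open>Passing to angles turns \<open>E 1\<close> into a closed additive semigroup of
    reals; its invariance under the period \<open>2 * pi\<close> supplies elements of both
    signs.\<close>
  define \<Theta> where "\<Theta> = {\<theta>. cis \<theta> \<in> E 1}"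
  have \<Theta>_closed: "closed \<Theta>"
    unfolding closed_sequential_limits
  proof (intro allI impI, elim conjE)
    fix x l assume x: "\<forall>n. x n \<in> \<Theta>" "x \<longlonglongrightarrow> l"
    have lim: "(\<lambda>n. cis (x n)) \<longlonglongrightarrow> cis l" by (intro tendsto_intros x)
    have "(\<lambda>n. cmod (cis l - cis (x n)) * N 1) \<longlonglongrightarrow> cmod (cis l - cis l) * N 1"
      by (intro tendsto_intros lim)
    then have "(\<lambda>n. N (smult (cis l) 1 - smult (cis (x n)) 1)) \<longlonglongrightarrow> 0" by (simp only: N_smult_diff) simp
    then show "l \<in> \<Theta>" using E_closed[OF lim, of "\<lambda>_. 1" 1] x(1) by (auto simp: \<Theta>_def)
  qed
  have \<Theta>_add: "s + t \<in> \<Theta>" if "s \<in> \<Theta>" "t \<in> \<Theta>" for s t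
    using that E_mult[of "cis s" 1 "cis t" 1] by (simp add: \<Theta>_def cis_mult)
  obtain c0 where c0: "c0 \<in> E 1" using E_nonempty by blast
  then have \<theta>0: "Arg c0 \<in> \<Theta>" by (simp add: \<Theta>_def E_def cis_Arg_unit)
  have \<Theta>_period: "\<theta> + 2 * pi * of_int k \<in> \<Theta>" if "\<theta> \<in> \<Theta>" for \<theta> k
  proof -
    have "cis (\<theta> + 2 * pi * of_int k) = cis \<theta>"
      by (simp add: cis_multiple_2pi flip: cis_mult)
    then show ?thesis using that by (simp add: \<Theta>_def)
  qed
  have Arg: "- pi < Arg c0" "Arg c0 \<le> pi" using Arg_bounded by auto
  consider "\<Theta> = UNIV" | \<alpha> where "\<alpha> > 0" "\<Theta> = range (\<lambda>k::int. of_int k * \<alpha>)"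
    using closed_add_semigroup_cases[of \<Theta>, OF \<Theta>_closed \<Theta>_add \<Theta>_period[OF \<theta>0, of 1] _ \<Theta>_period[OF \<theta>0, of "-1"]]
      Arg pi_gt_zero by force
  then show ?thesis
  proof cases
    case 1
    \<comment> \<open>Every rotation is now in \<open>E 1\<close>, so the one attached to
      \<open>P\<close> can be undone.\<close>
    obtain c where c: "c \<in> E P" using E_nonempty by blast
    then have "cmod (inverse c) = 1" "c \<noteq> 0" by (auto simp: E_def norm_inverse)
    have "cis (Arg (inverse c)) = inverse c" by (rule cis_Arg_unit) fact
    then have "inverse c \<in> E 1" using 1 by (metis UNIV_I \<Theta>_def mem_Collect_eq)
    from E_mult[OF c this] have "1 \<in> E P" using \<open>c \<noteq> 0\<close> by simp
    then show ?thesis by (simp add: E_def)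
  next
    case (2 \<alpha>)
    \<comment> \<open>The period is a difference of two elements of \<open>\<Theta>\<close>, hence a
      multiple of the generator \<open>\<alpha>\<close>.\<close>
    obtain m where m: "2 * pi = of_int m * \<alpha>"
    proof -
      obtain i where i: "Arg c0 = of_int i * \<alpha>" using \<theta>0 2(2) by auto
      have "Arg c0 + 2 * pi \<in> \<Theta>" using \<Theta>_period[OF \<theta>0, of 1] by simp
      then obtain j where "Arg c0 + 2 * pi = of_int j * \<alpha>" using 2(2) by auto
      with i show thesis by (intro that[of "j - i"]) (simp add: algebra_simps)
    qed
    then have "of_int m * \<alpha> > 0" using pi_gt_zero by linarith
    then have "m > 0" using 2(1) by (simp add: zero_less_mult_iff)
    define M where "M = nat m"
    have M: "real M * \<alpha> = 2 * pi" "M > 0" using m \<open>m > 0\<close> by (auto simp: M_def)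
    have root: "c ^ M = 1" if "c \<in> E 1" for c
    proof -
      have c: "cis (Arg c) = c" using that by (simp add: E_def cis_Arg_unit)
      then have "Arg c \<in> \<Theta>" using that by (simp add: \<Theta>_def)
      then obtain k where "Arg c = of_int k * \<alpha>" using 2(2) by auto
      then have k: "real M * Arg c = 2 * pi * of_int k" using M(1) by (simp add: mult_ac)
      have "cis (Arg c) ^ M = cis (real M * Arg c)" by (rule Complex.DeMoivre)
      also have "\<dots> = 1" unfolding k by (rule cis_multiple_2pi) simp
      finally show ?thesis using c by simp
    qed
    have coset: "c ^ M = d ^ M" if P: "P \<noteq> 0" and cd: "c \<in> E P" "d \<in> E P" for P c d
    proof -
      \<comment> \<open>Take approximate inverses \<open>s k\<close> of \<open>P\<close> with
        attached rotations \<open>u k\<close>. A limit point \<open>l\<close> of the latter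
        satisfies \<open>b * l \<in> E 1\<close> for every \<open>b \<in> E P\<close>, so all these
        \<open>b\<close> have the same \<open>M\<close>-th power.\<close>
      have "\<exists>s. N (1 - P * s) < inverse (real (Suc k))" for k
        using dense[OF P] unfolding dense_range_def by simp
      then obtain s where s: "\<And>k. N (1 - P * s k) < inverse (real (Suc k))" by metis
      define u where "u k = (SOME c. c \<in> E (s k))" for k
      have u: "u k \<in> E (s k)" for k unfolding u_def by (rule pick)
      then obtain l r where r: "strict_mono r" "(u \<circ> r) \<longlonglongrightarrow> l" using compact_E by blast
      have "b * l \<in> E 1" if b: "b \<in> E P" for b
      proof (rule E_closed)
        show lim: "(\<lambda>k. b * u (r k)) \<longlonglongrightarrow> b * l" using r(2) by (intro tendsto_intros) (simp add: o_def)
        show "b * u (r k) \<in> E (P * s (r k))" for k by (rule E_mult[OF b u])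
        have "N (smult (b * l) 1 - smult (b * u (r k)) (P * s (r k)))
            \<le> cmod (b * l - b * u (r k)) * N 1 + inverse (real (Suc (r k)))" for k
        proof -
          have "cmod (b * u (r k)) = 1" using b u[of "r k"] by (simp add: E_def norm_mult)
          then have "N (smult (b * u (r k)) 1 - smult (b * u (r k)) (P * s (r k))) = N (1 - P * s (r k))"
            using smult[of "b * u (r k)" "1 - P * s (r k)"] by (simp add: smult_diff_right)
          then show ?thesis
            using N_diff_triangle[of "smult (b * l) 1" "smult (b * u (r k)) (P * s (r k))" "smult (b * u (r k)) 1"]
              s[of "r k"] N_smult_diff[of "b * l" 1 "b * u (r k)"] by linarith
        qed
        moreover have "(\<lambda>k. cmod (b * l - b * u (r k)) * N 1 + inverse (real (Suc (r k)))) \<longlonglongrightarrow> 0"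
        proof -
          have "(\<lambda>k. inverse (real (Suc (r k)))) \<longlonglongrightarrow> 0"
            using LIMSEQ_subseq_LIMSEQ[OF LIMSEQ_inverse_real_of_nat r(1)] by (simp add: o_def)
          then have "(\<lambda>k. cmod (b * l - b * u (r k)) * N 1 + inverse (real (Suc (r k))))
              \<longlonglongrightarrow> cmod (b * l - b * l) * N 1 + 0"
            by (intro tendsto_intros lim)
          then show ?thesis by simp
        qed
        ultimately show "(\<lambda>k. N (smult (b * l) 1 - smult (b * u (r k)) (P * s (r k)))) \<longlonglongrightarrow> 0"
          by (rule N_tendsto_0)
      qed
      then have "(c * l) ^ M = 1" "(d * l) ^ M = 1" using cd root by blast+
      then show ?thesis by (metis mult_cancel_right power_mult_distrib mult_zero_right zero_neq_one)
    qed
    define W where "W w = [:w, complex_of_real (1 - cmod w):]" for w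
    have W: "W w \<noteq> 0" for w by (auto simp: W_def)
    define f where "f w = (SOME c. c \<in> E (W w)) ^ M" for w
    have f: "f w = c ^ M" if "c \<in> E (W w)" for w c
      unfolding f_def using coset[OF W _ that] someI[of "\<lambda>c. c \<in> E (W w)", OF that] by blast
    have f_norm: "cmod (f w) = 1" for w
    proof -
      obtain c where c: "c \<in> E (W w)" using E_nonempty by blast
      then show ?thesis using f[OF c] by (simp add: E_def norm_power)
    qed
    \<comment> \<open>The values lie on a compact circle, so closedness of the graph suffices, and
      this is the stability of \<open>E\<close> under limits.\<close>
    have "continuous_on (cball 0 1) f"
    proof (rule continuous_from_closed_graph)
      show "compact (sphere (0::complex) 1)" by simp
      show "f \<in> cball 0 1 \<rightarrow> sphere 0 1" using f_norm by simp
      show "closed ((\<lambda>x. (x, f x)) ` cball 0 1)"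
        unfolding closed_sequential_limits
      proof (intro allI impI, elim conjE)
        fix x l assume x: "\<forall>n. x n \<in> (\<lambda>x. (x, f x)) ` cball 0 1" and l: "x \<longlonglongrightarrow> l"
        define w where "w n = fst (x n)" for n
        have w: "w n \<in> cball 0 1" "snd (x n) = f (w n)" for n
        proof -
          obtain y where "y \<in> cball 0 1" "x n = (y, f y)" using x by blast
          then show "w n \<in> cball 0 1" "snd (x n) = f (w n)" by (simp_all add: w_def)
        qed
        have wl: "w \<longlonglongrightarrow> fst l" unfolding w_def by (intro tendsto_intros l)
        have fl: "(\<lambda>n. f (w n)) \<longlonglongrightarrow> snd l" using tendsto_snd[OF l] w(2) by simp
        have "fst l \<in> cball 0 1" using closed_sequentially[OF closed_cball _ wl] w(1) by blast
        define u where "u k = (SOME c. c \<in> E (W (w k)))" for k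
        have u: "u k \<in> E (W (w k))" for k unfolding u_def by (rule pick)
        then obtain c r where r: "strict_mono r" "(u \<circ> r) \<longlonglongrightarrow> c"
          using compact_E[of u "\<lambda>k. W (w k)"] by blast
        have wr: "(\<lambda>k. w (r k)) \<longlonglongrightarrow> fst l" using LIMSEQ_subseq_LIMSEQ[OF wl r(1)] by (simp add: o_def)
        have ur: "(\<lambda>k. u (r k)) \<longlonglongrightarrow> c" using r(2) by (simp add: o_def)
        have "c \<in> E (W (fst l))"
        proof (rule E_closed[OF ur])
          show "u (r k) \<in> E (W (w (r k)))" for k by (rule u)
          define A where "A k = c * fst l - u (r k) * w (r k)" for k
          define B where "B k = c * of_real (1 - cmod (fst l)) - u (r k) * of_real (1 - cmod (w (r k)))" for k
          have "smult c (W (fst l)) - smult (u (r k)) (W (w (r k))) = smult (A k) 1 + smult (B k) [:0, 1:]" for k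
            by (simp add: W_def A_def B_def)
          then have bound: "N (smult c (W (fst l)) - smult (u (r k)) (W (w (r k)))) \<le> cmod (A k) * N 1 + cmod (B k) * N [:0, 1:]" for k
            by (metis triangle smult)
          have "(\<lambda>k. cmod (A k) * N 1 + cmod (B k) * N [:0, 1:]) \<longlonglongrightarrow>
              cmod (c * fst l - c * fst l) * N 1
              + cmod (c * of_real (1 - cmod (fst l)) - c * of_real (1 - cmod (fst l))) * N [:0, 1:]"
            unfolding A_def B_def by (intro tendsto_intros ur wr)
          then have "(\<lambda>k. cmod (A k) * N 1 + cmod (B k) * N [:0, 1:]) \<longlonglongrightarrow> 0" by simp
          with bound show "(\<lambda>k. N (smult c (W (fst l)) - smult (u (r k)) (W (w (r k))))) \<longlonglongrightarrow> 0"
            by (rule N_tendsto_0)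
        qed
        then have "f (fst l) = c ^ M" by (rule f)
        moreover have "(\<lambda>k. f (w (r k))) \<longlonglongrightarrow> c ^ M"
          using f[OF u] by (simp add: tendsto_power[OF ur])
        moreover have "(\<lambda>k. f (w (r k))) \<longlonglongrightarrow> snd l"
          using LIMSEQ_subseq_LIMSEQ[OF fl r(1)] by (simp add: o_def)
        ultimately have "f (fst l) = snd l" using LIMSEQ_unique by metis
        then show "l \<in> (\<lambda>x. (x, f x)) ` cball 0 1"
          using \<open>fst l \<in> cball 0 1\<close> by (intro image_eqI[of _ _ "fst l"]) (simp add: prod_eq_iff)
      qed
    qed
    moreover have "f w \<noteq> 0" for w using f_norm[of w] by auto
    ultimately obtain h where h: "continuous_on (cball 0 1) h" "\<And>w. w \<in> cball 0 1 \<Longrightarrow> f w = exp (h w)"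
      using continuous_logarithm_on_cball by metis
    \<comment> \<open>On the boundary \<open>f w * w ^ M = 1\<close>, so \<open>\<phi>\<close> takes
      integer values. It is continuous and grows by \<open>M\<close> over one turn because
      \<open>h\<close> is single-valued; halfway to the next integer the intermediate value theorem
      gives a contradiction.\<close>
    define \<phi> where "\<phi> \<theta> = (Im (h (cis \<theta>)) + real M * \<theta>) / (2 * pi)" for \<theta>
    have "\<phi> \<theta> \<in> \<int>" for \<theta>
    proof -
      obtain c where c: "c \<in> E (W (cis \<theta>))" using E_nonempty by blast
      then have "c * cis \<theta> \<in> E 1" by (auto simp: E_def W_def norm_mult one_pCons)
      then have "f (cis \<theta>) * cis \<theta> ^ M = 1" using root f[OF c] by (metis power_mult_distrib)
      then have "exp (h (cis \<theta>)) * cis (real M * \<theta>) = 1" by (simp add: h(2) Complex.DeMoivre)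
      then have "exp (h (cis \<theta>) + \<i> * (real M * \<theta>)) = 1" by (simp add: exp_add cis_conv_exp)
      then obtain n :: int where "Im (h (cis \<theta>)) + real M * \<theta> = of_int (2 * n) * pi"
        by (auto simp: exp_eq_1)
      then have "\<phi> \<theta> = of_int n" by (simp add: \<phi>_def)
      then show ?thesis by simp
    qed
    moreover have "continuous_on {0..2 * pi} \<phi>"
    proof -
      have "continuous_on {0..2 * pi} (\<lambda>\<theta>. h (cis \<theta>))"
        by (intro continuous_on_compose2[OF h(1)] continuous_intros) auto
      then show ?thesis unfolding \<phi>_def by (intro continuous_intros) auto
    qed
    moreover have step: "\<phi> (2 * pi) = \<phi> 0 + real M"
    proof -
      have "cis (2 * pi) = cis 0" using cis_multiple_2pi[of 1] by simp
      then show ?thesis by (simp add: \<phi>_def field_simps)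
    qed
    ultimately obtain \<theta> where "\<phi> \<theta> = \<phi> 0 + 1 / 2"
      using IVT'[of \<phi> 0 "\<phi> 0 + 1/2" "2 * pi"] M(2) pi_gt_zero by (auto simp: Suc_le_eq)
    then have "1 / 2 \<in> (\<int> :: real set)"
      using \<open>\<And>\<theta>. \<phi> \<theta> \<in> \<int>\<close> by (metis Ints_diff add_diff_cancel_left')
    then obtain k :: int where "1 / 2 = real_of_int k" by (auto elim: Ints_cases)
    then have "real_of_int (2 * k) = real_of_int 1" by simp
    then have "2 * k = 1" by (simp only: of_int_eq_iff)
    then have False by presburger
    then show ?thesis ..
  qed
qed

end

section \<open>Moduli in a nowhere dense set\<close>

text \<open>Powers of \<open>l\<close> decrease to 0, stay at 1 or increase to infinity. The
  positive lower bound \<open>a\<close> excludes the accumulation at 0, which gives the local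
  finiteness used for evaluations.\<close>

lemma finite_powers_between:
  fixes l :: real
  assumes l: "l \<ge> 0" and a: "a > 0"
  shows "finite {l ^ m |m. a \<le> l ^ m \<and> l ^ m \<le> b}"
proof -
  consider "l < 1" | "l = 1" | "l > 1" by linarith
  then show ?thesis
  proof cases
    case 1
    obtain n where n: "l ^ n < a" using real_arch_pow_inv[OF a 1] by blast
    have "l ^ m < a" if "m \<ge> n" for m using power_decreasing[OF that, of l] l 1 n by simp
    then have "{l ^ m |m. a \<le> l ^ m \<and> l ^ m \<le> b} \<subseteq> (\<lambda>m. l ^ m) ` {..<n}" by (force simp: not_less[symmetric])
    then show ?thesis by (rule finite_subset) simp
  next
    case 2
    then show ?thesis by simp
  next
    case 3
    obtain n where n: "b < l ^ n" using real_arch_pow[OF 3] by blast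
    have "b < l ^ m" if "m \<ge> n" for m using power_increasing[OF that, of l] 3 n by linarith
    then have "{l ^ m |m. a \<le> l ^ m \<and> l ^ m \<le> b} \<subseteq> (\<lambda>m. l ^ m) ` {..<n}" by (force simp: not_less[symmetric])
    then show ?thesis by (rule finite_subset) simp
  qed
qed

lemma interior_mult_image_empty:
  fixes R :: "real set"
  assumes "interior R = {}" "v \<noteq> 0"
  shows "interior ((*) v ` R) = {}"
proof -
  have "surj ((*) v)" using assms(2) by (intro surjI[of _ "\<lambda>x. x / v"]) simp
  then have "interior ((*) v ` R) \<subseteq> (*) v ` interior R"
    using assms(2) by (intro interior_image_subset) (auto simp: inj_on_def isCont_def intro!: tendsto_intros)
  then show ?thesis using assms(1) by simp
qed

text \<open>Only the moduli of the coefficients are prescribed, so nowhere density becomes a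
  statement about subsets of the real line.\<close>

locale nowhere_dense_moduli = poly_seminorm +
  fixes R :: "real set" and p0 :: "complex poly" and \<epsilon> :: real
  assumes R_compact: "compact R" and R_pos: "r \<in> R \<Longrightarrow> r > 0" and R_interior: "interior R = {}"
    and N_1: "N 1 > 0" and eps_pos: "\<epsilon> > 0"
    and cover: "N (p - p0) < \<epsilon> \<Longrightarrow> \<eta> > 0 \<Longrightarrow> \<exists>c m. cmod c \<in> R \<and> N (p - monom c m) < \<eta>"
begin

lemma R_bounds: obtains a b where "0 < a" "\<And>r. r \<in> R \<Longrightarrow> a \<le> r" "\<And>r. r \<in> R \<Longrightarrow> r \<le> b"
proof -
  obtain c where c: "cmod c \<in> R" using cover[of p0 1] eps_pos by auto
  obtain a where "a \<in> R" "\<And>r. r \<in> R \<Longrightarrow> a \<le> r" using compact_attains_inf[OF R_compact] c by blast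
  moreover obtain b where "\<And>r. r \<in> R \<Longrightarrow> r \<le> b" using compact_attains_sup[OF R_compact] c by blast
  ultimately show thesis using that R_pos by blast
qed

text \<open>A bounded evaluation at \<open>z\<close> would map the ball about \<open>p0\<close> onto
  a set containing a disc, and each modulus in this disc would be a limit of numbers r l^m with r in
  \<open>R\<close> and l = |z|. Near a positive modulus finitely many powers occur, so finitely many
  dilates of \<open>R\<close> would cover an interval.\<close>

lemma poly_unbounded: "\<exists>p. cmod (poly p z) > M * N p"
proof (rule ccontr)
  assume "\<not> ?thesis"
  then have bdd: "cmod (poly p z) \<le> M * N p" for p by (simp add: not_less)
  have "1 \<le> M * N 1" using bdd[of 1] by simp
  then have M: "M > 0" using N_1 by (metis not_one_le_zero mult_nonpos_nonneg not_le order_trans less_imp_le)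
  obtain a b where ab: "0 < a" "\<And>r. r \<in> R \<Longrightarrow> a \<le> r" "\<And>r. r \<in> R \<Longrightarrow> r \<le> b" using R_bounds by metis
  define l where "l = cmod z"
  \<comment> \<open>Adding to \<open>p0\<close> a constant of modulus below \<open>\<rho>\<close>
    does not leave the ball; this yields the disc about the value of \<open>p0\<close> at
    \<open>z\<close>.\<close>
  define \<rho> where "\<rho> = \<epsilon> / N 1"
  have \<rho>: "\<rho> > 0" using eps_pos N_1 by (simp add: \<rho>_def)
  have near: "\<exists>r\<in>R. \<exists>m. \<bar>cmod w - r * l ^ m\<bar> < \<eta>"
    if w: "cmod (w - poly p0 z) < \<rho>" and \<eta>: "\<eta> > 0" for w \<eta>
  proof -
    define t where "t = w - poly p0 z"
    have "N ([:t:] + p0 - p0) = cmod t * N 1" using smult[of t 1] by simp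
    also have "\<dots> < \<epsilon>" using w N_1 by (simp add: t_def \<rho>_def field_simps)
    finally obtain c m where c: "cmod c \<in> R" "N ([:t:] + p0 - monom c m) < \<eta> / M"
      using cover[of "[:t:] + p0" "\<eta> / M"] \<eta> M by auto
    have "cmod (w - c * z ^ m) = cmod (poly ([:t:] + p0 - monom c m) z)" by (simp add: t_def poly_monom)
    also have "\<dots> \<le> M * N ([:t:] + p0 - monom c m)" by (rule bdd)
    also have "\<dots> < \<eta>" using c(2) M by (simp add: field_simps)
    finally have "\<bar>cmod w - cmod (c * z ^ m)\<bar> < \<eta>" using norm_triangle_ineq3[of w "c * z ^ m"] by linarith
    then show ?thesis using c(1) by (intro bexI[of _ "cmod c"] exI[of _ m]) (auto simp: norm_mult norm_power l_def)
  qed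
  \<comment> \<open>The centre has to avoid 0, since near modulus 0 infinitely many powers of
    \<open>l\<close> could contribute.\<close>
  obtain w1 where w1: "cmod (w1 - poly p0 z) < \<rho> / 2" "w1 \<noteq> 0"
  proof (cases "poly p0 z = 0")
    case True
    then show thesis using \<rho> by (intro that[of "of_real (\<rho> / 4)"]) (auto simp: norm_of_real simp del: of_real_divide)
  next
    case False
    then show thesis using \<rho> by (intro that[of "poly p0 z"]) auto
  qed
  define x where "x = cmod w1"
  have x: "x > 0" using w1 by (simp add: x_def)
  define \<delta> where "\<delta> = min (\<rho> / 2) (x / 2)"
  have \<delta>: "\<delta> > 0" "\<delta> \<le> x / 2" "\<delta> \<le> \<rho> / 2" using \<rho> x by (auto simp: \<delta>_def)
  \<comment> \<open>As \<open>R\<close> lies between \<open>a\<close> and \<open>b\<close>, a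
    product \<open>r * l ^ m\<close> between \<open>x / 4\<close> and \<open>2 * x\<close> confines
    the power to these bounds.\<close>
  define V where "V = {l ^ m |m. x / 4 / b \<le> l ^ m \<and> l ^ m \<le> 2 * x / a}"
  have "R \<noteq> {}" using near[of w1 1] w1 \<rho> by auto
  then have b: "b > 0" using ab by (meson all_not_in_conv order_less_le_trans)
  have V: "finite V" "\<And>v. v \<in> V \<Longrightarrow> v > 0"
  proof -
    show "finite V" unfolding V_def using x b by (intro finite_powers_between) (auto simp: l_def)
    show "v > 0" if "v \<in> V" for v
    proof -
      have "x / 4 / b \<le> v" using that by (auto simp: V_def)
      then show ?thesis using x b by (meson divide_pos_pos order_less_le_trans zero_less_numeral)
    qed
  qed
  have "ball x \<delta> \<subseteq> (\<Union>v\<in>V. (*) v ` R)"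
  proof
    fix s assume s: "s \<in> ball x \<delta>"
    define w where "w = of_real (s / x) * w1"
    have s0: "s > x / 2" "s < 3 / 2 * x" using s \<delta> by (auto simp: dist_real_def)
    have cw: "cmod w = s" using x s0 by (simp add: w_def norm_mult x_def norm_divide)
    have "w - w1 = of_real (s / x - 1) * w1" by (simp add: w_def algebra_simps)
    then have "cmod (w - w1) = \<bar>s / x - 1\<bar> * x" by (simp only: norm_mult norm_of_real x_def)
    also have "\<dots> = \<bar>s - x\<bar>" using x by (simp add: abs_if field_simps)
    also have "\<dots> < \<rho> / 2" using s \<delta> by (simp add: dist_real_def abs_minus_commute)
    finally have w: "cmod (w - poly p0 z) < \<rho>"
      using w1(1) norm_triangle_ineq[of "w - w1" "w1 - poly p0 z"] by simp
    have "s \<in> closure (\<Union>v\<in>V. (*) v ` R)"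
      unfolding closure_approachable
    proof (intro allI impI)
      fix \<eta> :: real assume "\<eta> > 0"
      then obtain r m where r: "r \<in> R" "\<bar>s - r * l ^ m\<bar> < min \<eta> (x / 4)"
        using near[OF w, of "min \<eta> (x / 4)"] x cw by auto
      have lm: "l ^ m \<ge> 0" by (simp add: l_def)
      have "r * l ^ m \<ge> x / 4" "r * l ^ m \<le> 2 * x" using r(2) s0 by linarith+
      moreover have "r * l ^ m \<le> b * l ^ m" "a * l ^ m \<le> r * l ^ m" using ab r(1) lm by (auto intro: mult_right_mono)
      ultimately have "x / 4 \<le> b * l ^ m" "a * l ^ m \<le> 2 * x" by linarith+
      then have "l ^ m \<in> V" using ab(1) b by (auto simp: V_def field_simps)
      then have "l ^ m * r \<in> (\<Union>v\<in>V. (*) v ` R)" by (rule UN_I) (rule image_eqI[OF refl r(1)])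
      then show "\<exists>y\<in>\<Union>v\<in>V. (*) v ` R. dist y s < \<eta>"
        using r(2) by (intro bexI[of _ "l ^ m * r"]) (simp_all add: dist_real_def mult.commute abs_minus_commute)
    qed
    moreover have "closed (\<Union>v\<in>V. (*) v ` R)"
      using V(1) R_compact
      by (intro closed_UN ballI compact_imp_closed compact_continuous_image continuous_intros) auto
    ultimately show "s \<in> (\<Union>v\<in>V. (*) v ` R)" by simp
  qed
  moreover have "interior (\<Union>v\<in>V. (*) v ` R) = {}"
  proof (rule interior_finite_Union_closed_empty[OF V(1)])
    show "closed ((*) v ` R)" for v
      using R_compact by (intro compact_imp_closed compact_continuous_image continuous_intros)
    show "interior ((*) v ` R) = {}" if "v \<in> V" for v
      using V(2)[OF that] by (intro interior_mult_image_empty R_interior) simp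
  qed
  ultimately have "ball x \<delta> = {}" using interior_maximal open_ball by blast
  then show False using \<delta>(1) by simp
qed

sublocale dense_range_seminorm
  by unfold_locales (rule dense_range_nonzero[OF dense_range_linear[OF poly_unbounded]])

text \<open>All multiples of a polynomial of seminorm 0 have seminorm 0, so they cannot approximate
  1: dense ranges turn the seminorm into a norm.\<close>

lemma N_eq_0: assumes "N p = 0" shows "p = 0"
proof (rule ccontr)
  assume "p \<noteq> 0"
  then have "dense_range p" by (rule dense)
  then obtain s where s: "N (1 - p * s) < N 1" using N_1 unfolding dense_range_def by blast
  obtain C where "\<And>q. N (s * q) \<le> C * N q" using mult_bound[of s] by blast
  from this[of p] assms have "N (p * s) \<le> 0" by (simp add: mult.commute)
  then show False using s N_diff_triangle[of 1 0 "p * s"] by simp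
qed

text \<open>The coefficients with modulus in \<open>R\<close> form a compact set, on which the
  distance to \<open>p\<close> is continuous and, by definiteness of \<open>N\<close>,
  positive.\<close>

lemma monom_apart:
  assumes "\<And>c. p \<noteq> monom c m"
  shows "\<exists>\<mu>>0. \<forall>c. cmod c \<in> R \<longrightarrow> \<mu> \<le> N (p - monom c m)"
proof -
  define Z where "Z = {c :: complex. cmod c \<in> R}"
  obtain a b where ab: "\<And>r. r \<in> R \<Longrightarrow> a \<le> r" "\<And>r. r \<in> R \<Longrightarrow> r \<le> b" using R_bounds by metis
  have "closed Z"
    using continuous_closed_vimage[OF compact_imp_closed[OF R_compact], of cmod]
    by (simp add: Z_def vimage_def)
  moreover have "bounded Z" using ab(2) by (auto simp: Z_def bounded_iff)
  ultimately have "compact Z" by (simp add: compact_eq_bounded_closed)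
  moreover have "Z \<noteq> {}" using cover[of p0 1] eps_pos by (auto simp: Z_def)
  ultimately obtain c where "c \<in> Z" "\<And>d. d \<in> Z \<Longrightarrow> N (p - monom c m) \<le> N (p - monom d m)"
    using continuous_attains_inf[of Z "\<lambda>c. N (p - monom c m)"] continuous_on_N_monom by metis
  moreover have "N (p - monom c m) > 0" using assms[of c] N_eq_0[of "p - monom c m"] N_nonneg[of "p - monom c m"]
    by (cases "N (p - monom c m) = 0") auto
  ultimately show ?thesis by (auto simp: Z_def)
qed

lemma ball_limits:
  assumes p: "N (p - p0) < \<epsilon>"
  obtains r where "r \<in> R" "smult (of_real (inverse r)) p \<in> rotation_limits"
proof -
  have "p \<in> monom_limits {c. cmod c \<in> R}"
    unfolding monom_limits_def
  proof (intro CollectI allI impI)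
    fix e :: real and n assume e: "e > 0"
    \<comment> \<open>A small perturbation of \<open>p\<close> of large degree stays away from all \<open>monom c m\<close> with \<open>m < n\<close>.\<close>
    define L where "L = max n (Suc (degree p))"
    define d where "d = min (e / 2) (\<epsilon> - N (p - p0)) / (2 * (N (monom 1 L) + 1))"
    have "min (e / 2) (\<epsilon> - N (p - p0)) > 0" using e p by simp
    then have d: "d > 0" using N_nonneg[of "monom 1 L"] by (simp add: d_def add_nonneg_pos)
    define q where "q = p + monom (of_real d) L"
    have "N (q - p) = d * N (monom 1 L)"
      using smult[of "of_real d" "monom 1 L"] d by (simp add: q_def smult_monom)
    also have "\<dots> < d * (2 * (N (monom 1 L) + 1))"
      using d N_nonneg[of "monom 1 L"] by (intro mult_strict_left_mono) auto
    also have "\<dots> = min (e / 2) (\<epsilon> - N (p - p0))" using N_nonneg[of "monom 1 L"] by (simp add: d_def)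
    finally have q: "N (q - p) < e / 2" "N (q - p) < \<epsilon> - N (p - p0)" by auto
    have "N (q - p0) < \<epsilon>" using q(2) N_diff_triangle[of q p0 p] by linarith
    note cover_q = cover[OF this]
    have cL: "coeff q L = of_real d" by (simp add: q_def L_def coeff_eq_0)
    have "\<exists>\<mu>>0. \<forall>c. cmod c \<in> R \<longrightarrow> \<mu> \<le> N (q - monom c m)" if "m < n" for m
    proof (rule monom_apart)
      fix c show "q \<noteq> monom c m"
      proof
        assume "q = monom c m"
        moreover have "m < L" using that by (simp add: L_def)
        ultimately have "coeff q L = 0" by simp
        then show False using cL d by simp
      qed
    qed
    then obtain \<mu> where \<mu>: "\<And>m. m < n \<Longrightarrow> \<mu> m > 0"
      "\<And>m c. m < n \<Longrightarrow> cmod c \<in> R \<Longrightarrow> \<mu> m \<le> N (q - monom c m)" by metis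
    \<comment> \<open>No monomial of degree below \<open>n\<close> with modulus in \<open>R\<close>
      comes closer to \<open>q\<close> than this, so an approximation of this quality has exponent
      at least \<open>n\<close>.\<close>
    define \<mu>0 where "\<mu>0 = Min (insert (e / 2) (\<mu> ` {..<n}))"
    have "\<mu>0 > 0" using \<mu>(1) e by (auto simp: \<mu>0_def)
    then obtain c m where c: "cmod c \<in> R" "N (q - monom c m) < \<mu>0" using cover_q by blast
    have "\<mu>0 \<le> e / 2" unfolding \<mu>0_def by (rule Min_le) auto
    have "m \<ge> n"
    proof (rule ccontr)
      assume "\<not> m \<ge> n"
      then have "\<mu>0 \<le> \<mu> m" by (simp add: \<mu>0_def)
      then show False using \<mu>(2)[of m c] c \<open>\<not> m \<ge> n\<close> by simp
    qed
    moreover have "N (p - monom c m) < e"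
      using N_diff_triangle[of p "monom c m" q] N_commute[of p q] q(1) c(2) \<open>\<mu>0 \<le> e / 2\<close> by linarith
    ultimately show "\<exists>m\<ge>n. \<exists>c\<in>{c. cmod c \<in> R}. N (p - monom c m) < e" using c(1) by blast
  qed
  moreover have "{c. cmod c \<in> R} = {a * b |a b. a \<in> complex_of_real ` R \<and> b \<in> sphere 0 1}"
  proof (intro equalityI subsetI)
    fix c :: complex assume "c \<in> {c. cmod c \<in> R}"
    then have "cmod c \<in> R" "c \<noteq> 0" using R_pos[of "cmod c"] by auto
    then show "c \<in> {a * b |a b. a \<in> complex_of_real ` R \<and> b \<in> sphere 0 1}"
      by - (rule CollectI, rule exI[of _ "of_real (cmod c)"], rule exI[of _ "sgn c"],
         simp add: sgn_eq norm_divide)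
  next
    fix c assume "c \<in> {a * b |a b. a \<in> complex_of_real ` R \<and> b \<in> sphere 0 1}"
    then obtain r b where "r \<in> R" "c = of_real r * b" "cmod b = 1" by auto
    then show "c \<in> {c. cmod c \<in> R}" using R_pos[of r] by (simp add: norm_mult)
  qed
  ultimately have P: "p \<in> monom_limits {a * b |a b. a \<in> complex_of_real ` R \<and> b \<in> sphere 0 1}" by simp
  \<comment> \<open>The moduli range over a compact set avoiding 0, so one of them can be divided
    out, leaving coefficients on the circle.\<close>
  have "compact (complex_of_real ` R)" by (intro compact_continuous_image continuous_intros R_compact)
  moreover have "0 \<notin> complex_of_real ` R" using R_pos by force
  ultimately obtain a where "a \<in> complex_of_real ` R" "smult (inverse a) p \<in> rotation_limits"
    using monom_limits_compact_factor[OF _ _ P] by blast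
  then show thesis using that by auto
qed

text \<open>A scaling preserves all limits as soon as it carries a single power of the variable into
  them.\<close>

lemma rotation_limits_scalar_tail:
  assumes "smult c (monom 1 n) \<in> rotation_limits" "Q \<in> rotation_limits"
  shows "smult c Q \<in> rotation_limits"
  using rotation_limits_mult_tail[of "[:c:]" 1 n Q] assms by simp

text \<open>A monomial c z^n in the ball is r times a limit for some r in \<open>R\<close>; hence
  |c| / r preserves limits, and r is again the modulus of a monomial in the ball. In logarithms this
  is the covering condition of the semigroup lemma. With a half-line of scalings available, one
  \<open>\<rho>\<close> serves all r, because \<rho> p = (\<rho> r) (p / r).\<close>

lemma ball_scaled_limits:
  obtains \<rho> :: real where "\<rho> > 0" "\<And>p. N (p - p0) < \<epsilon> \<Longrightarrow> smult (of_real \<rho>) p \<in> rotation_limits"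
proof -
  define \<Phi> where "\<Phi> = {u. \<forall>q\<in>rotation_limits. smult (of_real (exp u)) q \<in> rotation_limits}"
  define Q where "Q = {u. \<exists>c n. cmod c = exp u \<and> N (p0 - monom c n) < \<epsilon>}"
  obtain a b where ab: "0 < a" "\<And>r. r \<in> R \<Longrightarrow> a \<le> r" "\<And>r. r \<in> R \<Longrightarrow> r \<le> b" using R_bounds by metis
  have "{0<..} \<subseteq> \<Phi> \<or> {..<0} \<subseteq> \<Phi>"
  proof (rule closed_add_semigroup_translates_nowhere_dense)
    show "closed \<Phi>"
      unfolding closed_sequential_limits
    proof (intro allI impI, elim conjE)
      fix x l assume x: "\<forall>n. x n \<in> \<Phi>" "x \<longlonglongrightarrow> l"
      show "l \<in> \<Phi>"
        unfolding \<Phi>_def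
      proof (intro CollectI ballI monom_limits_closed)
        fix q and e :: real assume q: "q \<in> rotation_limits" and e: "e > 0"
        have "(\<lambda>n. cmod (of_real (exp l) - of_real (exp (x n))) * N q)
            \<longlonglongrightarrow> cmod (of_real (exp l) - of_real (exp l)) * N q"
          by (intro tendsto_intros x)
        then have "(\<lambda>n. N (smult (of_real (exp l)) q - smult (of_real (exp (x n))) q)) \<longlonglongrightarrow> 0"
          by (simp only: N_smult_diff) simp
        then have "eventually (\<lambda>n. N (smult (of_real (exp l)) q - smult (of_real (exp (x n))) q) < e) sequentially"
          using e by (rule order_tendstoD(2))
        then obtain n where "N (smult (of_real (exp l)) q - smult (of_real (exp (x n))) q) < e"
          using eventually_happens by fastforce
        then show "\<exists>r\<in>rotation_limits. N (smult (of_real (exp l)) q - r) < e"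
          using x(1) q by (auto simp: \<Phi>_def)
      qed
    qed
    show "s + t \<in> \<Phi>" if "s \<in> \<Phi>" "t \<in> \<Phi>" for s t
      using that unfolding \<Phi>_def by (force simp: exp_add simp flip: smult_smult)
    show "compact (ln ` R)"
      using R_pos by (intro compact_continuous_image continuous_intros R_compact) fastforce
    show "interior (ln ` R) = {}"
    proof (rule ccontr)
      assume "interior (ln ` R) \<noteq> {}"
      then obtain u where u: "u \<in> interior (ln ` R)" by blast
      define S where "S = {0<..} \<inter> ln -` interior (ln ` R)"
      have "open S" unfolding S_def
        by (intro continuous_open_preimage continuous_intros open_interior) auto
      moreover have "S \<subseteq> R"
      proof
        fix s assume "s \<in> S"
        then have "s > 0" "ln s \<in> ln ` R" using interior_subset by (auto simp: S_def)
        then show "s \<in> R" using R_pos by (auto simp: ln_inj_iff)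
      qed
      moreover have "exp u \<in> S" using u by (simp add: S_def)
      ultimately show False using R_interior interior_maximal by blast
    qed
    show "open Q"
    proof -
      have "Q = (\<Union>c\<in>sphere 0 1. \<Union>n. {u. N (p0 - monom (of_real (exp u) * c) n) < \<epsilon>})"
      proof (intro equalityI subsetI)
        fix u assume "u \<in> Q"
        then obtain c n where c: "cmod c = exp u" "N (p0 - monom c n) < \<epsilon>" by (auto simp: Q_def)
        have "c = of_real (exp u) * (c / of_real (exp u))" by simp
        moreover have "c / of_real (exp u) \<in> sphere 0 1" using c(1) by (simp add: norm_divide)
        ultimately show "u \<in> (\<Union>c\<in>sphere 0 1. \<Union>n. {u. N (p0 - monom (of_real (exp u) * c) n) < \<epsilon>})"
          using c(2) by (metis (mono_tags, lifting) UN_I UNIV_I mem_Collect_eq)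
      next
        fix u assume "u \<in> (\<Union>c\<in>sphere 0 1. \<Union>n. {u. N (p0 - monom (of_real (exp u) * c) n) < \<epsilon>})"
        then obtain c n where "cmod c = 1" "N (p0 - monom (of_real (exp u) * c) n) < \<epsilon>" by auto
        then show "u \<in> Q" unfolding Q_def
          by (intro CollectI exI[of _ "of_real (exp u) * c"] exI[of _ n]) (simp add: norm_mult)
      qed
      moreover have "open {u. N (p0 - monom (of_real (exp u) * c) n) < \<epsilon>}" for c n
      proof (intro open_Collect_less)
        have "continuous_on UNIV (\<lambda>u. complex_of_real (exp u) * c)" by (intro continuous_intros)
        then show "continuous_on UNIV (\<lambda>u. N (p0 - monom (of_real (exp u) * c) n))"
          by (rule continuous_on_compose2[OF continuous_on_N_monom[of UNIV]]) auto
      qed simp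
      ultimately show ?thesis by auto
    qed
    show "Q \<inter> ln ` R \<noteq> {}"
    proof -
      obtain c m where "cmod c \<in> R" "N (p0 - monom c m) < \<epsilon>" using cover[of p0 \<epsilon>] eps_pos by auto
      then have "ln (cmod c) \<in> Q \<inter> ln ` R" using R_pos[of "cmod c"] by (auto simp: Q_def)
      then show ?thesis by blast
    qed
    show "\<exists>r\<in>ln ` R \<inter> Q. t - r \<in> \<Phi>" if "t \<in> Q" for t
    proof -
      obtain c n where c: "cmod c = exp t" "N (p0 - monom c n) < \<epsilon>" using \<open>t \<in> Q\<close> by (auto simp: Q_def)
      then obtain r where r: "r \<in> R" "smult (of_real (inverse r)) (monom c n) \<in> rotation_limits"
        using ball_limits[of "monom c n"] by (metis N_commute)
      have r0: "r > 0" using R_pos r(1) .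
      have "t - ln r \<in> \<Phi>"
        unfolding \<Phi>_def
      proof (rule CollectI, rule ballI, rule rotation_limits_scalar_tail[where n = n])
        have "c \<noteq> 0" using c(1) by auto
        \<comment> \<open>Rotating by the conjugate phase leaves a positive real
          coefficient.\<close>
        have "smult (cnj (sgn c)) (smult (of_real (inverse r)) (monom c n)) \<in> rotation_limits"
          using \<open>c \<noteq> 0\<close> by (intro rotation_limits_smult[OF r(2)]) (simp add: norm_sgn)
        moreover have "cnj (sgn c) * (of_real (inverse r) * c) = of_real (exp (t - ln r))"
        proof -
          have "cnj (sgn c) * c = of_real (cmod c)"
            using \<open>c \<noteq> 0\<close> complex_norm_square[of c] by (simp add: sgn_eq field_simps power2_eq_square)
          then show ?thesis using c(1) r0 by (simp add: exp_diff field_simps)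
        qed
        ultimately show "smult (of_real (exp (t - ln r))) (monom 1 n) \<in> rotation_limits"
          by (simp add: smult_monom)
      qed
      moreover have "ln r \<in> Q"
      proof -
        \<comment> \<open>Multiplication by \<open>r\<close> turns this tolerance into the distance
          that \<open>monom c n\<close> still has to the boundary of the ball.\<close>
        define d where "d = (\<epsilon> - N (p0 - monom c n)) / r"
        have "d > 0" using c r0 by (simp add: d_def)
        then obtain m b where b: "cmod b = 1" "N (smult (of_real (inverse r)) (monom c n) - monom b m) < d"
          using monom_limitsD[OF r(2), of d 0] by auto
        have "smult (of_real r) (smult (of_real (inverse r)) (monom c n) - monom b m)
            = monom c n - monom (of_real r * b) m"
          using r0 by (simp add: smult_diff_right smult_monom)
        then have "N (monom c n - monom (of_real r * b) m)
            = r * N (smult (of_real (inverse r)) (monom c n) - monom b m)"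
          using r0 by (metis abs_of_pos norm_of_real smult)
        also have "\<dots> < r * d" using b(2) r0 by simp
        also have "\<dots> = \<epsilon> - N (p0 - monom c n)" using r0 by (simp add: d_def)
        finally have "N (p0 - monom (of_real r * b) m) < \<epsilon>"
          using N_diff_triangle[of p0 "monom (of_real r * b) m" "monom c n"] by linarith
        then show ?thesis unfolding Q_def using b(1) r0
          by (intro CollectI exI[of _ "of_real r * b"] exI[of _ m]) (simp add: norm_mult)
      qed
      ultimately show ?thesis using r(1) by blast
    qed
  qed
  \<comment> \<open>All products \<open>\<rho> * r\<close> have to lie on the side of 1 covered by
    \<open>\<Phi>\<close>: the lower bound \<open>a\<close> decides how large \<open>\<rho>\<close>
    must be, the upper bound \<open>b\<close> how small. Taking \<open>max b 1\<close> makes the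
    denominator positive without an appeal to \<open>R \<noteq> {}\<close>.\<close>
  then obtain \<rho> where \<rho>: "\<rho> > 0" "\<And>r. r \<in> R \<Longrightarrow> ln (\<rho> * r) \<in> \<Phi>"
  proof
    assume *: "{0<..} \<subseteq> \<Phi>"
    show thesis
    proof (rule that)
      show "2 / a > 0" using ab(1) by simp
      show "ln (2 / a * r) \<in> \<Phi>" if "r \<in> R" for r
      proof -
        have "2 / a * r > 1" using ab(1) ab(2)[OF that] by (simp add: field_simps)
        then show ?thesis using * by auto
      qed
    qed
  next
    assume *: "{..<0} \<subseteq> \<Phi>"
    have b: "b > 0" if "r \<in> R" for r using ab(3)[OF that] R_pos[OF that] by linarith
    show thesis
    proof (rule that)
      show "1 / (2 * max b 1) > 0" by simp
      show "ln (1 / (2 * max b 1) * r) \<in> \<Phi>" if "r \<in> R" for r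
      proof -
        have "1 / (2 * max b 1) * r > 0" "1 / (2 * max b 1) * r < 1"
          using R_pos[OF that] ab(3)[OF that] by (auto simp: field_simps)
        then show ?thesis using * ln_less_zero by blast
      qed
    qed
  qed
  have "smult (of_real \<rho>) p \<in> rotation_limits" if "N (p - p0) < \<epsilon>" for p
  proof -
    obtain r where r: "r \<in> R" "smult (of_real (inverse r)) p \<in> rotation_limits" using ball_limits \<open>N (p - p0) < \<epsilon>\<close> by blast
    have "r > 0" using R_pos r(1) .
    have "smult (of_real (exp (ln (\<rho> * r)))) (smult (of_real (inverse r)) p) \<in> rotation_limits"
      using \<rho>(2)[OF r(1)] r(2) unfolding \<Phi>_def by blast
    moreover have "exp (ln (\<rho> * r)) = \<rho> * r" using \<rho>(1) \<open>r > 0\<close> by simp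
    ultimately show ?thesis using \<open>r > 0\<close> by (simp add: field_simps)
  qed
  then show thesis using that \<rho>(1) by blast
qed

text \<open>The scaled ball consists of limits and its centre is one of them, so the ball contains a
  rotated monomial; undoing the rotation leaves a pure power.\<close>

lemma limits_interior_monom: obtains m where "monom 1 m \<in> limits_interior"
proof -
  obtain \<rho> :: real where \<rho>: "\<rho> > 0" "\<And>p. N (p - p0) < \<epsilon> \<Longrightarrow> smult (of_real \<rho>) p \<in> rotation_limits"
    using ball_scaled_limits by blast
  define P where "P = smult (of_real \<rho>) p0"
  have ball: "q \<in> rotation_limits" if "N (q - P) < \<rho> * \<epsilon>" for q
  proof -
    have "smult (of_real \<rho>) (smult (of_real (inverse \<rho>)) q - p0) = q - P"
      using \<rho>(1) by (simp add: P_def smult_diff_right)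
    then have "\<rho> * N (smult (of_real (inverse \<rho>)) q - p0) = N (q - P)"
      using \<rho>(1) by (metis abs_of_pos norm_of_real smult)
    then have "N (smult (of_real (inverse \<rho>)) q - p0) < \<epsilon>"
      using that \<rho>(1) by (metis mult_less_cancel_left_pos)
    from \<rho>(2)[OF this] show ?thesis using \<rho>(1) by simp
  qed
  have pos: "\<rho> * \<epsilon> > 0" using \<rho>(1) eps_pos by simp
  then have "P \<in> rotation_limits" by (intro ball) simp
  then obtain m c where c: "cmod c = 1" "N (P - monom c m) < \<rho> * \<epsilon>"
    using monom_limitsD[of P "sphere 0 1" "\<rho> * \<epsilon>" 0] pos by auto
  have "monom 1 m \<in> limits_interior"
    unfolding limits_interior_def
  proof (intro CollectI exI[of _ "\<rho> * \<epsilon> - N (P - monom c m)"] conjI allI impI)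
    fix q assume q: "N (q - monom 1 m) < \<rho> * \<epsilon> - N (P - monom c m)"
    have "N (smult c q - monom c m) = N (q - monom 1 m)"
      using smult[of c "q - monom 1 m"] c(1) by (simp add: smult_diff_right smult_monom)
    then have "N (smult c q - P) < \<rho> * \<epsilon>"
      using N_diff_triangle[of "smult c q" P "monom c m"] N_commute[of P "monom c m"] q by linarith
    then have "smult (inverse c) (smult c q) \<in> rotation_limits"
      using c(1) rotation_limits_smult[OF ball, of "smult c q" "inverse c"] by (simp add: norm_inverse)
    then show "q \<in> rotation_limits" using c(1) by (cases "c = 0") auto
  qed (use c in simp)
  then show thesis by (rule that)
qed

theorem orbit_dense:
  assumes "e > 0"
  shows "\<exists>m. N (P - monom 1 m) < e"
proof -
  obtain n where n: "monom 1 n \<in> limits_interior" using limits_interior_monom .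
  \<comment> \<open>Passing to \<open>N'\<close> moves the interior point \<open>monom 1 n\<close> to 1.\<close>
  define N' where "N' p = N (monom 1 n * p)" for p
  interpret shifted: poly_seminorm N' K
  proof
    fix p q :: "complex poly" and c :: complex
    show "N' (p + q) \<le> N' p + N' q" unfolding N'_def by (simp add: distrib_left triangle)
    show "N' (smult c p) = cmod c * N' p" unfolding N'_def by (simp add: smult)
    show "N' (pCons 0 p) \<le> K * N' p" unfolding N'_def using shift[of "monom 1 n * p"] by simp
    show "0 \<le> K" by (rule K_nonneg)
  qed
  interpret shifted: dense_range_seminorm N' K
  proof
    fix p :: "complex poly" assume "p \<noteq> 0"
    show "shifted.dense_range p"
      unfolding shifted.dense_range_def
    proof (intro allI impI)
      fix q and e :: real assume e: "e > 0"
      obtain C where C: "C > 0" "\<And>q. N (monom 1 n * q) \<le> C * N q" using mult_bound[of "monom 1 n"] by blast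
      obtain s where s: "N (q - p * s) < e / C"
        using dense[OF \<open>p \<noteq> 0\<close>] e C(1) unfolding dense_range_def by (meson divide_pos_pos)
      have "N' (q - p * s) \<le> C * N (q - p * s)" unfolding N'_def by (rule C(2))
      also have "\<dots> < e" using s C(1) by (simp add: field_simps)
      finally show "\<exists>s. N' (q - p * s) < e" by blast
    qed
  qed
  obtain d where d: "d > 0" "\<And>q. N (q - monom 1 n) < d \<Longrightarrow> q \<in> rotation_limits"
    using n unfolding limits_interior_def by blast
  have "1 \<in> shifted.limits_interior"
    unfolding shifted.limits_interior_def
  proof (intro CollectI exI[of _ d] conjI allI impI)
    fix q assume "N' (q - 1) < d"
    then have q: "monom 1 n * q \<in> rotation_limits" by (intro d(2)) (simp add: N'_def algebra_simps)
    show "q \<in> shifted.rotation_limits"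
      unfolding shifted.monom_limits_def
    proof (intro CollectI allI impI)
      fix e :: real and k assume "e > 0"
      then obtain m c where m: "m \<ge> n + k" "c \<in> sphere 0 1" "N (monom 1 n * q - monom c m) < e"
        using monom_limitsD[OF q] by blast
      have "monom 1 n * q - monom c m = monom 1 n * (q - monom c (m - n))"
        using m(1) by (simp add: right_diff_distrib mult_monom)
      then have "N' (q - monom c (m - n)) < e" using m(3) by (simp add: N'_def)
      then show "\<exists>m\<ge>k. \<exists>c\<in>sphere 0 1. N' (q - monom c m) < e"
        using m(1,2) by (intro exI[of _ "m - n"]) auto
    qed
  qed (rule d(1))
  then have lim: "p \<in> shifted.monom_limits {1}" for p
    by (intro shifted.orbit_dense_of_rotation_limits_UNIV shifted.rotation_limits_UNIV)
  \<comment> \<open>Multiples of \<open>monom 1 n\<close> are dense, so \<open>P\<close> may be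
    replaced by such a multiple; density for \<open>N'\<close> at the cofactor \<open>s\<close>
    gives the exponent \<open>n + m\<close>.\<close>
  have "monom 1 n \<noteq> (0 :: complex poly)" by simp
  then obtain s where s: "N (P - monom 1 n * s) < e / 2"
    using dense assms unfolding dense_range_def by (meson half_gt_zero)
  obtain m where "N' (s - monom 1 m) < e / 2"
    using shifted.monom_limitsD[OF lim[of s], of "e / 2" 0] assms by auto
  then have "N (monom 1 n * s - monom 1 (n + m)) < e / 2"
    by (simp add: N'_def right_diff_distrib mult_monom)
  then have "N (P - monom 1 (n + m)) < e"
    using s N_diff_triangle[of P "monom 1 (n + m)" "monom 1 n * s"] by linarith
  then show ?thesis by blast
qed

end

section \<open>Orbits in normed spaces\<close>

context complex_normed_space
begin

lemma smult_add_left: "y \<in> carrier X \<Longrightarrow> (a + b) \<odot>\<^bsub>X\<^esub> y = a \<odot>\<^bsub>X\<^esub> y \<oplus>\<^bsub>X\<^esub> b \<odot>\<^bsub>X\<^esub> y"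
  using smult_l_distr[of a b y] by (simp add: complex_ring_def)

lemma smult_smult: "y \<in> carrier X \<Longrightarrow> a \<odot>\<^bsub>X\<^esub> (b \<odot>\<^bsub>X\<^esub> y) = (a * b) \<odot>\<^bsub>X\<^esub> y"
  using smult_assoc1[of a b y] by (simp add: complex_ring_def)

lemma one_smult: "y \<in> carrier X \<Longrightarrow> 1 \<odot>\<^bsub>X\<^esub> y = y"
  using smult_one[of y] by (simp add: complex_ring_def)

lemma zero_smult: "y \<in> carrier X \<Longrightarrow> 0 \<odot>\<^bsub>X\<^esub> y = \<zero>\<^bsub>X\<^esub>"
  using smult_l_null[of y] by (simp add: complex_ring_def)

lemma smult_in [intro, simp]: "y \<in> carrier X \<Longrightarrow> c \<odot>\<^bsub>X\<^esub> y \<in> carrier X"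
  by (rule smult_closed) simp_all

lemma smult_add_right:
  "y \<in> carrier X \<Longrightarrow> z \<in> carrier X \<Longrightarrow> c \<odot>\<^bsub>X\<^esub> (y \<oplus>\<^bsub>X\<^esub> z) = c \<odot>\<^bsub>X\<^esub> y \<oplus>\<^bsub>X\<^esub> c \<odot>\<^bsub>X\<^esub> z"
  by (rule smult_r_distr) simp_all

lemma minus_eq_smult: "y \<in> carrier X \<Longrightarrow> \<ominus>\<^bsub>X\<^esub> y = (-1) \<odot>\<^bsub>X\<^esub> y"
  using smult_add_left[of y 1 "-1"] by (intro M.minus_equality) (simp_all add: zero_smult one_smult M.a_comm)

lemma diff_eq_smult: "y \<in> carrier X \<Longrightarrow> z \<in> carrier X \<Longrightarrow> y \<ominus>\<^bsub>X\<^esub> z = y \<oplus>\<^bsub>X\<^esub> (-1) \<odot>\<^bsub>X\<^esub> z"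
  by (simp add: M.minus_eq minus_eq_smult)

lemma in_closure_iff:
  "y \<in> nrm_topology X closure_of S \<longleftrightarrow>
     y \<in> carrier X \<and> (\<forall>e>0. \<exists>s\<in>S \<inter> carrier X. nrm X (y \<ominus>\<^bsub>X\<^esub> s) < e)"
  using Metric_space.metric_closure_of[OF Metric_space_nrm_dist, of S]
  by (fastforce simp: Metric_space.in_mball[OF Metric_space_nrm_dist] nrm_dist_def)

lemma in_interior_iff:
  "y \<in> nrm_topology X interior_of S \<longleftrightarrow>
     y \<in> carrier X \<and> (\<exists>e>0. \<forall>z\<in>carrier X. nrm X (y \<ominus>\<^bsub>X\<^esub> z) < e \<longrightarrow> z \<in> S)"
  using Metric_space.metric_interior_of[OF Metric_space_nrm_dist, of S]
  by (auto simp: Metric_space.in_mball[OF Metric_space_nrm_dist] nrm_dist_def subset_iff)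

lemma nrm_diff_commute:
  "y \<in> carrier X \<Longrightarrow> z \<in> carrier X \<Longrightarrow> nrm X (y \<ominus>\<^bsub>X\<^esub> z) = nrm X (z \<ominus>\<^bsub>X\<^esub> y)"
  using Metric_space.commute[OF Metric_space_nrm_dist, of y z] by (simp add: nrm_dist_def)

lemma nrm_diff_triangle:
  "y \<in> carrier X \<Longrightarrow> z \<in> carrier X \<Longrightarrow> w \<in> carrier X \<Longrightarrow>
     nrm X (y \<ominus>\<^bsub>X\<^esub> w) \<le> nrm X (y \<ominus>\<^bsub>X\<^esub> z) + nrm X (z \<ominus>\<^bsub>X\<^esub> w)"
  using Metric_space.triangle[OF Metric_space_nrm_dist, of y z w] by (simp add: nrm_dist_def)

end

locale operator_orbit = complex_normed_space +
  fixes T :: "'a \<Rightarrow> 'a" and x :: 'a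
  assumes T: "T \<in> bounded_operators X" and x: "x \<in> carrier X"
begin

lemma T_in [simp, intro]: "y \<in> carrier X \<Longrightarrow> T y \<in> carrier X"
  using T by (auto simp: bounded_operators_def)

lemma T_add: "y \<in> carrier X \<Longrightarrow> z \<in> carrier X \<Longrightarrow> T (y \<oplus>\<^bsub>X\<^esub> z) = T y \<oplus>\<^bsub>X\<^esub> T z"
  using T by (auto simp: bounded_operators_def)

lemma T_smult: "y \<in> carrier X \<Longrightarrow> T (c \<odot>\<^bsub>X\<^esub> y) = c \<odot>\<^bsub>X\<^esub> T y"
  using T by (auto simp: bounded_operators_def)

lemma T_zero: "T \<zero>\<^bsub>X\<^esub> = \<zero>\<^bsub>X\<^esub>"
  using T_smult[of "\<zero>\<^bsub>X\<^esub>" 0] by (simp add: zero_smult)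

lemma T_bounded: obtains K where "K \<ge> 0" "\<And>y. y \<in> carrier X \<Longrightarrow> nrm X (T y) \<le> K * nrm X y"
proof -
  obtain K where K: "\<And>y. y \<in> carrier X \<Longrightarrow> nrm X (T y) \<le> K * nrm X y"
    using T unfolding bounded_operators_def by blast
  have "nrm X (T y) \<le> max K 0 * nrm X y" if "y \<in> carrier X" for y
    using K[OF that] nrm_nonneg[OF that] by (meson max.cobounded1 mult_right_mono order_trans)
  then show thesis by (intro that[of "max K 0"]) auto
qed

lemma T_power_in [simp]: "(T ^^ n) x \<in> carrier X"
  by (induction n) (auto simp: x)

text \<open>Horner's scheme for \<open>p(T) x\<close>.\<close>

definition poly_act :: "complex poly \<Rightarrow> 'a" where
  "poly_act p = fold_coeffs (\<lambda>a y. a \<odot>\<^bsub>X\<^esub> x \<oplus>\<^bsub>X\<^esub> T y) p \<zero>\<^bsub>X\<^esub>"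

lemma poly_act_0 [simp]: "poly_act 0 = \<zero>\<^bsub>X\<^esub>"
  by (simp add: poly_act_def)

lemma poly_act_pCons: "poly_act (pCons a p) = a \<odot>\<^bsub>X\<^esub> x \<oplus>\<^bsub>X\<^esub> T (poly_act p)"
  by (cases "a \<noteq> 0 \<or> p \<noteq> 0")
     (auto simp: poly_act_def fold_coeffs_pCons_not_0_0_eq T_zero zero_smult x)

lemma poly_act_in [simp]: "poly_act p \<in> carrier X"
  by (induction p) (auto simp: poly_act_pCons x)

lemma poly_act_add: "poly_act (p + q) = poly_act p \<oplus>\<^bsub>X\<^esub> poly_act q"
proof (induction p q rule: poly_induct2)
  case (pCons a p b q)
  then show ?case
    by (simp add: poly_act_pCons T_add smult_add_left x M.a_ac)
qed simp

lemma poly_act_smult: "poly_act (smult c p) = c \<odot>\<^bsub>X\<^esub> poly_act p"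
  by (induction p)
     (simp_all add: poly_act_pCons T_smult smult_add_right smult_smult x)

lemma poly_act_diff: "poly_act (p - q) = poly_act p \<ominus>\<^bsub>X\<^esub> poly_act q"
  using poly_act_add[of p "- q"] poly_act_smult[of "-1" q] by (simp add: diff_eq_smult)

lemma poly_act_monom: "poly_act (monom c n) = c \<odot>\<^bsub>X\<^esub> (T ^^ n) x"
  by (induction n)
     (simp_all add: monom_0 monom_Suc poly_act_pCons T_zero T_smult zero_smult x)

lemma poly_seminorm_poly_act: obtains K where "poly_seminorm (\<lambda>p. nrm X (poly_act p)) K"
proof -
  obtain K where K: "K \<ge> 0" "\<And>y. y \<in> carrier X \<Longrightarrow> nrm X (T y) \<le> K * nrm X y" using T_bounded by blast
  have "poly_seminorm (\<lambda>p. nrm X (poly_act p)) K"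
    using K by unfold_locales
      (simp_all add: poly_act_add poly_act_smult poly_act_pCons nrm_triangle nrm_smult zero_smult x)
  then show thesis by (rule that)
qed

text \<open>The ball in the orbit closure is recentred at a vector of the span and moved off 0,
  since \<open>\<Gamma>\<close> may contain 0. Density for polynomials reaches all of
  \<open>X\<close> because the span is dense, which is itself a consequence of the ball.\<close>

theorem hypercyclic_of_somewhere_dense:
  assumes A: "bounded (closure (circle_saturation \<Gamma>) - {0})"
      "bounded_away_from_0 (closure (circle_saturation \<Gamma>) - {0})"
      "interior (closure (circle_saturation \<Gamma>) - {0}) = {}"
    and dense: "somewhere_dense X (scalar_orbit X \<Gamma> x T)"
  shows "hypercyclic_vector X T x"
proof -
  define S where "S = circle_saturation \<Gamma>"
  define N where "N p = nrm X (poly_act p)" for p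
  obtain K where "poly_seminorm N K" using poly_seminorm_poly_act unfolding N_def by blast
  then interpret poly_seminorm N K .
  have orbit: "scalar_orbit X \<Gamma> x T = {poly_act (monom c n) |c n. c \<in> \<Gamma>}"
    by (auto simp: scalar_orbit_def poly_act_monom)
  obtain y e where y: "y \<in> carrier X" "e > 0"
    "\<And>z. z \<in> carrier X \<Longrightarrow> nrm X (y \<ominus>\<^bsub>X\<^esub> z) < e \<Longrightarrow> z \<in> nrm_topology X closure_of scalar_orbit X \<Gamma> x T"
    using dense by (auto simp: somewhere_dense_def in_interior_iff ex_in_conv[symmetric])
  have "y \<in> nrm_topology X closure_of scalar_orbit X \<Gamma> x T"
    using y by (intro y(3)) (simp_all add: M.r_neg M.minus_eq nrm_zero)
  then obtain p1 where p1: "nrm X (y \<ominus>\<^bsub>X\<^esub> poly_act p1) < e / 2"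
    using y(2) unfolding in_closure_iff orbit by (fastforce dest: spec[of _ "e/2"])
  have near: "\<exists>c\<in>\<Gamma>. \<exists>n. nrm X (z \<ominus>\<^bsub>X\<^esub> poly_act (monom c n)) < \<eta>"
    if z: "z \<in> carrier X" "nrm X (poly_act p1 \<ominus>\<^bsub>X\<^esub> z) < e / 2" and "\<eta> > 0" for z \<eta>
  proof -
    have "nrm X (y \<ominus>\<^bsub>X\<^esub> z) < e"
      using nrm_diff_triangle[OF y(1) poly_act_in[of p1] z(1)] p1 z(2) by linarith
    then have "z \<in> nrm_topology X closure_of scalar_orbit X \<Gamma> x T" using y(3) z(1) by blast
    then show ?thesis using \<open>\<eta> > 0\<close> unfolding in_closure_iff orbit by blast
  qed
  have N_near: "\<exists>c\<in>\<Gamma>. \<exists>n. N (p - monom c n) < \<eta>" if "N (p - p1) < e / 2" "\<eta> > 0" for p \<eta>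
    using near[of "poly_act p" \<eta>] that nrm_diff_commute[of "poly_act p" "poly_act p1"]
    by (simp add: N_def poly_act_diff)
  have orbit_dense: "\<exists>m. N (P - monom 1 m) < \<eta>" if \<eta>: "\<eta> > 0" for P \<eta>
  proof (cases "N 1 = 0")
    case True
    \<comment> \<open>If \<open>N 1 = 0\<close>, then \<open>x\<close> is 0 and every seminorm
      vanishes.\<close>
    obtain C where "\<And>q. N ((P - 1) * q) \<le> C * N q" using mult_bound[of "P - 1"] by blast
    from this[of 1] True \<eta> show ?thesis by (intro exI[of _ 0]) (simp add: monom_0 one_pCons)
  next
    case False
    then have N1: "N 1 > 0" using N_nonneg[of 1] by simp
    \<comment> \<open>A ball about \<open>p0\<close> of radius at most \<open>N p0\<close> contains
      no \<open>p\<close> with \<open>N p = 0\<close>; approximations of \<open>p\<close> finer than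
      \<open>N p\<close> then have a non-zero coefficient.\<close>
    obtain p0 where p0: "N (p0 - p1) \<le> e / 4" "N p0 > 0"
    proof (cases "N p1 = 0")
      case True
      define t where "t = complex_of_real (e / (4 * N 1))"
      have t: "N [:t:] = e / 4" using smult[of t 1] N1 y(2) by (simp add: t_def norm_divide)
      show thesis
      proof (rule that)
        show "N (p1 + [:t:] - p1) \<le> e / 4" using t by simp
        show "N (p1 + [:t:]) > 0" using N_diff[of "p1 + [:t:]" p1] t True y(2) by simp
      qed
    next
      case False
      then show thesis using that[of p1] N_nonneg[of p1] y(2) by simp
    qed
    define R where "R = {r. r > 0 \<and> complex_of_real r \<in> closure S}"
    obtain \<delta> where \<delta>: "\<delta> > 0" "\<And>r. r \<in> R \<Longrightarrow> \<delta> \<le> r"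
    proof -
      obtain \<delta> where \<delta>: "\<delta> > 0" "\<And>z. z \<in> closure S - {0} \<Longrightarrow> \<delta> \<le> cmod z"
        using A(2) unfolding bounded_away_from_0_def S_def by blast
      have "\<delta> \<le> r" if "r \<in> R" for r using \<delta>(2)[of "of_real r"] that by (auto simp: R_def)
      then show thesis using that \<delta>(1) by blast
    qed
    \<comment> \<open>The closure is invariant under rotations, so apart from 0 it is described by
      moduli alone.\<close>
    have rot: "z \<in> closure S" if z: "of_real (cmod z) \<in> closure S" "z \<noteq> 0" for z
      unfolding closure_approachable
    proof (intro allI impI)
      fix d :: real assume "d > 0"
      then obtain w where w: "w \<in> S" "dist w (of_real (cmod z)) < d"
        using z(1) unfolding closure_approachable by blast
      then obtain \<gamma> u where "\<gamma> \<in> \<Gamma>" "cmod u = 1" "w = \<gamma> * u" by (auto simp: S_def circle_saturation_def)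
      then have "sgn z * w \<in> S" unfolding S_def circle_saturation_def
        using z(2) by (intro CollectI exI[of _ \<gamma>] exI[of _ "sgn z * u"]) (auto simp: norm_mult norm_sgn)
      moreover have "sgn z * w - z = sgn z * (w - of_real (cmod z))"
        using z(2) by (simp add: sgn_eq right_diff_distrib)
      then have "dist (sgn z * w) z < d" using w(2) z(2) by (simp add: dist_norm norm_mult norm_sgn)
      ultimately show "\<exists>y\<in>S. dist y z < d" by blast
    qed
    interpret nowhere_dense_moduli N K R p0 "min (N p0) (e / 4)"
    proof
      \<comment> \<open>Cutting at \<open>\<delta>\<close> shows closedness even when 0 lies in the
        closure of \<open>S\<close>.\<close>
      have "R = {\<delta>..} \<inter> complex_of_real -` closure S" using \<delta> by (force simp: R_def)
      moreover have "closed ({\<delta>..} \<inter> complex_of_real -` closure S)"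
        by (intro closed_Int continuous_closed_vimage continuous_intros) auto
      moreover obtain b where "\<And>z. z \<in> closure S - {0} \<Longrightarrow> cmod z \<le> b"
        using A(1) unfolding bounded_iff S_def by blast
      then have "\<And>r. r \<in> R \<Longrightarrow> norm r \<le> b" by (force simp: R_def)
      then have "bounded R" unfolding bounded_iff by blast
      ultimately show "compact R" by (simp add: compact_eq_bounded_closed)
      show "r > 0" if "r \<in> R" for r using that by (simp add: R_def)
      show "interior R = {}"
      proof (rule ccontr)
        assume "interior R \<noteq> {}"
        then obtain r where r: "r \<in> interior R" by blast
        \<comment> \<open>By rotation invariance, an interval of moduli would fill an annulus of the
          closure.\<close>
        have "open (cmod -` interior R)" by (intro open_vimage open_interior continuous_intros)
        moreover have "cmod -` interior R \<subseteq> closure S - {0}"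
        proof
          fix z assume "z \<in> cmod -` interior R"
          then have "cmod z \<in> R" using interior_subset by auto
          then show "z \<in> closure S - {0}" using rot[of z] by (auto simp: R_def)
        qed
        ultimately have "cmod -` interior R = {}"
          using A(3) interior_maximal unfolding S_def by blast
        moreover have "r > 0" using r interior_subset[of R] by (auto simp: R_def)
        then have "complex_of_real r \<in> cmod -` interior R" using r by simp
        ultimately show False by blast
      qed
      show "N 1 > 0" by (rule N1)
      show "min (N p0) (e / 4) > 0" using p0 y(2) by simp
      show "\<exists>c m. cmod c \<in> R \<and> N (p - monom c m) < \<eta>" if p: "N (p - p0) < min (N p0) (e / 4)" and "\<eta> > 0" for p \<eta>
      proof -
        have "N (p - p1) < e / 2" using p p0(1) N_diff_triangle[of p p1 p0] by linarith
        moreover have pos: "N p > 0" using p N_diff[of "p - p0" p] N_minus[of p0] by simp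
        ultimately obtain c n where c: "c \<in> \<Gamma>" "N (p - monom c n) < min \<eta> (N p)"
          using N_near[of p "min \<eta> (N p)"] \<open>\<eta> > 0\<close> by auto
        then have "c \<noteq> 0" by auto
        then have "of_real (cmod c) \<in> S" unfolding S_def circle_saturation_def using c(1)
          by - (rule CollectI, rule exI[of _ c], rule exI[of _ "inverse (sgn c)"],
            simp add: norm_inverse norm_divide sgn_eq)
        then have "cmod c \<in> R" using closure_subset[of S] \<open>c \<noteq> 0\<close> by (auto simp: R_def)
        then show ?thesis using c(2) by auto
      qed
    qed
    show ?thesis using orbit_dense \<eta> by blast
  qed
  have "z \<in> nrm_topology X closure_of range (\<lambda>n. (T ^^ n) x)" if z: "z \<in> carrier X" for z
    unfolding in_closure_iff
  proof (intro conjI allI impI z)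
    fix d :: real assume d: "d > 0"
    \<comment> \<open>With this factor the multiple of \<open>z\<close> has norm at most
      \<open>e / 4\<close>, so adding it to \<open>poly_act p1\<close> stays within the ball.
      Approximating the sum by an orbit element and solving for \<open>z\<close> gives a vector of
      the span.\<close>
    define t where "t = e / (4 * (nrm X z + 1))"
    have t: "t > 0" using y(2) nrm_nonneg[OF z] by (simp add: t_def)
    define c where "c = complex_of_real t"
    have c: "c \<noteq> 0" "cmod c = t" using t by (auto simp: c_def)
    define w where "w = poly_act p1 \<oplus>\<^bsub>X\<^esub> c \<odot>\<^bsub>X\<^esub> z"
    have w: "w \<in> carrier X" using z by (simp add: w_def)
    have "w \<ominus>\<^bsub>X\<^esub> poly_act p1 = c \<odot>\<^bsub>X\<^esub> z" using z by (simp add: w_def M.minus_eq M.a_ac M.r_neg1 M.r_neg2 M.r_neg M.l_neg)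
    then have "nrm X (poly_act p1 \<ominus>\<^bsub>X\<^esub> w) = t * nrm X z"
      using nrm_diff_commute[of w "poly_act p1"] w z c(2) by (simp add: nrm_smult)
    also have "\<dots> \<le> t * (nrm X z + 1)" using t by (intro mult_left_mono) auto
    also have "\<dots> = e / 4"
    proof -
      have "nrm X z + 1 \<noteq> 0" using nrm_nonneg[OF z] by simp
      then show ?thesis unfolding t_def by (simp add: divide_simps)
    qed
    also have "\<dots> < e / 2" using y(2) by simp
    finally obtain a n where a: "nrm X (w \<ominus>\<^bsub>X\<^esub> poly_act (monom a n)) < t * (d / 2)"
      using near[OF w, of "t * (d / 2)"] t d by auto
    define p where "p = smult (inverse c) (monom a n - p1)"
    have "c \<odot>\<^bsub>X\<^esub> (z \<ominus>\<^bsub>X\<^esub> poly_act p) = w \<ominus>\<^bsub>X\<^esub> poly_act (monom a n)"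
    proof -
      have "c \<odot>\<^bsub>X\<^esub> poly_act p = poly_act (monom a n) \<ominus>\<^bsub>X\<^esub> poly_act p1"
        using c(1) by (simp add: p_def poly_act_smult smult_smult one_smult poly_act_diff)
      moreover have "c \<odot>\<^bsub>X\<^esub> (z \<ominus>\<^bsub>X\<^esub> poly_act p) = c \<odot>\<^bsub>X\<^esub> z \<ominus>\<^bsub>X\<^esub> c \<odot>\<^bsub>X\<^esub> poly_act p"
        using z by (simp add: diff_eq_smult smult_add_right smult_smult mult.commute)
      ultimately show ?thesis
        using z by (simp add: w_def M.minus_eq M.minus_add M.a_ac)
    qed
    then have "t * nrm X (z \<ominus>\<^bsub>X\<^esub> poly_act p) < t * (d / 2)"
      using a c(2) z nrm_smult[of "z \<ominus>\<^bsub>X\<^esub> poly_act p" c] by simp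
    then have 1: "nrm X (z \<ominus>\<^bsub>X\<^esub> poly_act p) < d / 2" using t by simp
    obtain m where "N (p - monom 1 m) < d / 2" using orbit_dense[of "d / 2"] d by auto
    then have 2: "nrm X (poly_act p \<ominus>\<^bsub>X\<^esub> (T ^^ m) x) < d / 2"
      by (simp add: N_def poly_act_diff poly_act_monom one_smult)
    have "nrm X (z \<ominus>\<^bsub>X\<^esub> (T ^^ m) x) < d"
      using nrm_diff_triangle[OF z poly_act_in[of p] T_power_in[of m]] 1 2 by linarith
    then show "\<exists>s\<in>range (\<lambda>n. (T ^^ n) x) \<inter> carrier X. nrm X (z \<ominus>\<^bsub>X\<^esub> s) < d" by auto
  qed
  moreover have "nrm_topology X closure_of range (\<lambda>n. (T ^^ n) x) \<subseteq> carrier X"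
    by (auto simp: in_closure_iff)
  ultimately show ?thesis unfolding hypercyclic_vector_def using x by blast
qed

lemma somewhere_dense_of_hypercyclic:
  assumes "hypercyclic_vector X T x" "\<gamma> \<in> \<Gamma>" "\<gamma> \<noteq> 0"
  shows "somewhere_dense X (scalar_orbit X \<Gamma> x T)"
proof -
  have "z \<in> nrm_topology X closure_of scalar_orbit X \<Gamma> x T" if z: "z \<in> carrier X" for z
    unfolding in_closure_iff
  proof (intro conjI allI impI z)
    fix e :: real assume e: "e > 0"
    have "inverse \<gamma> \<odot>\<^bsub>X\<^esub> z \<in> nrm_topology X closure_of range (\<lambda>n. (T ^^ n) x)"
      using assms(1) z by (simp add: hypercyclic_vector_def)
    moreover have "e / cmod \<gamma> > 0" using e assms(3) by simp
    ultimately obtain n where n: "nrm X (inverse \<gamma> \<odot>\<^bsub>X\<^esub> z \<ominus>\<^bsub>X\<^esub> (T ^^ n) x) < e / cmod \<gamma>"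
      unfolding in_closure_iff by blast
    have "z \<ominus>\<^bsub>X\<^esub> \<gamma> \<odot>\<^bsub>X\<^esub> (T ^^ n) x = \<gamma> \<odot>\<^bsub>X\<^esub> (inverse \<gamma> \<odot>\<^bsub>X\<^esub> z \<ominus>\<^bsub>X\<^esub> (T ^^ n) x)"
      using z assms(3) by (simp add: diff_eq_smult smult_add_right smult_smult one_smult mult.commute)
    then have "nrm X (z \<ominus>\<^bsub>X\<^esub> \<gamma> \<odot>\<^bsub>X\<^esub> (T ^^ n) x) = cmod \<gamma> * nrm X (inverse \<gamma> \<odot>\<^bsub>X\<^esub> z \<ominus>\<^bsub>X\<^esub> (T ^^ n) x)"
      using z by (simp add: nrm_smult)
    also have "\<dots> < e" using n assms(3) by (simp add: field_simps)
    finally show "\<exists>s\<in>scalar_orbit X \<Gamma> x T \<inter> carrier X. nrm X (z \<ominus>\<^bsub>X\<^esub> s) < e"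
      using assms(2) by (intro bexI[of _ "\<gamma> \<odot>\<^bsub>X\<^esub> (T ^^ n) x"]) (auto simp: scalar_orbit_def)
  qed
  then have "\<zero>\<^bsub>X\<^esub> \<in> nrm_topology X interior_of (nrm_topology X closure_of scalar_orbit X \<Gamma> x T)"
    by (auto simp: in_interior_iff intro!: exI[of _ 1])
  then show ?thesis unfolding somewhere_dense_def by blast
qed

end

section \<open>A copy of the space of null sequences\<close>

text \<open>Real and imaginary parts are determined by the rationals below them, so a sequence is
  coded by a set of naturals and hence by a real. This makes room for the counterexample space in
  \<open>'a\<close>.\<close>

lemma inj_sequences_of_inj_complex:
  fixes emb :: "complex \<Rightarrow> 'a" assumes "inj emb"
  obtains j :: "(nat \<Rightarrow> complex) \<Rightarrow> 'a" where "inj j"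
proof -
  define part where "part b f i = (if b then Re (f i) else Im (f i))" for b and f :: "nat \<Rightarrow> complex" and i :: nat
  define h where "h f = {to_nat (i, b, q) |i b q. real_of_rat q < part b f i}" for f
  have h_iff: "to_nat (i, b, q) \<in> h f \<longleftrightarrow> real_of_rat q < part b f i" for i b q f
    by (auto simp: h_def)
  have "inj h"
  proof (rule injI)
    fix f g assume eq: "h f = h g"
    have "part b f i = part b g i" for b i
    proof (rule ccontr)
      assume "part b f i \<noteq> part b g i"
      then obtain q where "(part b f i < real_of_rat q \<and> real_of_rat q < part b g i) \<or>
          (part b g i < real_of_rat q \<and> real_of_rat q < part b f i)"
        using of_rat_dense by (metis linorder_neqE_linordered_idom)
      then show False using h_iff[of i b q f] h_iff[of i b q g] eq by auto
    qed
    from this[of True] this[of False] show "f = g" by (simp add: part_def complex_eq_iff fun_eq_iff)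
  qed
  moreover obtain r :: "nat set \<Rightarrow> real" where "inj r"
    using nat_sets_eqpoll_reals unfolding eqpoll_def bij_betw_def by blast
  ultimately have "inj (emb \<circ> complex_of_real \<circ> r \<circ> h)"
    using assms by (intro inj_compose) (auto simp: inj_def)
  then show thesis by (rule that)
qed

definition null_sequences :: "(nat \<Rightarrow> complex) set" where
  "null_sequences = {f. f \<longlonglongrightarrow> 0}"

definition sup_norm :: "(nat \<Rightarrow> complex) \<Rightarrow> real" where
  "sup_norm f = (SUP i. cmod (f i))"

lemma norm_le_sup_norm: assumes "f \<in> null_sequences" shows "cmod (f i) \<le> sup_norm f"
proof -
  have "Bseq f" using assms by (intro convergent_imp_Bseq convergentI) (simp add: null_sequences_def)
  then have "bdd_above (range (\<lambda>i. cmod (f i)))" by (auto simp: Bseq_def bdd_above_def)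
  then show ?thesis unfolding sup_norm_def by (rule cSUP_upper[OF UNIV_I])
qed

lemma sup_norm_le: "(\<And>i. cmod (f i) \<le> B) \<Longrightarrow> sup_norm f \<le> B"
  unfolding sup_norm_def by (rule cSUP_least) auto

lemma null_sequences_add: "f \<in> null_sequences \<Longrightarrow> g \<in> null_sequences \<Longrightarrow> (\<lambda>i. f i + g i) \<in> null_sequences"
  unfolding null_sequences_def using tendsto_add[of f 0 sequentially g 0] by simp

lemma null_sequences_mult: "f \<in> null_sequences \<Longrightarrow> (\<lambda>i. c * f i) \<in> null_sequences"
  unfolding null_sequences_def using tendsto_mult_left[of f 0 sequentially c] by simp

lemma null_sequences_diff: "f \<in> null_sequences \<Longrightarrow> g \<in> null_sequences \<Longrightarrow> (\<lambda>i. f i - g i) \<in> null_sequences"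
  using null_sequences_add[of f "\<lambda>i. (-1) * g i"] null_sequences_mult[of g "-1"] by simp

lemma null_sequences_finite_support: assumes "\<And>i. i \<ge> n \<Longrightarrow> f i = 0" shows "f \<in> null_sequences"
proof -
  have "eventually (\<lambda>i. f i = 0) sequentially" using assms by (auto simp: eventually_sequentially)
  then show ?thesis unfolding null_sequences_def by (simp add: tendsto_eventually)
qed

lemma null_sequences_shift: "f \<in> null_sequences \<Longrightarrow> (\<lambda>i. f (i + k)) \<in> null_sequences"
  unfolding null_sequences_def using LIMSEQ_ignore_initial_segment[of f 0 k] by simp

lemma sup_norm_mult: assumes "f \<in> null_sequences" shows "sup_norm (\<lambda>i. c * f i) = cmod c * sup_norm f"
proof (cases "c = 0")
  case True
  then show ?thesis by (simp add: sup_norm_def)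
next
  case False
  have 1: "sup_norm (\<lambda>i. c * f i) \<le> cmod c * sup_norm f" if "f \<in> null_sequences" for c f
    by (intro sup_norm_le) (simp add: norm_mult mult_left_mono norm_le_sup_norm[OF that])
  have "sup_norm (\<lambda>i. inverse c * (c * f i)) \<le> cmod (inverse c) * sup_norm (\<lambda>i. c * f i)"
    by (rule 1[OF null_sequences_mult[OF assms]])
  moreover have "(\<lambda>i. inverse c * (c * f i)) = f" using False by (simp flip: mult.assoc)
  ultimately have "cmod c * sup_norm f \<le> cmod c * (cmod (inverse c) * sup_norm (\<lambda>i. c * f i))"
    by (simp add: mult_left_mono)
  also have "\<dots> = sup_norm (\<lambda>i. c * f i)" using False by (simp add: norm_inverse)
  finally have "cmod c * sup_norm f \<le> sup_norm (\<lambda>i. c * f i)" .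
  with 1[OF assms, of c] show ?thesis by simp
qed

lemma cring_complex_ring: "cring complex_ring"
proof (rule cringI)
  show "abelian_group complex_ring"
  proof (rule abelian_groupI)
    fix x assume "x \<in> carrier complex_ring"
    show "\<exists>y\<in>carrier complex_ring. y \<oplus>\<^bsub>complex_ring\<^esub> x = \<zero>\<^bsub>complex_ring\<^esub>"
      by (rule bexI[of _ "-x"]) (simp_all add: complex_ring_def)
  qed (simp_all add: complex_ring_def)
  show "comm_monoid complex_ring"
    by (rule comm_monoidI) (simp_all add: complex_ring_def)
qed (simp add: complex_ring_def distrib_right)

text \<open>Two annihilators of \<open>B\<close> with disjoint supports have a non-trivial
  combination that also annihilates \<open>b\<close>. The lower bound \<open>m\<close> on the
  support is what the induction needs to make them disjoint.\<close>

lemma finite_support_annihilator: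
  fixes F :: "'b \<Rightarrow> nat \<Rightarrow> complex"
  assumes "finite B"
  shows "\<exists>n a. (\<forall>i. a i \<noteq> 0 \<longrightarrow> m \<le> i \<and> i < n) \<and> (\<exists>i. a i \<noteq> 0) \<and> (\<forall>b\<in>B. (\<Sum>i<n. a i * F b i) = 0)"
  using assms
proof (induction B arbitrary: m)
  case empty
  show ?case by (intro exI[of _ "Suc m"] exI[of _ "\<lambda>i. if i = m then 1 else 0"]) auto
next
  case (insert b B)
  obtain n1 a1 where a1: "\<And>i. a1 i \<noteq> 0 \<Longrightarrow> m \<le> i \<and> i < n1" "\<exists>i. a1 i \<noteq> 0"
    "\<And>b. b \<in> B \<Longrightarrow> (\<Sum>i<n1. a1 i * F b i) = 0"
    using insert.IH[of m] by blast
  obtain n2 a2 where a2: "\<And>i. a2 i \<noteq> 0 \<Longrightarrow> max m n1 \<le> i \<and> i < n2" "\<exists>i. a2 i \<noteq> 0"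
    "\<And>b. b \<in> B \<Longrightarrow> (\<Sum>i<n2. a2 i * F b i) = 0"
    using insert.IH[of "max m n1"] by blast
  obtain i2 where i2: "a2 i2 \<noteq> 0" using a2(2) by blast
  then have n12: "n1 \<le> i2" "i2 < n2" using a2(1)[OF i2] by auto
  define \<alpha> where "\<alpha> = (\<Sum>i<n1. a1 i * F b i)"
  define \<beta> where "\<beta> = (\<Sum>i<n2. a2 i * F b i)"
  show ?case
  proof (cases "\<alpha> = 0")
    case True
    then show ?thesis using a1 by (intro exI[of _ n1] exI[of _ a1]) (auto simp: \<alpha>_def)
  next
    case False
    \<comment> \<open>Against \<open>F b\<close> the two parts cancel. At \<open>i2\<close> the
      first part vanishes, so \<open>\<alpha> \<noteq> 0\<close> keeps the combination
      non-zero.\<close>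
    define a where "a i = \<beta> * a1 i - \<alpha> * a2 i" for i
    have ext: "(\<Sum>i<n2. a1 i * F c i) = (\<Sum>i<n1. a1 i * F c i)" for c
      using a1(1) n12 by (intro sum.mono_neutral_right) (auto, metis not_less)
    have sum_a: "(\<Sum>i<n2. a i * F c i) = \<beta> * (\<Sum>i<n1. a1 i * F c i) - \<alpha> * (\<Sum>i<n2. a2 i * F c i)" for c
      by (simp add: a_def left_diff_distrib sum_subtractf mult.assoc flip: sum_distrib_left ext)
    have "a1 i2 = 0" using a1(1)[of i2] n12 by auto
    then have "a i2 \<noteq> 0" using i2 False by (simp add: a_def)
    moreover have "m \<le> i \<and> i < n2" if "a i \<noteq> 0" for i
    proof -
      have "a1 i \<noteq> 0 \<or> a2 i \<noteq> 0" using that by (auto simp: a_def)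
      then show ?thesis using a1(1)[of i] a2(1)[of i] n12 by auto
    qed
    moreover have "(\<Sum>i<n2. a i * F c i) = 0" if "c \<in> insert b B" for c
      unfolding sum_a using that a1(3) a2(3) by (auto simp: \<alpha>_def \<beta>_def)
    ultimately show ?thesis by blast
  qed
qed

locale sequence_copy =
  fixes j :: "(nat \<Rightarrow> complex) \<Rightarrow> 'a" assumes inj: "inj j"
begin

abbreviation coord :: "'a \<Rightarrow> nat \<Rightarrow> complex" where "coord \<equiv> inv_into UNIV j"

lemma coord_j [simp]: "coord (j f) = f"
  by (rule inv_f_f[OF inj])

definition c0_space :: "'a normed_module" where
  "c0_space = \<lparr>carrier = j ` null_sequences, monoid.mult = undefined, one = undefined,
     ring.zero = j (\<lambda>i. 0), add = (\<lambda>u v. j (\<lambda>i. coord u i + coord v i)),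
     module.smult = (\<lambda>c u. j (\<lambda>i. c * coord u i)), nrm = (\<lambda>u. sup_norm (coord u))\<rparr>"

lemma c0_simps [simp]:
  "carrier c0_space = j ` null_sequences"
  "\<zero>\<^bsub>c0_space\<^esub> = j (\<lambda>i. 0)"
  "u \<oplus>\<^bsub>c0_space\<^esub> v = j (\<lambda>i. coord u i + coord v i)"
  "c \<odot>\<^bsub>c0_space\<^esub> u = j (\<lambda>i. c * coord u i)"
  "nrm c0_space u = sup_norm (coord u)"
  by (simp_all add: c0_space_def)

sublocale c0: complex_normed_space c0_space
proof (intro complex_normed_space.intro complex_normed_space_axioms.intro moduleI)
  show "cring complex_ring" by (rule cring_complex_ring)
  show "abelian_group c0_space"
  proof (rule abelian_groupI)
    fix u assume "u \<in> carrier c0_space"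
    then obtain f where "u = j f" "f \<in> null_sequences" by auto
    then show "\<exists>v\<in>carrier c0_space. v \<oplus>\<^bsub>c0_space\<^esub> u = \<zero>\<^bsub>c0_space\<^esub>"
      using null_sequences_mult[of f "-1"] by (intro bexI[of _ "j (\<lambda>i. -1 * f i)"]) auto
  qed (auto simp: null_sequences_add add_ac intro: null_sequences_finite_support)
  fix u v c
  assume u: "u \<in> carrier c0_space"
  show "nrm c0_space u = 0 \<Longrightarrow> u = \<zero>\<^bsub>c0_space\<^esub>"
  proof -
    assume *: "nrm c0_space u = 0"
    obtain f where f: "u = j f" "f \<in> null_sequences" using u by auto
    then have "f i = 0" for i using norm_le_sup_norm[of f i] * by simp
    then have "f = (\<lambda>i. 0)" by blast
    then show ?thesis by (simp add: f(1))
  qed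
  show "0 \<le> nrm c0_space u"
    using u norm_le_sup_norm by (fastforce intro: order_trans[OF norm_ge_zero])
  show "nrm c0_space (c \<odot>\<^bsub>c0_space\<^esub> u) = cmod c * nrm c0_space u" using u by (auto simp: sup_norm_mult)
  assume v: "v \<in> carrier c0_space"
  show "nrm c0_space (u \<oplus>\<^bsub>c0_space\<^esub> v) \<le> nrm c0_space u + nrm c0_space v"
    using u v by (auto intro!: sup_norm_le norm_triangle_le add_mono norm_le_sup_norm)
qed (auto simp: complex_ring_def null_sequences_mult algebra_simps)

lemma c0_diff:
  assumes "f \<in> null_sequences" "g \<in> null_sequences"
  shows "j f \<ominus>\<^bsub>c0_space\<^esub> j g = j (\<lambda>i. f i - g i)"
  using c0.diff_eq_smult[of "j f" "j g"] assms by simp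

lemma nrm_dist_c0:
  assumes "f \<in> null_sequences" "g \<in> null_sequences"
  shows "nrm_dist c0_space (j f) (j g) = sup_norm (\<lambda>i. f i - g i)"
  using assms by (simp add: nrm_dist_def c0_diff)

text \<open>Coordinatewise limits exist; the Cauchy estimate is uniform in the coordinate and
  survives in the limit, and uniform limits of null sequences are null.\<close>

lemma complex_banach_space_c0: "complex_banach_space c0_space"
proof -
  interpret M: Metric_space "carrier c0_space" "nrm_dist c0_space" by (rule c0.Metric_space_nrm_dist)
  have "\<exists>l. limitin M.mtopology \<sigma> l sequentially" if \<sigma>: "M.MCauchy \<sigma>" for \<sigma>
  proof -
    define s where "s n = coord (\<sigma> n)" for n
    have \<sigma>_in: "\<sigma> n \<in> j ` null_sequences" for n using \<sigma> unfolding M.MCauchy_def by auto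
    have s: "s n \<in> null_sequences" "\<sigma> n = j (s n)" for n
    proof -
      obtain f where "\<sigma> n = j f" "f \<in> null_sequences"
        using \<sigma>_in[of n] by (rule imageE)
      then show "s n \<in> null_sequences" "\<sigma> n = j (s n)" by (simp_all add: s_def)
    qed
    have cauchy: "\<exists>N. \<forall>n\<ge>N. \<forall>k\<ge>N. \<forall>i. cmod (s n i - s k i) < e" if e: "e > 0" for e
    proof -
      obtain N where N: "\<And>n k. n \<ge> N \<Longrightarrow> k \<ge> N \<Longrightarrow> nrm_dist c0_space (\<sigma> n) (\<sigma> k) < e"
        using \<sigma> e unfolding M.MCauchy_def by blast
      have "cmod (s n i - s k i) < e" if "n \<ge> N" "k \<ge> N" for n k i
        using N[OF that] norm_le_sup_norm[OF null_sequences_diff[OF s(1)[of n] s(1)[of k]], of i]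
        unfolding s(2) nrm_dist_c0[OF s(1) s(1)] by linarith
      then show ?thesis by blast
    qed
    have "Cauchy (\<lambda>n. s n i)" for i
      unfolding Cauchy_def dist_norm using cauchy by meson
    then have "\<exists>l. (\<lambda>n. s n i) \<longlonglongrightarrow> l" for i by (simp add: Cauchy_convergent_iff convergent_def)
    then obtain l where l: "\<And>i. (\<lambda>n. s n i) \<longlonglongrightarrow> l i" by metis
    have unif: "\<exists>N. \<forall>n\<ge>N. \<forall>i. cmod (s n i - l i) \<le> e" if e: "e > 0" for e
    proof -
      obtain N where N: "\<And>n k i. n \<ge> N \<Longrightarrow> k \<ge> N \<Longrightarrow> cmod (s n i - s k i) < e" using cauchy[OF e] by blast
      have "cmod (s n i - l i) \<le> e" if "n \<ge> N" for n i
      proof (rule tendsto_upperbound)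
        show "(\<lambda>k. cmod (s n i - s k i)) \<longlonglongrightarrow> cmod (s n i - l i)" by (intro tendsto_intros l)
        show "\<forall>\<^sub>F k in sequentially. cmod (s n i - s k i) \<le> e"
          using N[OF that] by (auto simp: eventually_sequentially intro!: exI[of _ N] less_imp_le)
      qed simp
      then show ?thesis by blast
    qed
    have l0: "l \<in> null_sequences"
      unfolding null_sequences_def LIMSEQ_iff
    proof (intro CollectI allI impI)
      fix e :: real assume "e > 0"
      then obtain n where n: "\<And>i. cmod (s n i - l i) \<le> e / 2" using unif[of "e/2"] by auto
      obtain I where I: "\<And>i. i \<ge> I \<Longrightarrow> cmod (s n i) < e / 2"
        using LIMSEQ_D[of "s n" 0 "e / 2"] s(1)[of n] \<open>e > 0\<close> by (auto simp: null_sequences_def)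
      have "cmod (l i - 0) < e" if "i \<ge> I" for i
        using n[of i] I[OF that] norm_triangle_ineq4[of "s n i" "s n i - l i"] by simp
      then show "\<exists>I. \<forall>i\<ge>I. cmod (l i - 0) < e" by blast
    qed
    have "limitin M.mtopology \<sigma> (j l) sequentially"
      unfolding M.limitin_metric
    proof (intro conjI allI impI)
      show "j l \<in> carrier c0_space" using l0 by simp
      fix e :: real assume "e > 0"
      then obtain N where N: "\<And>n i. n \<ge> N \<Longrightarrow> cmod (s n i - l i) \<le> e / 2" using unif[of "e/2"] by auto
      have "nrm_dist c0_space (\<sigma> n) (j l) < e" if "n \<ge> N" for n
        using sup_norm_le[of "\<lambda>i. s n i - l i", OF N[OF that]] \<open>e > 0\<close>
        unfolding s(2) nrm_dist_c0[OF s(1) l0] by linarith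
      then show "\<forall>\<^sub>F n in sequentially. \<sigma> n \<in> carrier c0_space \<and> nrm_dist c0_space (\<sigma> n) (j l) < e"
        using s by (auto simp: eventually_sequentially)
    qed
    then show ?thesis by blast
  qed
  then show ?thesis
    unfolding complex_banach_space_def M.mcomplete_def using c0.complex_normed_space_axioms by blast
qed

text \<open>A finitely supported functional annihilating a finite spanning set would annihilate its
  own conjugate, which is a null sequence, so its squared moduli would sum to 0.\<close>

lemma infinite_dimensional_c0: "infinite_dimensional c0_space"
  unfolding infinite_dimensional_def
proof (rule notI, elim exE conjE)
  fix B assume B: "finite B" "B \<subseteq> carrier c0_space"
    "\<forall>x\<in>carrier c0_space. \<exists>c. x = (\<Oplus>\<^bsub>c0_space\<^esub>b\<in>B. c b \<odot>\<^bsub>c0_space\<^esub> b)"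
  have coord_sum: "coord (\<Oplus>\<^bsub>c0_space\<^esub>b\<in>B'. c b \<odot>\<^bsub>c0_space\<^esub> b) i = (\<Sum>b\<in>B'. c b * coord b i)"
    if "finite B'" "B' \<subseteq> carrier c0_space" for B' c i
    using that
  proof (induction B')
    case (insert b B')
    have "(\<lambda>b. c b \<odot>\<^bsub>c0_space\<^esub> b) \<in> insert b B' \<rightarrow> carrier c0_space"
      using insert.prems c0.smult_in by blast
    then show ?case using insert by (simp add: c0.M.finsum_insert Pi_def del: c0_simps(1,4)) (simp)
  qed simp
  obtain n a where a: "\<And>i. a i \<noteq> 0 \<Longrightarrow> i < n" "\<exists>i. a i \<noteq> 0" "\<And>b. b \<in> B \<Longrightarrow> (\<Sum>i<n. a i * coord b i) = 0"
    using finite_support_annihilator[OF B(1), of 0 coord] by blast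
  have "(\<lambda>i. cnj (a i)) \<in> null_sequences"
    using a(1) by (intro null_sequences_finite_support[of n]) (metis complex_cnj_zero not_less)
  then obtain c where c: "j (\<lambda>i. cnj (a i)) = (\<Oplus>\<^bsub>c0_space\<^esub>b\<in>B. c b \<odot>\<^bsub>c0_space\<^esub> b)"
    using B(3) by auto
  have "cnj (a i) = (\<Sum>b\<in>B. c b * coord b i)" for i
    using coord_sum[OF B(1,2), of c i] unfolding c[symmetric] by simp
  then have "(\<Sum>i<n. a i * cnj (a i)) = (\<Sum>i<n. \<Sum>b\<in>B. c b * (a i * coord b i))"
    by (simp add: sum_distrib_left mult_ac)
  also have "\<dots> = (\<Sum>b\<in>B. c b * (\<Sum>i<n. a i * coord b i))"
    by (subst sum.swap) (simp add: sum_distrib_left)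
  also have "\<dots> = 0" using a(3) by simp
  finally have "complex_of_real (\<Sum>i<n. (cmod (a i))\<^sup>2) = 0"
    by (simp only: of_real_sum complex_norm_square)
  then have "(\<Sum>i<n. (cmod (a i))\<^sup>2) = 0" by (simp only: of_real_eq_0_iff)
  then have "\<forall>i<n. a i = 0" by (simp add: sum_nonneg_eq_0_iff)
  then show False using a(1,2) by blast
qed

section \<open>Operators on null sequences and criteria for failure\<close>

definition lift :: "((nat \<Rightarrow> complex) \<Rightarrow> nat \<Rightarrow> complex) \<Rightarrow> 'a \<Rightarrow> 'a" where
  "lift S u = j (S (coord u))"

lemma lift_power: "(lift S ^^ n) (j f) = j ((S ^^ n) f)"
  by (induction n) (simp_all add: lift_def)

end

definition null_sequence_operator :: "((nat \<Rightarrow> complex) \<Rightarrow> nat \<Rightarrow> complex) \<Rightarrow> bool" where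
  "null_sequence_operator S \<longleftrightarrow> (\<forall>f\<in>null_sequences. S f \<in> null_sequences)
     \<and> (\<forall>f g. S (\<lambda>i. f i + g i) = (\<lambda>i. S f i + S g i)) \<and> (\<forall>c f. S (\<lambda>i. c * f i) = (\<lambda>i. c * S f i))
     \<and> (\<exists>K. \<forall>f\<in>null_sequences. \<forall>i. cmod (S f i) \<le> K * sup_norm f)"

lemma null_sequence_operator_power:
  "null_sequence_operator S \<Longrightarrow> f \<in> null_sequences \<Longrightarrow> (S ^^ n) f \<in> null_sequences"
  by (induction n) (auto simp: null_sequence_operator_def)

text \<open>Membership of \<open>g\<close> in the closure of the scalar orbit, written in
  coordinates so that counterexamples can be checked on sequences.\<close>

definition scalar_approximable ::
  "((nat \<Rightarrow> complex) \<Rightarrow> nat \<Rightarrow> complex) \<Rightarrow> complex set \<Rightarrow> (nat \<Rightarrow> complex) \<Rightarrow> (nat \<Rightarrow> complex) \<Rightarrow> bool" where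
  "scalar_approximable S \<Gamma> f g \<longleftrightarrow> (\<forall>e>0. \<exists>\<gamma>\<in>\<Gamma>. \<exists>n. \<forall>i. cmod (g i - \<gamma> * (S ^^ n) f i) \<le> e)"

context sequence_copy
begin

lemma lift_bounded: assumes "null_sequence_operator S" shows "lift S \<in> bounded_operators c0_space"
proof -
  obtain K where K: "\<And>f i. f \<in> null_sequences \<Longrightarrow> cmod (S f i) \<le> K * sup_norm f"
    using assms unfolding null_sequence_operator_def by blast
  have "\<forall>u\<in>carrier c0_space. nrm c0_space (lift S u) \<le> K * nrm c0_space u"
    using K by (auto simp: lift_def intro!: sup_norm_le)
  then show ?thesis using assms by (auto simp: bounded_operators_def lift_def null_sequence_operator_def)
qed

lemma in_closure_scalar_orbit:
  assumes S: "null_sequence_operator S" and f: "f \<in> null_sequences" and g: "g \<in> null_sequences"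
    and "scalar_approximable S \<Gamma> f g"
  shows "j g \<in> nrm_topology c0_space closure_of scalar_orbit c0_space \<Gamma> (j f) (lift S)"
  unfolding c0.in_closure_iff
proof (intro conjI allI impI)
  fix e :: real assume e: "e > 0"
  then obtain \<gamma> n where n: "\<gamma> \<in> \<Gamma>" "\<And>i. cmod (g i - \<gamma> * (S ^^ n) f i) \<le> e / 2"
    using assms(4) unfolding scalar_approximable_def by (meson half_gt_zero)
  have s: "(\<lambda>i. \<gamma> * (S ^^ n) f i) \<in> null_sequences"
    by (intro null_sequences_mult null_sequence_operator_power S f)
  have "\<gamma> \<odot>\<^bsub>c0_space\<^esub> (lift S ^^ n) (j f) \<in> scalar_orbit c0_space \<Gamma> (j f) (lift S)"
    using n(1) unfolding scalar_orbit_def by blast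
  then have "j (\<lambda>i. \<gamma> * (S ^^ n) f i) \<in> scalar_orbit c0_space \<Gamma> (j f) (lift S)"
    by (simp add: lift_power)
  moreover have "nrm c0_space (j g \<ominus>\<^bsub>c0_space\<^esub> j (\<lambda>i. \<gamma> * (S ^^ n) f i)) < e"
    using sup_norm_le[of "\<lambda>i. g i - \<gamma> * (S ^^ n) f i" "e/2"] n(2) e by (simp add: c0_diff[OF g s])
  ultimately show "\<exists>s\<in>scalar_orbit c0_space \<Gamma> (j f) (lift S) \<inter> carrier c0_space.
      nrm c0_space (j g \<ominus>\<^bsub>c0_space\<^esub> s) < e" using s by auto
qed (use g in simp)

text \<open>A counterexample is reduced to coordinate estimates: the ball about \<open>g0\<close>
  makes the scalar orbit somewhere dense, while \<open>g1\<close> keeps a fixed distance from the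
  plain orbit.\<close>

lemma not_scalar_set:
  assumes S: "null_sequence_operator S" and f: "f \<in> null_sequences"
    and g0: "g0 \<in> null_sequences" "d > 0"
      "\<And>g. g \<in> null_sequences \<Longrightarrow> (\<And>i. cmod (g0 i - g i) < d) \<Longrightarrow> scalar_approximable S \<Gamma> f g"
    and g1: "g1 \<in> null_sequences" "e > 0" "\<And>n. \<exists>i. cmod (g1 i - (S ^^ n) f i) \<ge> e"
  shows "\<not> somewhere_hypercyclic_scalar_set TYPE('a) \<Gamma>"
proof
  assume "somewhere_hypercyclic_scalar_set TYPE('a) \<Gamma>"
  then have iff: "somewhere_dense c0_space (scalar_orbit c0_space \<Gamma> (j f) (lift S))
      \<longleftrightarrow> hypercyclic_vector c0_space (lift S) (j f)"
    using complex_banach_space_c0 infinite_dimensional_c0 lift_bounded[OF S] f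
    unfolding somewhere_hypercyclic_scalar_set_def by simp
  have "j g0 \<in> nrm_topology c0_space interior_of
      (nrm_topology c0_space closure_of scalar_orbit c0_space \<Gamma> (j f) (lift S))"
    unfolding c0.in_interior_iff
  proof (intro conjI exI[of _ d] ballI impI g0(2))
    fix u assume u: "u \<in> carrier c0_space" "nrm c0_space (j g0 \<ominus>\<^bsub>c0_space\<^esub> u) < d"
    then obtain g where g: "u = j g" "g \<in> null_sequences" by auto
    have "cmod (g0 i - g i) < d" for i
      using u(2) norm_le_sup_norm[OF null_sequences_diff[OF g0(1) g(2)], of i]
      unfolding g(1) c0_diff[OF g0(1) g(2)] by simp
    then show "u \<in> nrm_topology c0_space closure_of scalar_orbit c0_space \<Gamma> (j f) (lift S)"
      unfolding g(1) by (intro in_closure_scalar_orbit S f g g0(3))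
  qed (use g0 in simp)
  then have "hypercyclic_vector c0_space (lift S) (j f)"
    using iff unfolding somewhere_dense_def by blast
  then have "j g1 \<in> nrm_topology c0_space closure_of range (\<lambda>n. (lift S ^^ n) (j f))"
    using g1(1) by (simp add: hypercyclic_vector_def)
  then obtain n where n: "nrm c0_space (j g1 \<ominus>\<^bsub>c0_space\<^esub> (lift S ^^ n) (j f)) < e"
    unfolding c0.in_closure_iff using g1(2) by blast
  have s: "(S ^^ n) f \<in> null_sequences" by (rule null_sequence_operator_power[OF S f])
  obtain i where "cmod (g1 i - (S ^^ n) f i) \<ge> e" using g1(3) by blast
  then show False
    using n norm_le_sup_norm[OF null_sequences_diff[OF g1(1) s], of i]
    unfolding lift_power c0_diff[OF g1(1) s] by simp
qed

text \<open>Here the opposite implication fails: \<open>f\<close> is hypercyclic, but its scalar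
  orbit is the single point 0.\<close>

lemma not_scalar_set_zero:
  assumes S: "null_sequence_operator S" and f: "f \<in> null_sequences"
    and dense: "\<And>g. g \<in> null_sequences \<Longrightarrow> scalar_approximable S {1} f g"
  shows "\<not> somewhere_hypercyclic_scalar_set TYPE('a) {0}"
proof
  assume "somewhere_hypercyclic_scalar_set TYPE('a) {0}"
  then have iff: "somewhere_dense c0_space (scalar_orbit c0_space {0} (j f) (lift S))
      \<longleftrightarrow> hypercyclic_vector c0_space (lift S) (j f)"
    using complex_banach_space_c0 infinite_dimensional_c0 lift_bounded[OF S] f
    unfolding somewhere_hypercyclic_scalar_set_def by simp
  have orbit1: "scalar_orbit c0_space {1} (j f) (lift S) = range (\<lambda>n. (lift S ^^ n) (j f))"
    by (auto simp: scalar_orbit_def lift_power)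
  have "carrier c0_space \<subseteq> nrm_topology c0_space closure_of range (\<lambda>n. (lift S ^^ n) (j f))"
    using in_closure_scalar_orbit[OF S f _ dense] unfolding orbit1 by auto
  moreover have "nrm_topology c0_space closure_of range (\<lambda>n. (lift S ^^ n) (j f)) \<subseteq> carrier c0_space"
    unfolding c0.in_closure_iff subset_iff by blast
  ultimately have "hypercyclic_vector c0_space (lift S) (j f)"
    unfolding hypercyclic_vector_def using f by (intro conjI equalityI) simp_all
  then have "somewhere_dense c0_space (scalar_orbit c0_space {0} (j f) (lift S))" using iff by blast
  moreover have "scalar_orbit c0_space {0} (j f) (lift S) = {j (\<lambda>i. 0)}"
    by (auto simp: scalar_orbit_def)
  ultimately obtain y e where y: "y \<in> carrier c0_space" "e > 0"
    "\<And>z. z \<in> carrier c0_space \<Longrightarrow> nrm c0_space (y \<ominus>\<^bsub>c0_space\<^esub> z) < e \<Longrightarrow>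
       z \<in> nrm_topology c0_space closure_of {j (\<lambda>i. 0)}"
    unfolding somewhere_dense_def ex_in_conv[symmetric] c0.in_interior_iff by auto
  obtain g where g: "y = j g" "g \<in> null_sequences" using y(1) by auto
  have zero: "h 0 = 0" if h: "h \<in> null_sequences" "\<And>i. cmod (g i - h i) \<le> e / 2" for h
  proof -
    have "nrm c0_space (y \<ominus>\<^bsub>c0_space\<^esub> j h) < e"
      using sup_norm_le[of "\<lambda>i. g i - h i" "e/2"] h(2) y(2) unfolding g(1) c0_diff[OF g(2) h(1)] by simp
    then have cl: "j h \<in> nrm_topology c0_space closure_of {j (\<lambda>i. 0)}" using y(3) h(1) by simp
    have z: "(\<lambda>i. 0) \<in> null_sequences" by (rule null_sequences_finite_support) simp
    have "cmod (h 0) < d" if "d > 0" for d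
    proof -
      have "nrm c0_space (j h \<ominus>\<^bsub>c0_space\<^esub> j (\<lambda>i. 0)) < d"
        using cl that unfolding c0.in_closure_iff by auto
      then show ?thesis using norm_le_sup_norm[OF h(1), of 0] unfolding c0_diff[OF h(1) z] by simp
    qed
    from this[of "cmod (h 0)"] show ?thesis by auto
  qed
  \<comment> \<open>Two points of the supposed ball that differ in coordinate 0 cannot both vanish
    there.\<close>
  define h where "h i = g i + (if i = 0 then complex_of_real (e / 2) else 0)" for i
  have h: "h \<in> null_sequences"
    unfolding h_def by (intro null_sequences_add g null_sequences_finite_support[of 1]) simp
  have "h 0 = 0" using y(2) by (intro zero[OF h]) (simp add: h_def norm_divide)
  moreover have "g 0 = 0" using y(2) g(2) by (intro zero) auto
  ultimately show False using y(2) by (simp add: h_def)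
qed

end

section \<open>Counterexamples for shifts\<close>

text \<open>Block \<open>k\<close> of \<open>x\<close> is \<open>v k\<close> divided by
  \<open>w k\<close>, placed at position \<open>n k\<close>. Shifting and multiplying restores
  \<open>v k\<close>, and later blocks are negligible because their divisors outgrow
  \<open>w k\<close>. The predicate \<open>good\<close> ties the multiplier to the position; the
  last conclusion gives exact entries for later lower bounds.\<close>

lemma block_sequence:
  fixes v :: "nat \<Rightarrow> nat \<Rightarrow> complex" and L :: "nat \<Rightarrow> nat" and good :: "nat \<Rightarrow> nat \<Rightarrow> complex \<Rightarrow> bool"
  assumes step: "\<And>k B C. \<exists>n w. n \<ge> B \<and> cmod w \<ge> C \<and> good k n w"
    and support: "\<And>k i. i \<ge> L k \<Longrightarrow> v k i = 0"
  obtains n w x where "x \<in> null_sequences" "\<And>k. good k (n k) (w k)"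
    "\<And>k i. cmod (w k * x (n k + i) - v k i) \<le> inverse (real (Suc k))"
    "\<And>m. x m = 0 \<or> (\<exists>k i. m = n k + i \<and> x m = v k i / w k)"
proof -
  have "\<exists>M\<ge>1. \<forall>i. cmod (v k i) \<le> M" for k
  proof (intro exI[of _ "Max (insert 1 ((\<lambda>i. cmod (v k i)) ` {..<L k}))"] conjI allI)
    fix i
    show "cmod (v k i) \<le> Max (insert 1 ((\<lambda>i. cmod (v k i)) ` {..<L k}))"
    proof (cases "i < L k")
      case False
      then have "cmod (v k i) \<le> 1" using support[of k i] by simp
      then show ?thesis by (rule order_trans) (rule Max_ge, auto)
    qed (intro Max_ge, auto)
  qed (rule Max_ge, auto)
  then obtain M where M: "\<And>k. M k \<ge> 1" "\<And>k i. cmod (v k i) \<le> M k" by metis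
  \<comment> \<open>\<open>P\<close> bounds the entries of block \<open>k\<close> by 1 / (k + 1), so
    that \<open>x\<close> is null. \<open>Q\<close> separates consecutive blocks and keeps the next
    one small even after multiplication by the present multiplier.\<close>
  define P where "P k s = (cmod (snd s) \<ge> real (Suc k) * M k \<and> good k (fst s) (snd s))" for k and s :: "nat \<times> complex"
  define Q where "Q k s t = (fst t \<ge> fst s + L k \<and> cmod (snd t) \<ge> real (Suc (Suc k)) * M (Suc k) * cmod (snd s))"
    for k and s t :: "nat \<times> complex"
  have "\<exists>s. \<forall>k. P k (s k) \<and> Q k (s k) (s (Suc k))"
  proof (rule dependent_nat_choice)
    show "\<exists>s. P 0 s" using step[of 0 "real (Suc 0) * M 0" 0] unfolding P_def by auto
  next
    fix s :: "nat \<times> complex" and k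
    obtain n w where nw: "n \<ge> fst s + L k" "cmod w \<ge> real (Suc (Suc k)) * M (Suc k) * max 1 (cmod (snd s))" "good (Suc k) n w"
      using step by blast
    have "real (Suc (Suc k)) * M (Suc k) * c \<le> real (Suc (Suc k)) * M (Suc k) * max 1 (cmod (snd s))"
      if "c \<le> max 1 (cmod (snd s))" for c
      using that M(1)[of "Suc k"] by (intro mult_left_mono) auto
    from order_trans[OF this[of 1] nw(2)] order_trans[OF this[of "cmod (snd s)"] nw(2)]
    show "\<exists>t. P (Suc k) t \<and> Q k s t"
      unfolding P_def Q_def using nw(1,3) by (intro exI[of _ "(n, w)"]) auto
  qed
  then obtain s where s: "\<And>k. P k (s k)" "\<And>k. Q k (s k) (s (Suc k))" by blast
  define n where "n k = fst (s k)" for k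
  define w where "w k = snd (s k)" for k
  have good: "good k (n k) (w k)" and w_large: "cmod (w k) \<ge> real (Suc k) * M k" for k
    using s(1)[of k] by (auto simp: P_def n_def w_def)
  have n_step: "n (Suc k) \<ge> n k + L k" and w_step: "cmod (w (Suc k)) \<ge> real (Suc (Suc k)) * M (Suc k) * cmod (w k)" for k
    using s(2)[of k] by (auto simp: Q_def n_def w_def)
  have "mono n" using n_step by (intro incseq_SucI) (meson add_leD1)
  have n_less: "n k + L k \<le> n l" if "k < l" for k l
    using n_step[of k] monoD[OF \<open>mono n\<close>, of "Suc k" l] that by simp
  have w_mono: "mono (\<lambda>k. cmod (w k))"
  proof (rule incseq_SucI)
    fix k
    have "1 \<le> real (Suc (Suc k)) * M (Suc k)" using M(1)[of "Suc k"] mult_mono[of 1 "real (Suc (Suc k))" 1 "M (Suc k)"] by simp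
    then have "1 * cmod (w k) \<le> real (Suc (Suc k)) * M (Suc k) * cmod (w k)" by (intro mult_right_mono) auto
    then show "cmod (w k) \<le> cmod (w (Suc k))" using w_step[of k] by simp
  qed
  have w_less: "cmod (w l) \<ge> real (Suc l) * M l * cmod (w k)" if kl: "k < l" for k l
  proof -
    obtain l' where l': "l = Suc l'" "k \<le> l'" using kl by (cases l) auto
    have "real (Suc l) * M l * cmod (w k) \<le> real (Suc l) * M l * cmod (w l')"
      using monoD[OF w_mono l'(2)] M(1)[of l] by (intro mult_left_mono) auto
    then show ?thesis using w_step[of l'] unfolding l'(1)[symmetric] by (rule order_trans)
  qed
  have w0: "w k \<noteq> 0" for k
  proof -
    have "real (Suc k) * M k > 0" using M(1)[of k] by simp
    then have "cmod (w k) > 0" using w_large[of k] by linarith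
    then show ?thesis by simp
  qed
  have block_unique: "k = l" if k: "n k \<le> m" "m < n k + L k" and l: "n l \<le> m" "m < n l + L l" for k l m
    using n_less[of k l] n_less[of l k] k l by (metis linorder_neqE_nat not_less order_trans)
  define x where "x m = (if \<exists>k. n k \<le> m \<and> m < n k + L k
     then let k = (SOME k. n k \<le> m \<and> m < n k + L k) in v k (m - n k) / w k else 0)" for m
  have x_block: "x m = v k (m - n k) / w k" if "n k \<le> m" "m < n k + L k" for m k
  proof -
    have "(SOME k. n k \<le> m \<and> m < n k + L k) = k"
      using that block_unique by (intro some_equality) blast+
    then show ?thesis using that unfolding x_def by (auto simp: Let_def)
  qed
  have x_cases: "x m = 0 \<or> (\<exists>k. n k \<le> m \<and> m < n k + L k \<and> x m = v k (m - n k) / w k)" for m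
  proof (cases "\<exists>k. n k \<le> m \<and> m < n k + L k")
    case True
    then show ?thesis using x_block by blast
  next
    case False
    then have "x m = 0" unfolding x_def by (rule if_not_P)
    then show ?thesis ..
  qed
  have small: "cmod (v k i / w k) \<le> inverse (real (Suc k))" for k i
  proof -
    have "cmod (v k i) * real (Suc k) \<le> M k * real (Suc k)" using M(2) by (intro mult_right_mono) auto
    also have "\<dots> \<le> cmod (w k)" using w_large[of k] by (simp add: mult.commute)
    finally show ?thesis using w0[of k] by (simp add: norm_divide field_simps)
  qed
  show thesis
  proof (rule that[of x n w])
    show "x \<in> null_sequences"
      unfolding null_sequences_def LIMSEQ_iff
    proof (intro CollectI allI impI)
      fix e :: real assume "e > 0"
      then obtain J where J: "inverse (real (Suc J)) < e" using reals_Archimedean by blast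
      have "cmod (x m - 0) < e" if m: "m \<ge> n J + L J" for m
        using x_cases[of m]
      proof
        assume "\<exists>k. n k \<le> m \<and> m < n k + L k \<and> x m = v k (m - n k) / w k"
        then obtain k where k: "n k \<le> m" "m < n k + L k" "x m = v k (m - n k) / w k" by blast
        have "k \<ge> J"
        proof (rule ccontr)
          assume "\<not> k \<ge> J"
          then show False using n_less[of k J] k m by simp
        qed
        then have "inverse (real (Suc k)) \<le> inverse (real (Suc J))" by (intro le_imp_inverse_le) auto
        then show ?thesis using small[of k "m - n k"] J unfolding k(3) diff_zero by linarith
      qed (use \<open>e > 0\<close> in simp)
      then show "\<exists>no. \<forall>m\<ge>no. cmod (x m - 0) < e" by blast
    qed
    show "good k (n k) (w k)" for k by (rule good)
    show "cmod (w k * x (n k + i) - v k i) \<le> inverse (real (Suc k))" for k i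
    proof (cases "i < L k")
      case True
      then show ?thesis using x_block[of k "n k + i"] w0[of k] by simp
    next
      case False
      then have v: "v k i = 0" using support by simp
      show ?thesis using x_cases[of "n k + i"]
      proof
        assume "\<exists>l. n l \<le> n k + i \<and> n k + i < n l + L l \<and> x (n k + i) = v l (n k + i - n l) / w l"
        then obtain l where l: "n l \<le> n k + i" "n k + i < n l + L l"
          "x (n k + i) = v l (n k + i - n l) / w l" by blast
        \<comment> \<open>Beyond the end of block \<open>k\<close> only later blocks can occur, and
          to these the growth of the multipliers applies.\<close>
        have "k < l"
        proof (rule ccontr)
          assume "\<not> k < l"
          then consider "l = k" | "l < k" by linarith
          then show False
          proof cases
            case 1
            then show False using l(2) False by simp
          next
            case 2
            then show False using n_less[of l k] l(2) by simp
          qed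
        qed
        have "cmod (v l (n k + i - n l)) * (real (Suc l) * cmod (w k)) \<le> M l * (real (Suc l) * cmod (w k))"
          using M(2) by (intro mult_right_mono) auto
        also have "\<dots> \<le> cmod (w l)" using w_less[OF \<open>k < l\<close>] by (simp add: mult_ac)
        finally have "cmod (w k) * cmod (x (n k + i)) \<le> inverse (real (Suc l))"
          using w0[of l] unfolding l(3) by (simp add: norm_divide field_simps)
        also have "\<dots> \<le> inverse (real (Suc k))" using \<open>k < l\<close> by (intro le_imp_inverse_le) auto
        finally show ?thesis by (simp add: v norm_mult)
      qed (simp add: v)
    qed
    show "x m = 0 \<or> (\<exists>k i. m = n k + i \<and> x m = v k i / w k)" for m
      using x_cases[of m] by (metis le_add_diff_inverse)
  qed
qed

text \<open>The first component of a code only serves to make every target occur infinitely often.\<close>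

definition target_code :: "nat \<Rightarrow> nat \<times> rat \<times> (rat \<times> rat) list" where
  "target_code = from_nat"

definition target_angle :: "nat \<Rightarrow> real" where
  "target_angle k = of_rat (fst (snd (target_code k)))"

definition target_length :: "nat \<Rightarrow> nat" where
  "target_length k = length (snd (snd (target_code k)))"

definition target :: "nat \<Rightarrow> nat \<Rightarrow> complex" where
  "target k i = (let l = snd (snd (target_code k)) in
     if i < length l then Complex (of_rat (fst (l ! i))) (of_rat (snd (l ! i))) else 0)"

lemma target_support: "i \<ge> target_length k \<Longrightarrow> target k i = 0"
  by (simp add: target_def target_length_def)

text \<open>Rationals approximate the angle and the first \<open>L\<close> coordinates; beyond
  \<open>L\<close> both \<open>g\<close> and the default value 0 of the target are small.\<close>

lemma targets_dense:
  assumes g: "g \<in> null_sequences" and e: "e > 0"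
  obtains k where "k \<ge> K" "cmod (cis \<theta> - cis (target_angle k)) < e" "\<And>i. cmod (g i - target k i) < e"
proof -
  have "(cis \<longlongrightarrow> cis \<theta>) (at \<theta>)" by (intro tendsto_intros)
  then have "\<forall>\<^sub>F x in at \<theta>. dist (cis x) (cis \<theta>) < e" using e by (rule tendstoD)
  then obtain d where d: "d > 0" "\<And>x. x \<noteq> \<theta> \<Longrightarrow> dist x \<theta> < d \<Longrightarrow> dist (cis x) (cis \<theta>) < e"
    unfolding eventually_at by blast
  obtain q where q: "\<theta> < real_of_rat q" "real_of_rat q < \<theta> + d" using of_rat_dense[of \<theta> "\<theta> + d"] d by auto
  then have q': "cmod (cis \<theta> - cis (of_rat q)) < e"
    using d(2)[of "of_rat q"] by (simp add: dist_real_def dist_norm norm_minus_commute)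
  obtain L where L: "\<And>i. i \<ge> L \<Longrightarrow> cmod (g i) < e"
    using LIMSEQ_D[of g 0 e] g e by (auto simp: null_sequences_def)
  have "\<exists>r s. cmod (g i - Complex (of_rat r) (of_rat s)) < e" for i
  proof -
    obtain r where r: "Re (g i) < real_of_rat r" "real_of_rat r < Re (g i) + e / 2"
      using of_rat_dense[of "Re (g i)" "Re (g i) + e / 2"] e by auto
    obtain s where s: "Im (g i) < real_of_rat s" "real_of_rat s < Im (g i) + e / 2"
      using of_rat_dense[of "Im (g i)" "Im (g i) + e / 2"] e by auto
    have "cmod (g i - Complex (of_rat r) (of_rat s)) < e"
      using cmod_le[of "g i - Complex (of_rat r) (of_rat s)"] r s by simp
    then show ?thesis by blast
  qed
  then obtain r s where rs: "\<And>i. cmod (g i - Complex (of_rat (r i)) (of_rat (s i))) < e" by metis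
  define l where "l = map (\<lambda>i. (r i, s i)) [0..<L]"
  have "inj (\<lambda>m :: nat. to_nat (m, q, l))" by (auto simp: inj_def)
  then have "infinite (range (\<lambda>m :: nat. to_nat (m, q, l)))" by (rule range_inj_infinite)
  then obtain k where "k \<ge> K" "k \<in> range (\<lambda>m :: nat. to_nat (m, q, l))"
    unfolding infinite_nat_iff_unbounded_le by blast
  then obtain m where code: "k \<ge> K" "target_code k = (m, q, l)" by (auto simp: target_code_def)
  show thesis
  proof (rule that[OF code(1)])
    show "cmod (cis \<theta> - cis (target_angle k)) < e" using q' by (simp add: target_angle_def code(2))
    show "cmod (g i - target k i) < e" for i
      using rs[of i] L[of i] by (auto simp: target_def code(2) l_def Let_def)
  qed
qed

lemma inverse_Suc_small: assumes "(e::real) > 0" obtains K where "\<And>k. k \<ge> K \<Longrightarrow> inverse (real (Suc k)) < e"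
proof -
  obtain K where K: "inverse (real (Suc K)) < e" using reals_Archimedean[OF assms] by blast
  have "inverse (real (Suc k)) < e" if "k \<ge> K" for k
  proof -
    have "inverse (real (Suc k)) \<le> inverse (real (Suc K))" using that by (intro le_imp_inverse_le) auto
    then show ?thesis using K by (rule le_less_trans)
  qed
  then show thesis using that by blast
qed

section \<open>Shifts, rotations and universal vectors\<close>

definition weighted_shift :: "complex \<Rightarrow> (nat \<Rightarrow> complex) \<Rightarrow> nat \<Rightarrow> complex" where
  "weighted_shift a f i = a * f (Suc i)"

text \<open>The direct sum is modelled in one sequence space: coordinate 0 is the plane, the
  coordinates from 1 on carry the doubled backward shift.\<close>

definition rotation_plus_shift :: "complex \<Rightarrow> (nat \<Rightarrow> complex) \<Rightarrow> nat \<Rightarrow> complex" where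
  "rotation_plus_shift u f i = (if i = 0 then u * f 0 else 2 * f (Suc i))"

lemma weighted_shift_power: "(weighted_shift a ^^ n) f i = a ^ n * f (n + i)"
  by (induction n arbitrary: i) (simp_all add: weighted_shift_def)

lemma rotation_plus_shift_power:
  "(rotation_plus_shift u ^^ n) f i = (if i = 0 then u ^ n * f 0 else 2 ^ n * f (n + i))"
  by (induction n arbitrary: i) (simp_all add: rotation_plus_shift_def)

lemma weighted_shift_operator: "null_sequence_operator (weighted_shift a)"
  unfolding null_sequence_operator_def
proof (intro conjI ballI allI exI)
  fix f :: "nat \<Rightarrow> complex" assume f: "f \<in> null_sequences"
  have "(\<lambda>i. a * f (i + 1)) \<in> null_sequences" by (intro null_sequences_mult null_sequences_shift f)
  then show "weighted_shift a f \<in> null_sequences" by (simp add: weighted_shift_def[abs_def])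
  show "cmod (weighted_shift a f i) \<le> cmod a * sup_norm f" for i
    using norm_le_sup_norm[OF f] by (simp add: weighted_shift_def norm_mult mult_left_mono)
qed (auto simp: weighted_shift_def algebra_simps)

lemma rotation_plus_shift_operator: "null_sequence_operator (rotation_plus_shift u)"
  unfolding null_sequence_operator_def
proof (intro conjI ballI allI exI)
  fix f :: "nat \<Rightarrow> complex" assume f: "f \<in> null_sequences"
  \<comment> \<open>The operator is twice the shift up to a correction supported at coordinate
    0.\<close>
  have "(\<lambda>i. 2 * f (i + 1) + (if i = 0 then u * f 0 - 2 * f 1 else 0)) \<in> null_sequences"
    by (intro null_sequences_add null_sequences_mult null_sequences_shift f
        null_sequences_finite_support[of 1]) simp
  moreover have "rotation_plus_shift u f = (\<lambda>i. 2 * f (i + 1) + (if i = 0 then u * f 0 - 2 * f 1 else 0))"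
    by (auto simp: rotation_plus_shift_def)
  ultimately show "rotation_plus_shift u f \<in> null_sequences" by simp
  show "cmod (rotation_plus_shift u f i) \<le> (cmod u + 2) * sup_norm f" for i
  proof -
    have s: "sup_norm f \<ge> 0" using norm_le_sup_norm[OF f, of 0] norm_ge_zero order_trans by blast
    have u: "cmod u * cmod (f 0) \<le> cmod u * sup_norm f" using norm_le_sup_norm[OF f] by (intro mult_left_mono) auto
    have u0: "0 \<le> cmod u * sup_norm f" using s by simp
    show ?thesis
    proof (cases i)
      case 0
      then have "cmod (rotation_plus_shift u f i) = cmod u * cmod (f 0)"
        by (simp add: rotation_plus_shift_def norm_mult)
      then show ?thesis using u s unfolding distrib_right by linarith
    next
      case (Suc k)
      then have "cmod (rotation_plus_shift u f i) = 2 * cmod (f (Suc i))"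
        by (simp add: rotation_plus_shift_def norm_mult)
      then show ?thesis using u0 norm_le_sup_norm[OF f, of "Suc i"] unfolding distrib_right by linarith
    qed
  qed
qed (auto simp: rotation_plus_shift_def algebra_simps)

text \<open>Kronecker's theorem gives an exponent without a lower bound. Turning the target back by
  \<open>B\<close> steps and adding \<open>B\<close> to the exponent makes it large.\<close>

lemma irrational_rotation_dense:
  assumes "\<alpha> \<notin> \<rat>" and e: "e > 0"
  obtains n where "n \<ge> B" "cmod (cis (2 * pi * \<alpha>) ^ n - cis \<theta>) < e"
proof -
  define \<theta>' where "\<theta>' = \<theta> - real B * (2 * pi * \<alpha>)"
  define \<beta> where "\<beta> = frac (\<theta>' / (2 * pi))"
  have cis_frac: "cis (2 * pi * frac t) = cis (2 * pi * t)" for t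
  proof -
    have "cis (2 * pi * t) = cis (2 * pi * frac t) * cis (2 * pi * of_int \<lfloor>t\<rfloor>)"
      by (simp add: cis_mult frac_def algebra_simps)
    then show ?thesis by (simp add: cis_multiple_2pi)
  qed
  have "((\<lambda>t. cis (2 * pi * t)) \<longlongrightarrow> cis (2 * pi * \<beta>)) (at \<beta>)" by (intro tendsto_intros)
  then have "\<forall>\<^sub>F t in at \<beta>. dist (cis (2 * pi * t)) (cis (2 * pi * \<beta>)) < e" using e by (rule tendstoD)
  then obtain d where d: "d > 0" "\<And>t. t \<noteq> \<beta> \<Longrightarrow> dist t \<beta> < d \<Longrightarrow> dist (cis (2 * pi * t)) (cis (2 * pi * \<beta>)) < e"
    unfolding eventually_at by blast
  have "0 \<le> \<beta>" "\<beta> \<le> 1" unfolding \<beta>_def by (simp_all add: frac_lt_1 less_imp_le)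
  then obtain k where k: "\<bar>frac (real k * \<alpha>) - \<beta>\<bar> < d"
    using Kronecker_approx_1_explicit[OF assms(1) _ _ d(1)] by metis
  have "dist (cis (2 * pi * frac (real k * \<alpha>))) (cis (2 * pi * \<beta>)) < e"
    using d(2)[of "frac (real k * \<alpha>)"] k e by (cases "frac (real k * \<alpha>) = \<beta>") (auto simp: dist_real_def)
  moreover have "cis (2 * pi * frac (real k * \<alpha>)) = cis (2 * pi * \<alpha>) ^ k"
    unfolding cis_frac by (simp add: Complex.DeMoivre mult_ac)
  moreover have "cis (2 * pi * \<beta>) = cis \<theta>'" unfolding \<beta>_def cis_frac by simp
  ultimately have 1: "cmod (cis (2 * pi * \<alpha>) ^ k - cis \<theta>') < e" by (simp add: dist_norm)
  have "cis \<theta> = cis (2 * pi * \<alpha>) ^ B * cis \<theta>'" by (simp add: Complex.DeMoivre cis_mult \<theta>'_def)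
  then have "cis (2 * pi * \<alpha>) ^ (B + k) - cis \<theta> = cis (2 * pi * \<alpha>) ^ B * (cis (2 * pi * \<alpha>) ^ k - cis \<theta>')"
    by (simp add: power_add right_diff_distrib)
  then have "cmod (cis (2 * pi * \<alpha>) ^ (B + k) - cis \<theta>) < e" using 1 by (simp add: norm_mult norm_power)
  then show thesis using that[of "B + k"] by simp
qed

lemma two_power_large: "\<exists>n\<ge>B. 2 ^ n \<ge> (C::real)"
proof -
  obtain m where "C < 2 ^ m" using real_arch_pow[of 2 C] by auto
  also have "(2::real) ^ m \<le> 2 ^ max B m" by (rule power_increasing) auto
  finally show ?thesis by (intro exI[of _ "max B m"]) auto
qed

text \<open>The multiplier of each block is \<open>2 ^ n\<close>, and the density of the rotation
  orbit leaves enough freedom in the position \<open>n\<close> to hit a target angle too. Thus one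
  exponent serves rotation and shift.\<close>

lemma universal_shift_rotation_orbit:
  assumes "\<alpha> \<notin> \<rat>"
  obtains y where "y \<in> null_sequences"
    "\<And>g \<theta> e. g \<in> null_sequences \<Longrightarrow> e > 0 \<Longrightarrow>
       \<exists>n. cmod (cis (2 * pi * \<alpha>) ^ n - cis \<theta>) < e \<and> (\<forall>i. cmod (g i - 2 ^ n * y (n + i)) < e)"
proof -
  define good where "good k n w \<longleftrightarrow> w = 2 ^ n \<and>
      cmod (cis (2 * pi * \<alpha>) ^ n - cis (target_angle k)) < inverse (real (Suc k))" for k n and w :: complex
  have "\<exists>n w. n \<ge> B \<and> cmod w \<ge> C \<and> good k n w" for k B C
  proof -
    obtain N where N: "2 ^ N \<ge> C" using two_power_large by blast
    obtain n where n: "n \<ge> max B N" "cmod (cis (2 * pi * \<alpha>) ^ n - cis (target_angle k)) < inverse (real (Suc k))"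
      using irrational_rotation_dense[OF assms, of "inverse (real (Suc k))" "max B N"] by auto
    have "(2::real) ^ N \<le> 2 ^ n" using n(1) by (intro power_increasing) auto
    then have "C \<le> 2 ^ n" using N by linarith
    then show ?thesis using n by (intro exI[of _ n] exI[of _ "2 ^ n"]) (auto simp: good_def norm_power)
  qed
  then obtain n w x where x: "x \<in> null_sequences" "\<And>k. good k (n k) (w k)"
    "\<And>k i. cmod (w k * x (n k + i) - target k i) \<le> inverse (real (Suc k))"
    using block_sequence[of good target_length target] target_support by metis
  have "\<exists>n. cmod (cis (2 * pi * \<alpha>) ^ n - cis \<theta>) < e \<and> (\<forall>i. cmod (g i - 2 ^ n * x (n + i)) < e)"
    if g: "g \<in> null_sequences" and e: "e > 0" for g \<theta> e
  proof -
    obtain K where K: "\<And>k. k \<ge> K \<Longrightarrow> inverse (real (Suc k)) < e / 2" using inverse_Suc_small[of "e / 2"] e by auto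
    obtain k where k: "k \<ge> K" "cmod (cis \<theta> - cis (target_angle k)) < e / 2" "\<And>i. cmod (g i - target k i) < e / 2"
      using targets_dense[OF g, of "e / 2"] e by auto
    have "cmod (cis (2 * pi * \<alpha>) ^ n k - cis \<theta>) < e"
      using x(2)[of k] K[OF k(1)] k(2)
        norm_triangle_ineq4[of "cis (2 * pi * \<alpha>) ^ n k - cis (target_angle k)" "cis \<theta> - cis (target_angle k)"]
      by (simp add: good_def)
    moreover have "cmod (g i - 2 ^ n k * x (n k + i)) < e" for i
      using x(2)[of k] x(3)[of k i] K[OF k(1)] k(3)[of i]
        norm_triangle_ineq4[of "g i - target k i" "w k * x (n k + i) - target k i"]
      by (simp add: good_def)
    ultimately show ?thesis by blast
  qed
  then show thesis using that x(1) by blast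
qed

lemma irrational_exists: obtains \<alpha> :: real where "\<alpha> \<notin> \<rat>"
  using countable_rat uncountable_UNIV_real by (metis UNIV_eq_I)

section \<open>Scalar sets for which the equivalence fails\<close>

context sequence_copy
begin

text \<open>Large scalars from \<open>\<Gamma>\<close> serve as divisors of the blocks, so scaling
  by them recovers every target.\<close>

lemma not_scalar_set_unbounded:
  assumes unbounded: "\<And>C. \<exists>\<gamma>\<in>\<Gamma>. cmod \<gamma> \<ge> C"
  shows "\<not> somewhere_hypercyclic_scalar_set TYPE('a) \<Gamma>"
proof -
  have "\<exists>n w. n \<ge> B \<and> cmod w \<ge> C \<and> w \<in> \<Gamma>" for B :: nat and C using unbounded[of C] by blast
  then obtain n :: "nat \<Rightarrow> nat" and w x where x: "x \<in> null_sequences" "\<And>k. w k \<in> \<Gamma>"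
    "\<And>k i. cmod (w k * x (n k + i) - target k i) \<le> inverse (real (Suc k))"
    using block_sequence[of "\<lambda>k n w. w \<in> \<Gamma>" target_length target] target_support by metis
  have approx: "scalar_approximable (weighted_shift 1) \<Gamma> x g" if g: "g \<in> null_sequences" for g
    unfolding scalar_approximable_def
  proof (intro allI impI)
    fix e :: real assume e: "e > 0"
    obtain K where K: "\<And>k. k \<ge> K \<Longrightarrow> inverse (real (Suc k)) < e / 2" using inverse_Suc_small[of "e / 2"] e by auto
    have "e / 2 > 0" using e by simp
    then obtain k where k: "k \<ge> K" "\<And>i. cmod (g i - target k i) < e / 2"
      using targets_dense[OF g, where e = "e / 2" and K = K and \<theta> = 0] by blast
    have "cmod (g i - w k * x (n k + i)) \<le> e" for i
      using x(3)[of k i] K[OF k(1)] k(2)[of i]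
        norm_triangle_ineq4[of "g i - target k i" "w k * x (n k + i) - target k i"] by simp
    then show "\<exists>\<gamma>\<in>\<Gamma>. \<exists>n. \<forall>i. cmod (g i - \<gamma> * (weighted_shift 1 ^^ n) x i) \<le> e"
      using x(2)[of k] by (intro bexI[of _ "w k"] exI[of _ "n k"]) (auto simp: weighted_shift_power)
  qed
  \<comment> \<open>Its first coordinate exceeds by 1 every entry that iterates of \<open>x\<close>
    under the contraction can have.\<close>
  define g1 where "g1 i = (if i = 0 then complex_of_real (sup_norm x + 1) else 0)" for i :: nat
  show ?thesis
  proof (rule not_scalar_set[OF weighted_shift_operator x(1) x(1) zero_less_one approx])
    show "g1 \<in> null_sequences" by (rule null_sequences_finite_support[of 1]) (simp add: g1_def)
    show "\<exists>i. cmod (g1 i - (weighted_shift 1 ^^ n) x i) \<ge> 1" for n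
    proof (rule exI[of _ 0])
      have "sup_norm x + 1 \<le> cmod (g1 0)" by (simp add: g1_def)
      then show "cmod (g1 0 - (weighted_shift 1 ^^ n) x 0) \<ge> 1"
        using norm_le_sup_norm[OF x(1), of n] norm_triangle_ineq2[of "g1 0" "x n"]
        by (simp add: weighted_shift_power)
    qed
  qed simp_all
qed

lemma not_scalar_set_near_0:
  assumes near: "\<And>\<delta>. \<delta> > 0 \<Longrightarrow> \<exists>\<gamma>\<in>\<Gamma>. \<gamma> \<noteq> 0 \<and> cmod \<gamma> \<le> \<delta>"
  shows "\<not> somewhere_hypercyclic_scalar_set TYPE('a) \<Gamma>"
proof -
  \<comment> \<open>The multiplier combines a scalar with a power of 2. A small scalar makes its
    product with the bounded perturbation negligible; the last clause forces non-zero quotients of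
    target entries by the scalar to have modulus at least 2.\<close>
  define good where "good k n w \<longleftrightarrow> (\<exists>\<gamma>\<in>\<Gamma>. w = \<gamma> * 2 ^ n \<and> \<gamma> \<noteq> 0 \<and> cmod \<gamma> \<le> inverse (real (Suc k))
      \<and> (\<forall>i. target k i \<noteq> 0 \<longrightarrow> 2 * cmod \<gamma> \<le> cmod (target k i)))" for k n and w :: complex
  have "\<exists>n w. n \<ge> B \<and> cmod w \<ge> C \<and> good k n w" for k B C
  proof -
    define D where "D = insert (inverse (real (Suc k))) ((\<lambda>i. cmod (target k i) / 2) ` {i. i < target_length k \<and> target k i \<noteq> 0})"
    have D: "finite D" by (simp add: D_def)
    have "Min D > 0" using D by (subst Min_gr_iff) (auto simp: D_def)
    then obtain \<gamma> where \<gamma>: "\<gamma> \<in> \<Gamma>" "\<gamma> \<noteq> 0" "cmod \<gamma> \<le> Min D" using near by blast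
    have "cmod \<gamma> \<le> inverse (real (Suc k))" using \<gamma>(3) Min_le[OF D, of "inverse (real (Suc k))"] by (simp add: D_def)
    moreover have "2 * cmod \<gamma> \<le> cmod (target k i)" if "target k i \<noteq> 0" for i
    proof -
      have "i < target_length k" using that target_support[of k i] by (meson not_less)
      then have "cmod (target k i) / 2 \<in> D" using that by (auto simp: D_def)
      then show ?thesis using \<gamma>(3) Min_le[OF D] by fastforce
    qed
    moreover obtain n where n: "n \<ge> B" "2 ^ n \<ge> C / cmod \<gamma>" using two_power_large by blast
    then have "C \<le> cmod (\<gamma> * 2 ^ n)" using \<gamma>(2) by (simp add: norm_mult norm_power field_simps)
    ultimately show ?thesis using \<gamma> n(1) unfolding good_def by blast
  qed
  then obtain n w x where x: "x \<in> null_sequences" "\<And>k. good k (n k) (w k)"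
    "\<And>k i. cmod (w k * x (n k + i) - target k i) \<le> inverse (real (Suc k))"
    "\<And>m. x m = 0 \<or> (\<exists>k i. m = n k + i \<and> x m = target k i / w k)"
    using block_sequence[of good target_length target] target_support by metis
  \<comment> \<open>The summand \<open>(1/2) ^ m\<close> keeps the first coordinate of every iterate away from 0.\<close>
  define y where "y m = x m + (1 / 2) ^ m" for m
  have "(\<lambda>m. (1 / 2) ^ m) \<in> null_sequences"
    unfolding null_sequences_def by (intro CollectI LIMSEQ_power_zero) (simp add: norm_divide)
  then have y: "y \<in> null_sequences" unfolding y_def by (intro null_sequences_add x)
  have y_shift: "2 ^ m * y (m + i) = 2 ^ m * x (m + i) + (1 / 2) ^ i" for m i
    by (simp add: y_def distrib_left power_add power_divide)
  have approx: "scalar_approximable (weighted_shift 2) \<Gamma> y g" if g: "g \<in> null_sequences" for g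
    unfolding scalar_approximable_def
  proof (intro allI impI)
    fix e :: real assume e: "e > 0"
    obtain K where K: "\<And>k. k \<ge> K \<Longrightarrow> inverse (real (Suc k)) < e / 3" using inverse_Suc_small[of "e / 3"] e by auto
    have "e / 3 > 0" using e by simp
    then obtain k where k: "k \<ge> K" "\<And>i. cmod (g i - target k i) < e / 3"
      using targets_dense[OF g, where e = "e / 3" and K = K and \<theta> = 0] by blast
    obtain \<gamma> where \<gamma>: "\<gamma> \<in> \<Gamma>" "w k = \<gamma> * 2 ^ n k" "cmod \<gamma> \<le> inverse (real (Suc k))"
      using x(2)[of k] by (auto simp: good_def)
    have "cmod (g i - \<gamma> * (2 ^ n k * y (n k + i))) \<le> e" for i
    proof -
      have eq: "g i - \<gamma> * (2 ^ n k * y (n k + i))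
          = (g i - target k i) - (w k * x (n k + i) - target k i) - \<gamma> * (1 / 2) ^ i"
        unfolding y_shift \<gamma>(2) by (simp add: algebra_simps)
      have "cmod (\<gamma> * (1 / 2) ^ i) \<le> cmod \<gamma> * 1"
        unfolding norm_mult by (intro mult_left_mono) (auto simp: norm_power norm_divide power_le_one)
      then have "cmod (\<gamma> * (1 / 2) ^ i) < e / 3" using \<gamma>(3) K[OF k(1)] by linarith
      moreover have "cmod (w k * x (n k + i) - target k i) < e / 3" using x(3)[of k i] K[OF k(1)] by linarith
      ultimately show ?thesis unfolding eq using k(2)[of i]
          norm_triangle_ineq4[of "(g i - target k i) - (w k * x (n k + i) - target k i)" "\<gamma> * (1 / 2) ^ i"]
          norm_triangle_ineq4[of "g i - target k i" "w k * x (n k + i) - target k i"] by linarith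
    qed
    then show "\<exists>\<gamma>\<in>\<Gamma>. \<exists>n. \<forall>i. cmod (g i - \<gamma> * (weighted_shift 2 ^^ n) y i) \<le> e"
      using \<gamma>(1) by (intro bexI[of _ \<gamma>] exI[of _ "n k"]) (auto simp: weighted_shift_power)
  qed
  show ?thesis
  proof (rule not_scalar_set[OF weighted_shift_operator y y zero_less_one approx])
    show "(\<lambda>i. 0) \<in> null_sequences" by (rule null_sequences_finite_support[of 0]) simp
    show "\<exists>i. cmod (0 - (weighted_shift 2 ^^ m) y i) \<ge> 1" for m
    proof (rule exI[of _ 0])
      have "cmod (2 ^ m * x m + 1) \<ge> 1"
        using x(4)[of m]
      proof
        assume "\<exists>k i. m = n k + i \<and> x m = target k i / w k"
        then obtain k i where ki: "m = n k + i" "x m = target k i / w k" by blast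
        obtain \<gamma> where \<gamma>: "w k = \<gamma> * 2 ^ n k" "\<gamma> \<noteq> 0" "target k i \<noteq> 0 \<Longrightarrow> 2 * cmod \<gamma> \<le> cmod (target k i)"
          using x(2)[of k] by (auto simp: good_def)
        show ?thesis
        proof (cases "target k i = 0")
          case False
          \<comment> \<open>Inside a block the first coordinate is 1 plus a number that is 0 or has
            modulus at least 2; outside the blocks it is 1.\<close>
          have "2 ^ m * x m = 2 ^ i * (target k i / \<gamma>)"
            unfolding ki(2) \<gamma>(1) using \<gamma>(2) by (simp add: ki(1) power_add)
          moreover have "cmod (target k i / \<gamma>) \<ge> 2" using \<gamma>(2,3) False by (simp add: norm_divide field_simps)
          moreover have "(2::real) ^ i \<ge> 1" by simp
          ultimately have "cmod (2 ^ m * x m) \<ge> 1 * 2"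
            using mult_mono[of 1 "2 ^ i" 2 "cmod (target k i / \<gamma>)"]
            by (simp only: norm_mult norm_power norm_numeral)
          then show ?thesis using norm_triangle_ineq2[of "2 ^ m * x m" "-1"] by simp
        qed (simp add: ki(2))
      qed simp
      then show "cmod (0 - (weighted_shift 2 ^^ m) y 0) \<ge> 1"
        using y_shift[of m 0] by (simp only: weighted_shift_power diff_0 norm_minus_cancel add_0_right power_0)
    qed
  qed simp_all
qed

text \<open>A point of the saturation near \<open>g 0\<close> is a product of some
  \<open>\<gamma>\<close> and a unit t. One exponent brings the rotation near t and the shift near
  the remaining coordinates divided by \<open>\<gamma>\<close>. The plain orbit avoids 0, as its
  coordinate 0 stays on the unit circle.\<close>

lemma not_scalar_set_interior:
  assumes int: "interior (closure (circle_saturation \<Gamma>) - {0}) \<noteq> {}"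
  shows "\<not> somewhere_hypercyclic_scalar_set TYPE('a) \<Gamma>"
proof -
  obtain \<alpha> :: real where \<alpha>: "\<alpha> \<notin> \<rat>" using irrational_exists .
  define u where "u = cis (2 * pi * \<alpha>)"
  obtain y where y: "y \<in> null_sequences"
    "\<And>g \<theta> e. g \<in> null_sequences \<Longrightarrow> e > 0 \<Longrightarrow>
       \<exists>n. cmod (u ^ n - cis \<theta>) < e \<and> (\<forall>i. cmod (g i - 2 ^ n * y (n + i)) < e)"
    using universal_shift_rotation_orbit[OF \<alpha>] unfolding u_def by metis
  define x where "x i = (case i of 0 \<Rightarrow> 1 | Suc i \<Rightarrow> y i)" for i
  have x: "x \<in> null_sequences"
  proof -
    have "(\<lambda>i. x (i + 1)) \<longlonglongrightarrow> 0" using y(1) by (simp add: x_def null_sequences_def)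
    then show ?thesis unfolding null_sequences_def by (intro CollectI LIMSEQ_offset[of x 1])
  qed
  obtain w0 d where d: "d > 0" "ball w0 d \<subseteq> closure (circle_saturation \<Gamma>) - {0}"
    using int by (metis ex_in_conv mem_interior)
  define g0 where "g0 i = (if i = 0 then w0 else 0)" for i :: nat
  have approx: "scalar_approximable (rotation_plus_shift u) \<Gamma> x g"
    if g: "g \<in> null_sequences" "\<And>i. cmod (g0 i - g i) < d" for g
    unfolding scalar_approximable_def
  proof (intro allI impI)
    fix e :: real assume e: "e > 0"
    have "g 0 \<in> ball w0 d" using g(2)[of 0] by (simp add: g0_def dist_norm)
    then have "g 0 \<in> closure (circle_saturation \<Gamma>) - {0}" using d(2) by blast
    then have g00: "g 0 \<in> closure (circle_saturation \<Gamma>)" "g 0 \<noteq> 0" by auto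
    \<comment> \<open>The bound by \<open>cmod (g 0)\<close> keeps \<open>z\<close> and hence
      \<open>\<gamma>\<close> non-zero, so that division by \<open>\<gamma>\<close> is
      possible.\<close>
    then have "min (e / 2) (cmod (g 0)) > 0" using e by simp
    then obtain z where z: "z \<in> circle_saturation \<Gamma>" "dist z (g 0) < min (e / 2) (cmod (g 0))"
      using g00(1) unfolding closure_approachable by blast
    then obtain \<gamma> t where \<gamma>: "\<gamma> \<in> \<Gamma>" "cmod t = 1" "z = \<gamma> * t" by (auto simp: circle_saturation_def)
    have "z \<noteq> 0" using z(2) by auto
    then have \<gamma>0: "\<gamma> \<noteq> 0" using \<gamma>(3) by auto
    have "t \<noteq> 0" using \<gamma>(2) by auto
    then have t: "cis (Arg t) = t" using \<gamma>(2) by (simp add: cis_Arg sgn_div_norm)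
    have "(\<lambda>i. inverse \<gamma> * g (i + 1)) \<in> null_sequences"
      by (intro null_sequences_mult null_sequences_shift g)
    moreover have "e / (2 * cmod \<gamma>) > 0" using e \<gamma>0 by simp
    ultimately obtain n where n: "cmod (u ^ n - t) < e / (2 * cmod \<gamma>)"
      "\<And>i. cmod (inverse \<gamma> * g (i + 1) - 2 ^ n * y (n + i)) < e / (2 * cmod \<gamma>)"
      using y(2)[of "\<lambda>i. inverse \<gamma> * g (i + 1)" "e / (2 * cmod \<gamma>)" "Arg t"] unfolding t by blast
    have scale: "cmod (\<gamma> * c) < e / 2" if "cmod c < e / (2 * cmod \<gamma>)" for c
      using that \<gamma>0 by (simp add: norm_mult field_simps)
    have "cmod (g i - \<gamma> * (rotation_plus_shift u ^^ n) x i) \<le> e" for i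
    proof (cases i)
      case 0
      have eq: "g 0 - \<gamma> * u ^ n = (g 0 - z) - \<gamma> * (u ^ n - t)" by (simp add: \<gamma>(3) algebra_simps)
      have "cmod (g 0 - z) < e / 2" using z(2) by (simp add: dist_norm norm_minus_commute)
      then have "cmod (g 0 - \<gamma> * u ^ n) < e"
        using scale[OF n(1)] norm_triangle_ineq4[of "g 0 - z" "\<gamma> * (u ^ n - t)"] unfolding eq by linarith
      then show ?thesis by (simp add: 0 rotation_plus_shift_power x_def)
    next
      case (Suc i')
      have "\<gamma> * (inverse \<gamma> * g (i' + 1) - 2 ^ n * y (n + i')) = g i - \<gamma> * (2 ^ n * y (n + i'))"
        using \<gamma>0 Suc by (simp add: right_diff_distrib flip: mult.assoc)
      then have "cmod (g i - \<gamma> * (2 ^ n * y (n + i'))) < e / 2" using scale[OF n(2)[of i']] by simp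
      then show ?thesis using Suc e by (simp add: rotation_plus_shift_power x_def)
    qed
    then show "\<exists>\<gamma>\<in>\<Gamma>. \<exists>n. \<forall>i. cmod (g i - \<gamma> * (rotation_plus_shift u ^^ n) x i) \<le> e" using \<gamma>(1) by blast
  qed
  show ?thesis
  proof (rule not_scalar_set[OF rotation_plus_shift_operator x _ d(1) approx])
    show "g0 \<in> null_sequences" by (rule null_sequences_finite_support[of 1]) (simp add: g0_def)
    show "(\<lambda>i. 0) \<in> null_sequences" by (rule null_sequences_finite_support[of 0]) simp
    show "\<exists>i. cmod (0 - (rotation_plus_shift u ^^ n) x i) \<ge> 1" for n
      by (rule exI[of _ 0]) (simp add: rotation_plus_shift_power x_def norm_power u_def)
  qed auto
qed

text \<open>Forgetting the angle, the universal vector is hypercyclic for the doubled shift.\<close>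

lemma not_scalar_set_singleton_0: "\<not> somewhere_hypercyclic_scalar_set TYPE('a) {0}"
proof -
  obtain \<alpha> :: real where \<alpha>: "\<alpha> \<notin> \<rat>" using irrational_exists .
  obtain y where y: "y \<in> null_sequences"
    "\<And>g \<theta> e. g \<in> null_sequences \<Longrightarrow> e > 0 \<Longrightarrow>
       \<exists>n. cmod (cis (2 * pi * \<alpha>) ^ n - cis \<theta>) < e \<and> (\<forall>i. cmod (g i - 2 ^ n * y (n + i)) < e)"
    using universal_shift_rotation_orbit[OF \<alpha>] by metis
  show ?thesis
  proof (rule not_scalar_set_zero[OF weighted_shift_operator[of 2] y(1)])
    show "scalar_approximable (weighted_shift 2) {1} y g" if "g \<in> null_sequences" for g
      unfolding scalar_approximable_def using y(2)[OF that] by (simp add: weighted_shift_power) (meson less_imp_le)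
  qed
qed

end

section \<open>From the saturated set back to the scalars\<close>

lemma circle_saturation_superset: "\<Gamma> \<subseteq> circle_saturation \<Gamma>"
  unfolding circle_saturation_def by (force intro: exI[of _ 1])

theorem theoremB:
  fixes \<Gamma> :: "complex set" and emb :: "complex \<Rightarrow> 'a"
  assumes universe_large: "inj emb"
    and nonempty: "\<Gamma> \<noteq> {}"
  shows "somewhere_hypercyclic_scalar_set TYPE('a) \<Gamma> \<longleftrightarrow>
    (let A = closure (circle_saturation \<Gamma>) - {0}
     in A \<noteq> {} \<and> bounded A \<and> bounded_away_from_0 A \<and> interior A = {})"
proof -
  define A where "A = closure (circle_saturation \<Gamma>) - {0}"
  \<comment> \<open>Moduli in \<open>A\<close> are limits of moduli in \<open>\<Gamma>\<close>, so
    unboundedness and accumulation at 0 are inherited by the scalars themselves.\<close>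
  have near_A: "\<exists>\<gamma>\<in>\<Gamma>. \<bar>cmod \<gamma> - cmod z\<bar> < e" if z: "z \<in> A" and e: "e > 0" for z e
  proof -
    obtain w where "w \<in> circle_saturation \<Gamma>" "dist w z < e"
      using z e by (auto simp: A_def closure_approachable)
    then obtain \<gamma> t where "\<gamma> \<in> \<Gamma>" "cmod t = 1" "dist (\<gamma> * t) z < e" by (auto simp: circle_saturation_def)
    then show ?thesis using norm_triangle_ineq3[of "\<gamma> * t" z] by (auto simp: dist_norm norm_mult intro!: bexI[of _ \<gamma>])
  qed
  obtain j :: "(nat \<Rightarrow> complex) \<Rightarrow> 'a" where "inj j" using inj_sequences_of_inj_complex[OF universe_large] .
  then interpret sequence_copy j by unfold_locales
  have "somewhere_hypercyclic_scalar_set TYPE('a) \<Gamma> \<longleftrightarrow>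
      A \<noteq> {} \<and> bounded A \<and> bounded_away_from_0 A \<and> interior A = {}"
  proof (intro iffI conjI)
    assume scalar: "somewhere_hypercyclic_scalar_set TYPE('a) \<Gamma>"
    show "A \<noteq> {}"
    proof
      assume "A = {}"
      then have "\<Gamma> \<subseteq> {0}" using circle_saturation_superset[of \<Gamma>] closure_subset[of "circle_saturation \<Gamma>"]
        unfolding A_def by blast
      then have "\<Gamma> = {0}" using nonempty by blast
      then show False using scalar not_scalar_set_singleton_0 by simp
    qed
    show "bounded A"
    proof (rule ccontr)
      assume nb: "\<not> bounded A"
      have "\<exists>\<gamma>\<in>\<Gamma>. cmod \<gamma> \<ge> C" for C
      proof -
        obtain z where "z \<in> A" "cmod z > C + 1" using nb unfolding bounded_iff by (meson not_le)
        then obtain \<gamma> where "\<gamma> \<in> \<Gamma>" "\<bar>cmod \<gamma> - cmod z\<bar> < 1" using near_A[of z 1] by auto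
        then show ?thesis using \<open>cmod z > C + 1\<close> by (intro bexI[of _ \<gamma>]) linarith+
      qed
      then show False using not_scalar_set_unbounded scalar by blast
    qed
    show "bounded_away_from_0 A"
    proof (rule ccontr)
      assume nb: "\<not> bounded_away_from_0 A"
      have "\<exists>\<gamma>\<in>\<Gamma>. \<gamma> \<noteq> 0 \<and> cmod \<gamma> \<le> \<delta>" if "\<delta> > 0" for \<delta>
      proof -
        obtain z where z: "z \<in> A" "cmod z < \<delta> / 2"
          using nb \<open>\<delta> > 0\<close> unfolding bounded_away_from_0_def by (meson half_gt_zero not_le)
        then have "cmod z > 0" by (auto simp: A_def)
        \<comment> \<open>The tolerance \<open>cmod z\<close> meets both demands:
          \<open>\<gamma>\<close> is non-zero, and its modulus is below \<open>2 * cmod z\<close>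
          and hence below \<open>\<delta>\<close>.\<close>
        then obtain \<gamma> where "\<gamma> \<in> \<Gamma>" "\<bar>cmod \<gamma> - cmod z\<bar> < cmod z" using near_A[OF z(1)] by blast
        then show ?thesis using z(2) by (intro bexI[of _ \<gamma>]) auto
      qed
      then show False using not_scalar_set_near_0 scalar by blast
    qed
    show "interior A = {}" using not_scalar_set_interior[of \<Gamma>] scalar unfolding A_def by blast
  next
    assume A: "A \<noteq> {} \<and> bounded A \<and> bounded_away_from_0 A \<and> interior A = {}"
    then obtain z where z: "z \<in> A" by blast
    then have "cmod z > 0" by (auto simp: A_def)
    then obtain \<gamma> where \<gamma>: "\<gamma> \<in> \<Gamma>" "\<bar>cmod \<gamma> - cmod z\<bar> < cmod z" using near_A[OF z] by blast
    then have "\<gamma> \<noteq> 0" by auto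
    show "somewhere_hypercyclic_scalar_set TYPE('a) \<Gamma>"
      unfolding somewhere_hypercyclic_scalar_set_def
    proof (intro allI impI ballI)
      fix X :: "'a normed_module" and T x
      assume "complex_banach_space X" "T \<in> bounded_operators X" "x \<in> carrier X"
      then interpret X: operator_orbit X T x
        unfolding operator_orbit_def operator_orbit_axioms_def complex_banach_space_def by blast
      show "somewhere_dense X (scalar_orbit X \<Gamma> x T) \<longleftrightarrow> hypercyclic_vector X T x"
        using X.hypercyclic_of_somewhere_dense[of \<Gamma>] X.somewhere_dense_of_hypercyclic[OF _ \<gamma>(1) \<open>\<gamma> \<noteq> 0\<close>]
          A unfolding A_def by blast
    qed
  qed
  then show ?thesis by (simp add: A_def Let_def)
qed

end
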